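(* Let $(A,\mathfrak{m})$ be a Noetherian local ring with infinite residue field, let $M$ be a finitely generated $A$-module, let $J$ be an $\mathfrak{m}$-primary ideal and $\mathbf{I}=I_1,\ldots,I_d$ ideals of $A$, and let $(k_0,\mathbf{k})\in\mathbb{N}^{d+1}$. Assume that $\bigtriangleup^{(k_0,\mathbf{k})}P(n_0,\mathbf{n},J,\mathbf{I},M)$ is a constant. Put $n=k_0+|\mathbf{k}|+1$. Then the following statements are equivalent: (i) $\bigtriangleup^{(k_0,\mathbf{k})}P(n_0,\mathbf{n},J,\mathbf{I},M)$ is positive. (ii) Every weak-(FC)-sequence $x_1,\ldots,x_n$ with $x_n\in J$ of $\mathbf{I},J$ with respect to $M$ of the type $(\mathbf{k},k_0+1)$ is maximal. (iii) There exists a maximal weak-(FC)-sequence $x_1,\ldots,x_n$ with $x_n\in J$ of $\mathbf{I},J$ with respect to $M$ of the type $(\mathbf{k},k_0+1)$. (iv) For any joint reduction $x_1,\ldots,x_n$ of $\mathbf{I},J$ with respect to $M$ of the type $(\mathbf{k},k_0+1)$ with $x_n\in J$, the sequence $x_1,\ldots,x_{n-1}$ is not a joint reduction of $\mathbf{I},J$ with respect to $M$. (v) Every joint reduction of $\mathbf{I},J$ with respect to $M$ of the type $(\mathbf{k},k_0+1)$ is minimal. (vi) There exists a minimal joint reduction of $\mathbf{I},J$ with respect to $M$ of the type $(\mathbf{k},k_0+1)$.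
   Context: Notation: $\mathbf{n}=(n_1,\ldots,n_d)$, $\mathbf{k}=(k_1,\ldots,k_d)\in\mathbb{N}^d$ ($0\in\mathbb{N}$), $|\mathbf{k}|=k_1+\cdots+k_d$, $\mathbf{e}_i$ is the $i$th standard unit vector, $\mathbb{I}^{\mathbf{n}}=I_1^{n_1}\cdots I_d^{n_d}$, $I=I_1\cdots I_d$. "For all large $n_0,\mathbf{n}$" means whenever all coordinates are sufficiently large. For integer tuples, $\mathbf{m}>\mathbf{n}$ means $m_i\ge n_i$ for all $i$ with at least one strict inequality. $P(n_0,\mathbf{n},J,\mathbf{I},M)$ is the polynomial that agrees with $\ell_A\big(J^{n_0}\mathbb{I}^{\mathbf{n}}M/J^{n_0+1}\mathbb{I}^{\mathbf{n}}M\big)$ for all large $n_0,\mathbf{n}$. Differences: for a numerical polynomial $f(\mathbf{n})$, $\bigtriangleup^{\mathbf{0}}f=f$, $\bigtriangleup^{\mathbf{e}_i}f(\mathbf{n})=f(\mathbf{n})-f(\mathbf{n}-\mathbf{e}_i)$, and $\bigtriangleup^{\mathbf{k}}f=\bigtriangleup^{\mathbf{e}_i}(\bigtriangleup^{\mathbf{k}-\mathbf{e}_i}f)$ for $\mathbf{k}\ge\mathbf{e}_i$; likewise in the variables $(n_0,\mathbf{n})$. Sequences and types: a sequence of the type $(\mathbf{k},h)$ in $\mathbf{I},J$ consists of $k_i$ elements taken from $I_i$ ($1\le i\le d$) and $h$ elements taken from $J$; the condition "$x_n\in J$" means that $x_n$ is one of the elements taken from $J$. Joint reductions: let $\mathfrak{I}_i$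 be a sequence of $k_i$ elements of $I_i$ ($1\le i\le d$) and $\mathfrak{I}_0$ a sequence of $h$ elements of $J$ (the empty sequence generates the zero ideal). The sequence $\mathfrak{I}_1,\ldots,\mathfrak{I}_d,\mathfrak{I}_0$ is a joint reduction of $\mathbf{I},J$ with respect to $M$ of the type $(\mathbf{k},h)$ if $J^{n_0}\mathbb{I}^{\mathbf{n}}M=(\mathfrak{I}_0)J^{n_0-1}\mathbb{I}^{\mathbf{n}}M+\sum_{i=1}^d(\mathfrak{I}_i)J^{n_0}\mathbb{I}^{\mathbf{n}-\mathbf{e}_i}M$ for all large $n_0,\mathbf{n}$. In (iv), $x_1,\ldots,x_{n-1}$ is regarded as a sequence of the type $(\mathbf{k},k_0)$. A joint reduction of the type $(\mathbf{k},h)$ is minimal if no sequence in $\mathbf{I},J$ of a type strictly smaller than $(\mathbf{k},h)$ is a joint reduction of $\mathbf{I},J$ with respect to $M$. Weak-(FC)-sequences: an element $x\in A$ is a weak-(FC)-element of $\mathbf{I},J$ with respect to $M$ if (FC1) either $x\in I_i$ for some $1\le i\le d$ and $xM\cap J^{n_0}\mathbb{I}^{\mathbf{n}}M=xJ^{n_0}\mathbb{I}^{\mathbf{n}-\mathbf{e}_i}M$ for all large $n_0,\mathbf{n}$, or $x\in J$ and $xM\cap J^{n_0}\mathbb{I}^{\mathbf{n}}M=xJ^{n_0-1}\mathbb{I}^{\mathbf{n}}M$ for all large $n_0,\mathbf{n}$; and (FC2) $0_M:x\subseteq 0_M:(IJ)^\infty$, where $0_M:\mathfrak{a}^\infty=\bigcup_{m}(0_M:\mathfrak{a}^m)$.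 With $M_i=M/(x_1,\ldots,x_i)M$, a sequence $x_1,\ldots,x_t$ is a weak-(FC)-sequence of $\mathbf{I},J$ with respect to $M$ if $x_{i+1}$ is a weak-(FC)-element of $\mathbf{I},J$ with respect to $M_i$ for all $0\le i\le t-1$ (condition (FC1) being taken with respect to the ideal from which $x_{i+1}$ is taken). A weak-(FC)-sequence $x_1,\ldots,x_t$ of $\mathbf{I},J$ with respect to $M$ is maximal if $IJ\nsubseteq\sqrt{\mathrm{Ann}(M_{t-1})}$ and $IJ\subseteq\sqrt{\mathrm{Ann}(M_t)}$. *)

theory Defs
  imports "HOL-Algebra.Ring_Divisibility" "HOL-Algebra.Ideal_Product" "HOL-Algebra.QuotRing"
    "HOL-Algebra.Generated_Groups" "HOL-Algebra.Module" "HOL-Library.Extended_Nat"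
begin

text \<open>
  Families indexed by \<open>{0..d}\<close> are functions on \<open>nat\<close>; only the values at \<open>i \<le> d\<close> matter.
  Throughout, \<open>K\<close> is the family of ideals with \<open>K 0 = J\<close> and \<open>K i = I\<^sub>i\<close> for \<open>1 \<le> i \<le> d\<close>.
  Likewise an exponent \<open>v\<close> stands for \<open>(n\<^sub>0, n\<^sub>1, \<dots>, n\<^sub>d)\<close>, and the type \<open>(\<^bold>k, h)\<close> of a
  sequence for the function \<open>\<tau>\<close> with \<open>\<tau> 0 = h\<close> and \<open>\<tau> i = k\<^sub>i\<close>.
\<close>


subsection \<open>Local rings and primary ideals\<close>

definition local_ring :: "('a, 'r) ring_scheme \<Rightarrow> 'a set \<Rightarrow> bool" where
  "local_ring A \<mm> \<longleftrightarrow> cring A \<and> maximalideal \<mm> A \<and> (\<forall>\<nn>. maximalideal \<nn> A \<longrightarrow> \<nn> = \<mm>)"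

definition ideal_radical :: "('a, 'r) ring_scheme \<Rightarrow> 'a set \<Rightarrow> 'a set" where
  "ideal_radical A Q = {a \<in> carrier A. \<exists>n::nat. a [^]\<^bsub>A\<^esub> n \<in> Q}"

definition primary_ideal :: "('a, 'r) ring_scheme \<Rightarrow> 'a set \<Rightarrow> bool" where
  "primary_ideal A Q \<longleftrightarrow> ideal Q A \<and> Q \<noteq> carrier A \<and>
     (\<forall>a\<in>carrier A. \<forall>b\<in>carrier A. a \<otimes>\<^bsub>A\<^esub> b \<in> Q \<longrightarrow> a \<in> Q \<or> b \<in> ideal_radical A Q)"

definition primary_to :: "('a, 'r) ring_scheme \<Rightarrow> 'a set \<Rightarrow> 'a set \<Rightarrow> bool" where
  "primary_to A \<pp> Q \<longleftrightarrow> primary_ideal A Q \<and> ideal_radical A Q = \<pp>"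


subsection \<open>Modules\<close>

text \<open>For an ideal \<open>\<aa>\<close> and a submodule \<open>N\<close> the additive subgroup generated by the
  products is the submodule \<open>\<aa>N\<close>.\<close>

definition ideal_smult :: "('a, 'b, 'm) module_scheme \<Rightarrow> 'a set \<Rightarrow> 'b set \<Rightarrow> 'b set" where
  "ideal_smult M \<aa> N = generate (add_monoid M) {a \<odot>\<^bsub>M\<^esub> x | a x. a \<in> \<aa> \<and> x \<in> N}"

definition elem_smult :: "('a, 'b, 'm) module_scheme \<Rightarrow> 'a \<Rightarrow> 'b set \<Rightarrow> 'b set" where
  "elem_smult M x N = (\<lambda>y. x \<odot>\<^bsub>M\<^esub> y) ` N"

definition finitely_generated_module ::
    "('a, 'r) ring_scheme \<Rightarrow> ('a, 'b, 'm) module_scheme \<Rightarrow> bool" where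
  "finitely_generated_module A M \<longleftrightarrow>
     (\<exists>G. finite G \<and> G \<subseteq> carrier M \<and> carrier M = ideal_smult M (carrier A) G)"

text \<open>The quotient \<open>M/N\<close>. The fields \<open>mult\<close> and \<open>one\<close>, inherited from rings by the module
  record, play no role in a module.\<close>

definition factor_module ::
    "('a, 'b, 'm) module_scheme \<Rightarrow> 'b set \<Rightarrow> ('a, 'b set) module" where
  "factor_module M N =
     \<lparr>carrier = a_rcosets\<^bsub>M\<^esub> N, monoid.mult = undefined, monoid.one = undefined,
      ring.zero = N, ring.add = set_add M,
      module.smult = (\<lambda>a C. \<Union>x\<in>C. N +>\<^bsub>M\<^esub> (a \<odot>\<^bsub>M\<^esub> x))\<rparr>"

lemma (in module) factor_module_smult:
  assumes N: "submodule N R M" and a: "a \<in> carrier R" and x: "x \<in> carrier M"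
  shows "a \<odot>\<^bsub>factor_module M N\<^esub> (N +>\<^bsub>M\<^esub> x) = N +>\<^bsub>M\<^esub> (a \<odot>\<^bsub>M\<^esub> x)"
proof -
  have sg: "abelian_subgroup N M"
    using N by (simp add: abelian_subgroupI3 additive_subgroup_def submodule.axioms(1)
        M.abelian_group_axioms)
  interpret S: abelian_subgroup N M by (rule sg)
  have NM: "N \<subseteq> carrier M" by (rule S.a_subset)
  have eq: "N +>\<^bsub>M\<^esub> (a \<odot>\<^bsub>M\<^esub> y) = N +>\<^bsub>M\<^esub> (a \<odot>\<^bsub>M\<^esub> x)" if "y \<in> N +>\<^bsub>M\<^esub> x" for y
  proof -
    from that obtain h where h: "h \<in> N" and y: "y = h \<oplus>\<^bsub>M\<^esub> x"
      by (auto simp: a_r_coset_def')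
    have "a \<odot>\<^bsub>M\<^esub> y = a \<odot>\<^bsub>M\<^esub> h \<oplus>\<^bsub>M\<^esub> a \<odot>\<^bsub>M\<^esub> x"
      using h y a x NM by (auto simp: smult_r_distr)
    moreover have "a \<odot>\<^bsub>M\<^esub> h \<in> N"
      using submoduleE(4)[OF N] a h by blast
    ultimately have "a \<odot>\<^bsub>M\<^esub> y \<in> N +>\<^bsub>M\<^esub> (a \<odot>\<^bsub>M\<^esub> x)"
      by (auto simp: a_r_coset_def')
    thus ?thesis using S.a_repr_independence'[of "a \<odot>\<^bsub>M\<^esub> y"] a x by auto
  qed
  have "a \<odot>\<^bsub>factor_module M N\<^esub> (N +>\<^bsub>M\<^esub> x) = (\<Union>y\<in>N +>\<^bsub>M\<^esub> x. N +>\<^bsub>M\<^esub> (a \<odot>\<^bsub>M\<^esub> y))"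
    by (simp add: factor_module_def)
  also have "\<dots> = (\<Union>y\<in>N +>\<^bsub>M\<^esub> x. N +>\<^bsub>M\<^esub> (a \<odot>\<^bsub>M\<^esub> x))"
    by (rule SUP_cong[OF refl eq])
  also have "\<dots> = N +>\<^bsub>M\<^esub> (a \<odot>\<^bsub>M\<^esub> x)"
    using S.a_rcos_self[OF x] by blast
  finally show ?thesis .
qed

lemma (in module) factor_module_is_module:
  assumes N: "submodule N R M"
  shows "module R (factor_module M N)"
proof -
  have sg: "abelian_subgroup N M"
    using N by (simp add: abelian_subgroupI3 additive_subgroup_def submodule.axioms(1)
        M.abelian_group_axioms)
  interpret S: abelian_subgroup N M by (rule sg)
  let ?Q = "factor_module M N"
  have carr: "carrier ?Q = (\<Union>x\<in>carrier M. {N +>\<^bsub>M\<^esub> x})"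
    by (simp add: factor_module_def A_RCOSETS_def')
  have add: "(N +>\<^bsub>M\<^esub> x) \<oplus>\<^bsub>?Q\<^esub> (N +>\<^bsub>M\<^esub> y) = N +>\<^bsub>M\<^esub> (x \<oplus>\<^bsub>M\<^esub> y)"
    if "x \<in> carrier M" "y \<in> carrier M" for x y
    using that by (simp add: factor_module_def S.a_rcos_sum)
  show ?thesis
  proof (rule moduleI)
    show "cring R" by (rule is_cring)
    show "abelian_group ?Q"
    proof (rule abelian_groupI)
      have "N +>\<^bsub>M\<^esub> \<zero>\<^bsub>M\<^esub> = N"
        by (simp add: S.a_subset)
      hence zero: "\<zero>\<^bsub>?Q\<^esub> = N +>\<^bsub>M\<^esub> \<zero>\<^bsub>M\<^esub>"
        by (simp add: factor_module_def)
      show "\<zero>\<^bsub>?Q\<^esub> \<in> carrier ?Q"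
        using zero by (auto simp: carr)
      fix X assume X: "X \<in> carrier ?Q"
      show "\<zero>\<^bsub>?Q\<^esub> \<oplus>\<^bsub>?Q\<^esub> X = X"
        using X zero by (auto simp: carr add)
      from X obtain x where x: "x \<in> carrier M" "X = N +>\<^bsub>M\<^esub> x"
        by (auto simp: carr)
      hence "(N +>\<^bsub>M\<^esub> (\<ominus>\<^bsub>M\<^esub> x)) \<oplus>\<^bsub>?Q\<^esub> X = \<zero>\<^bsub>?Q\<^esub>"
        by (simp add: add zero M.l_neg)
      thus "\<exists>Y\<in>carrier ?Q. Y \<oplus>\<^bsub>?Q\<^esub> X = \<zero>\<^bsub>?Q\<^esub>"
        using x by (auto simp: carr)
    qed (auto simp: carr add M.a_ac)
  qed (auto simp: carr add factor_module_smult[OF N] smult_l_distr smult_r_distr smult_assoc1)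
qed

definition module_length ::
    "('a, 'r) ring_scheme \<Rightarrow> ('a, 'b, 'm) module_scheme \<Rightarrow> enat" where
  "module_length A M = Sup {enat n | n. \<exists>N :: nat \<Rightarrow> 'b set.
     (\<forall>i\<le>n. submodule (N i) A M) \<and> (\<forall>i<n. N i \<subset> N (Suc i))}"

definition module_annihilator ::
    "('a, 'r) ring_scheme \<Rightarrow> ('a, 'b, 'm) module_scheme \<Rightarrow> 'a set" where
  "module_annihilator A M = {a \<in> carrier A. \<forall>y\<in>carrier M. a \<odot>\<^bsub>M\<^esub> y = \<zero>\<^bsub>M\<^esub>}"

definition zero_colon :: "('a, 'b, 'm) module_scheme \<Rightarrow> 'a set \<Rightarrow> 'b set" where
  "zero_colon M \<aa> = {y \<in> carrier M. \<forall>a\<in>\<aa>. a \<odot>\<^bsub>M\<^esub> y = \<zero>\<^bsub>M\<^esub>}"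

text \<open>\<open>ideals_set A\<close> is the multiplicative monoid of ideals, so \<open>[^]\<close> is the power of an ideal.\<close>

definition zero_colon_inf ::
    "('a, 'r) ring_scheme \<Rightarrow> ('a, 'b, 'm) module_scheme \<Rightarrow> 'a set \<Rightarrow> 'b set" where
  "zero_colon_inf A M \<aa> = (\<Union>m::nat. zero_colon M (\<aa> [^]\<^bsub>ideals_set A\<^esub> m))"


subsection \<open>Products of powers of the ideals\<close>

definition power_product ::
    "('a, 'r) ring_scheme \<Rightarrow> nat \<Rightarrow> (nat \<Rightarrow> 'a set) \<Rightarrow> (nat \<Rightarrow> nat) \<Rightarrow> 'a set" where
  "power_product A d K v = (\<Otimes>\<^bsub>ideals_set A\<^esub>i\<in>{0..d}. K i [^]\<^bsub>ideals_set A\<^esub> v i)"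

text \<open>The submodule \<open>J\<^bsup>n\<^sub>0\<^esup> I\<^sub>1\<^bsup>n\<^sub>1\<^esup> \<cdots> I\<^sub>d\<^bsup>n\<^sub>d\<^esup> M\<close>.\<close>

definition power_submodule ::
    "('a, 'r) ring_scheme \<Rightarrow> nat \<Rightarrow> (nat \<Rightarrow> 'a set) \<Rightarrow> ('a, 'b, 'm) module_scheme \<Rightarrow>
     (nat \<Rightarrow> nat) \<Rightarrow> 'b set" where
  "power_submodule A d K M v = ideal_smult M (power_product A d K v) (carrier M)"

text \<open>The ideal \<open>IJ = J I\<^sub>1 \<cdots> I\<^sub>d\<close>.\<close>

definition product_ideal :: "('a, 'r) ring_scheme \<Rightarrow> nat \<Rightarrow> (nat \<Rightarrow> 'a set) \<Rightarrow> 'a set" where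
  "product_ideal A d K = power_product A d K (\<lambda>_. 1)"

definition for_all_large :: "nat \<Rightarrow> ((nat \<Rightarrow> nat) \<Rightarrow> bool) \<Rightarrow> bool" where
  "for_all_large d Q \<longleftrightarrow> (\<exists>N. \<forall>v. (\<forall>i\<le>d. N \<le> v i) \<longrightarrow> Q v)"

definition lower :: "nat \<Rightarrow> (nat \<Rightarrow> nat) \<Rightarrow> nat \<Rightarrow> nat" where
  "lower i v = v(i := v i - 1)"


subsection \<open>Numerical polynomials and differences\<close>

text \<open>A polynomial in the variables \<open>v 0, \<dots>, v d\<close> with rational coefficients, given as the
  integer-valued function it defines on the integers: \<open>c a\<close> is the coefficient of the monomial
  with exponent \<open>a\<close>.\<close>

definition numerical_polynomial :: "nat \<Rightarrow> ((nat \<Rightarrow> int) \<Rightarrow> int) \<Rightarrow> bool" where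
  "numerical_polynomial d f \<longleftrightarrow> (\<exists>(S :: (nat \<Rightarrow> nat) set) (c :: (nat \<Rightarrow> nat) \<Rightarrow> rat). finite S \<and>
     (\<forall>v. of_int (f v) = (\<Sum>a\<in>S. c a * (\<Prod>i\<in>{0..d}. of_int (v i) ^ a i))))"

definition backward_diff :: "nat \<Rightarrow> ((nat \<Rightarrow> int) \<Rightarrow> int) \<Rightarrow> (nat \<Rightarrow> int) \<Rightarrow> int" where
  "backward_diff i f = (\<lambda>v. f v - f (v(i := v i - 1)))"

text \<open>The operators \<open>backward_diff i\<close> commute, so the order of composition is irrelevant.\<close>

definition iterated_diff ::
    "nat \<Rightarrow> (nat \<Rightarrow> nat) \<Rightarrow> ((nat \<Rightarrow> int) \<Rightarrow> int) \<Rightarrow> (nat \<Rightarrow> int) \<Rightarrow> int" where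
  "iterated_diff d \<kappa> f = fold (\<lambda>i. backward_diff i ^^ \<kappa> i) [0..<Suc d] f"

text \<open>\<open>P\<close> is the polynomial \<open>P(n\<^sub>0, \<^bold>n, J, \<^bold>I, M)\<close>. It is determined by the defining property
  below, since a polynomial is determined by its values at all large arguments.\<close>

definition is_hilbert_polynomial ::
    "('a, 'r) ring_scheme \<Rightarrow> nat \<Rightarrow> (nat \<Rightarrow> 'a set) \<Rightarrow> ('a, 'b, 'm) module_scheme \<Rightarrow>
     ((nat \<Rightarrow> int) \<Rightarrow> int) \<Rightarrow> bool" where
  "is_hilbert_polynomial A d K M P \<longleftrightarrow> numerical_polynomial d P \<and>
     for_all_large d (\<lambda>v. \<exists>l::nat.
       module_length A (factor_module (M\<lparr>carrier := power_submodule A d K M v\<rparr>)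
         (power_submodule A d K M (v(0 := v 0 + 1)))) = enat l \<and>
       P (\<lambda>i. int (v i)) = int l)"


subsection \<open>Sequences in the ideals\<close>

text \<open>A sequence is a list of pairs \<open>(x, i)\<close>, where \<open>i\<close> records the ideal \<open>K i\<close> from which \<open>x\<close> is
  taken; an element may lie in several of the ideals.\<close>

definition sequence_of_type ::
    "nat \<Rightarrow> (nat \<Rightarrow> 'a set) \<Rightarrow> (nat \<Rightarrow> nat) \<Rightarrow> ('a \<times> nat) list \<Rightarrow> bool" where
  "sequence_of_type d K \<tau> s \<longleftrightarrow>
     (\<forall>(x, i)\<in>set s. i \<le> d \<and> x \<in> K i) \<and> (\<forall>i\<le>d. count_list (map snd s) i = \<tau> i)"

definition type_less :: "nat \<Rightarrow> (nat \<Rightarrow> nat) \<Rightarrow> (nat \<Rightarrow> nat) \<Rightarrow> bool" where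
  "type_less d \<sigma> \<tau> \<longleftrightarrow> (\<forall>i\<le>d. \<sigma> i \<le> \<tau> i) \<and> (\<exists>i\<le>d. \<sigma> i < \<tau> i)"

text \<open>A sum of submodules is the additive subgroup generated by their union.\<close>

definition joint_reduction ::
    "('a, 'r) ring_scheme \<Rightarrow> nat \<Rightarrow> (nat \<Rightarrow> 'a set) \<Rightarrow> ('a, 'b, 'm) module_scheme \<Rightarrow>
     (nat \<Rightarrow> nat) \<Rightarrow> ('a \<times> nat) list \<Rightarrow> bool" where
  "joint_reduction A d K M \<tau> s \<longleftrightarrow> sequence_of_type d K \<tau> s \<and>
     for_all_large d (\<lambda>v. power_submodule A d K M v =
       generate (add_monoid M)
         (\<Union>i\<in>{0..d}. ideal_smult M (Idl\<^bsub>A\<^esub> {x. (x, i) \<in> set s})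
                                   (power_submodule A d K M (lower i v))))"

definition minimal_joint_reduction ::
    "('a, 'r) ring_scheme \<Rightarrow> nat \<Rightarrow> (nat \<Rightarrow> 'a set) \<Rightarrow> ('a, 'b, 'm) module_scheme \<Rightarrow>
     (nat \<Rightarrow> nat) \<Rightarrow> ('a \<times> nat) list \<Rightarrow> bool" where
  "minimal_joint_reduction A d K M \<tau> s \<longleftrightarrow> joint_reduction A d K M \<tau> s \<and>
     (\<forall>\<sigma> s'. type_less d \<sigma> \<tau> \<longrightarrow> \<not> joint_reduction A d K M \<sigma> s')"


subsection \<open>Weak-(FC)-sequences\<close>

text \<open>\<open>x\<close> is a weak-(FC)-element as an element taken from \<open>K i\<close>.\<close>

definition weak_FC_element ::
    "('a, 'r) ring_scheme \<Rightarrow> nat \<Rightarrow> (nat \<Rightarrow> 'a set) \<Rightarrow> ('a, 'b, 'm) module_scheme \<Rightarrow>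
     nat \<Rightarrow> 'a \<Rightarrow> bool" where
  "weak_FC_element A d K M i x \<longleftrightarrow> i \<le> d \<and> x \<in> K i \<and>
     for_all_large d (\<lambda>v. elem_smult M x (carrier M) \<inter> power_submodule A d K M v =
                          elem_smult M x (power_submodule A d K M (lower i v))) \<and>
     zero_colon M {x} \<subseteq> zero_colon_inf A M (product_ideal A d K)"

text \<open>\<open>M\<^sub>i = M/(x\<^sub>1, \<dots>, x\<^sub>i)M\<close>\<close>

definition quotient_by_initial ::
    "('a, 'r) ring_scheme \<Rightarrow> ('a, 'b, 'm) module_scheme \<Rightarrow> ('a \<times> nat) list \<Rightarrow> nat \<Rightarrow>
     ('a, 'b set) module" where
  "quotient_by_initial A M s i =
     factor_module M (ideal_smult M (Idl\<^bsub>A\<^esub> (fst ` set (take i s))) (carrier M))"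

definition weak_FC_sequence ::
    "('a, 'r) ring_scheme \<Rightarrow> nat \<Rightarrow> (nat \<Rightarrow> 'a set) \<Rightarrow> ('a, 'b, 'm) module_scheme \<Rightarrow>
     ('a \<times> nat) list \<Rightarrow> bool" where
  "weak_FC_sequence A d K M s \<longleftrightarrow> (\<forall>j<length s.
     weak_FC_element A d K (quotient_by_initial A M s j) (snd (s ! j)) (fst (s ! j)))"

definition maximal_weak_FC_sequence ::
    "('a, 'r) ring_scheme \<Rightarrow> nat \<Rightarrow> (nat \<Rightarrow> 'a set) \<Rightarrow> ('a, 'b, 'm) module_scheme \<Rightarrow>
     ('a \<times> nat) list \<Rightarrow> bool" where
  "maximal_weak_FC_sequence A d K M s \<longleftrightarrow> s \<noteq> [] \<and> weak_FC_sequence A d K M s \<and>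
     \<not> product_ideal A d K \<subseteq>
       ideal_radical A (module_annihilator A (quotient_by_initial A M s (length s - 1))) \<and>
     product_ideal A d K \<subseteq>
       ideal_radical A (module_annihilator A (quotient_by_initial A M s (length s)))"

end

theory Submission
  imports Defs "HOL-Library.Multiset"
begin

text \<open>
  Quotients \<open>M/N\<close> are replaced by submodules \<open>N\<close> of \<open>M\<close>, and \<open>U v\<close> denotes the submodule
  \<open>J\<^bsup>v 0\<^esup> I\<^sub>1\<^bsup>v 1\<^esup> \<cdots> I\<^sub>d\<^bsup>v d\<^esup> M\<close>.
  Passing from \<open>M/N\<close> to \<open>M/(xM + N)\<close> for a weak-(FC)-element \<open>x \<in> K i\<close> applies the difference
  operator \<open>\<Delta>\<^sub>i\<close> to the Hilbert function. A weak-(FC)-sequence of type \<open>\<kappa> = (k0, k)\<close> therefore leads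
  to a quotient with constant Hilbert function \<open>c \<ge> 0\<close>, which vanishes iff \<open>IJ\<close> is nilpotent on the
  quotient; one more element of \<open>J\<close> makes it vanish in any case. Moreover a weak-(FC)-sequence is
  a joint reduction iff \<open>IJ\<close> is nilpotent on the quotient by it.

  It remains to exclude joint reductions of a type \<open>\<sigma> < \<kappa> + e\<^sub>0\<close> when \<open>c > 0\<close>. Being a joint reduction
  is an open condition, so one of type \<open>\<sigma>\<close> can be moved into a weak-(FC)-sequence of the
  same type, whence \<open>\<Delta>\<^sup>\<sigma> P = 0\<close>. If \<open>\<sigma> \<le> \<kappa>\<close> this contradicts \<open>c > 0\<close>. Otherwise
  \<open>\<sigma> \<le> \<kappa> + e\<^sub>0 - e\<^sub>j\<close> for some \<open>j > 0\<close>, and \<open>Q = \<Delta>\<^sup>\<kappa>\<^sup>-\<^sup>e\<^sup>j P\<close> is the Hilbert function of a quotient with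
  \<open>\<Delta>\<^sub>0 Q = 0\<close> and \<open>\<Delta>\<^sub>j Q = c > 0\<close>, which the Artin-Rees lemma for \<open>J\<close> forbids.

  Both the Artin-Rees lemma and the existence of weak-(FC)-elements follow from the ascending
  chain condition for graded submodules of the Rees module \<open>\<Oplus>v. U v\<close>.
\<close>

section \<open>Submodules\<close>

text \<open>The main obstacle is genericity without primary decomposition. Instead of associated
  primes, finitely many proper subideals of \<open>K i\<close> describe the elements to be avoided.
  Since the residue field is infinite, a line \<open>x + t y\<close> meets their union for only
  finitely many \<open>t\<close> once \<open>y\<close> lies outside it. The same line deforms joint
  reductions, because surjectivity in a fixed degree also fails for only finitely many
  \<open>t\<close>; so one parameter meets both demands. Graded modules are never built: they are
  families of submodules of \<open>M\<close> indexed by exponents, and every uniform threshold comes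
  from a chain of such families becoming constant. Among the types below
  \<open>\<kappa> + e_0\<close>, the hard ones contain all \<open>k0 + 1\<close> elements of
  \<open>J\<close>. They are not below \<open>\<kappa>\<close>, so the vanishing of their difference
  says nothing about the constant itself; only a comparison of lengths in the direction of
  \<open>J\<close> excludes them.\<close>

lemma (in cring) cring_idealI:
  assumes "I \<subseteq> carrier R" "\<zero> \<in> I" "\<And>a b. a \<in> I \<Longrightarrow> b \<in> I \<Longrightarrow> a \<oplus> b \<in> I"
    and mult: "\<And>a x. a \<in> I \<Longrightarrow> x \<in> carrier R \<Longrightarrow> x \<otimes> a \<in> I"
  shows "ideal I R"
proof (rule idealI[OF ring_axioms _ mult])
  show "a \<otimes> x \<in> I" if "a \<in> I" "x \<in> carrier R" for a x
    using mult[OF that] that assms(1) by (simp add: m_comm subset_iff)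
  show "subgroup I (add_monoid R)"
  proof (rule add.subgroupI)
    show "\<ominus> a \<in> I" if "a \<in> I" for a
    proof -
      have "a \<in> carrier R" using that assms(1) by blast
      thus ?thesis using mult[OF that, of "\<ominus> \<one>"] l_minus[of \<one> a] by simp
    qed
  qed (use assms in auto)
qed

context module
begin

abbreviation madd (infixl \<open>\<oplus>\<^sub>M\<close> 65) where "x \<oplus>\<^sub>M y \<equiv> x \<oplus>\<^bsub>M\<^esub> y"
abbreviation mdiff (infixl \<open>\<ominus>\<^sub>M\<close> 65) where "x \<ominus>\<^sub>M y \<equiv> x \<ominus>\<^bsub>M\<^esub> y"
abbreviation mzero (\<open>\<zero>\<^sub>M\<close>) where "\<zero>\<^sub>M \<equiv> \<zero>\<^bsub>M\<^esub>"
abbreviation scale (infixl \<open>\<bullet>\<close> 70) where "a \<bullet> x \<equiv> a \<odot>\<^bsub>M\<^esub> x"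
abbreviation msum (infixl \<open>\<uplus>\<close> 60) where "N \<uplus> N' \<equiv> N <+>\<^bsub>M\<^esub> N'"

abbreviation sm :: "'c set \<Rightarrow> bool" where "sm N \<equiv> submodule N R M"

lemma sm_carrier: "sm N \<Longrightarrow> N \<subseteq> carrier M"
  by (rule submoduleE)

lemma sm_mem: "sm N \<Longrightarrow> z \<in> N \<Longrightarrow> z \<in> carrier M"
  using sm_carrier by blast

lemma sm_add: "sm N \<Longrightarrow> y \<in> N \<Longrightarrow> z \<in> N \<Longrightarrow> y \<oplus>\<^sub>M z \<in> N"
  by (rule submoduleE(5))

lemma sm_smult: "sm N \<Longrightarrow> a \<in> carrier R \<Longrightarrow> z \<in> N \<Longrightarrow> a \<bullet> z \<in> N"
  by (rule submoduleE(4))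

lemma sm_uminus: "sm N \<Longrightarrow> z \<in> N \<Longrightarrow> \<ominus>\<^bsub>M\<^esub> z \<in> N"
  by (rule submoduleE(3))

lemma sm_minus: "sm N \<Longrightarrow> y \<in> N \<Longrightarrow> z \<in> N \<Longrightarrow> y \<ominus>\<^sub>M z \<in> N"
  by (simp add: M.minus_eq sm_add sm_uminus)

lemma sm_zero: "sm N \<Longrightarrow> \<zero>\<^sub>M \<in> N"
  using subgroup.one_closed[of N "add_monoid M"] by (auto simp: submodule_def)

lemma diff_add_cancel [simp]:
  assumes "y \<in> carrier M" "z \<in> carrier M"
  shows "(y \<ominus>\<^sub>M z) \<oplus>\<^sub>M z = y" "z \<oplus>\<^sub>M (y \<ominus>\<^sub>M z) = y"
        "(y \<oplus>\<^sub>M z) \<ominus>\<^sub>M z = y" "(z \<oplus>\<^sub>M y) \<ominus>\<^sub>M z = y"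
  using assms by (simp_all add: M.minus_eq M.a_assoc M.l_neg M.r_neg M.a_comm[of z] M.r_neg1)

lemma smult_diff:
  assumes "a \<in> carrier R" "y \<in> carrier M" "z \<in> carrier M"
  shows "a \<bullet> (y \<ominus>\<^sub>M z) = a \<bullet> y \<ominus>\<^sub>M a \<bullet> z"
  using assms by (simp add: M.minus_eq smult_r_distr smult_r_minus)

lemma smult_diff_left:
  assumes "a \<in> carrier R" "b \<in> carrier R" "z \<in> carrier M"
  shows "(a \<ominus> b) \<bullet> z = a \<bullet> z \<ominus>\<^sub>M b \<bullet> z"
  using assms by (simp add: M.minus_eq R.minus_eq smult_l_distr smult_l_minus)

lemma smult_commute:
  assumes "a \<in> carrier R" "b \<in> carrier R" "z \<in> carrier M"
  shows "a \<bullet> (b \<bullet> z) = b \<bullet> (a \<bullet> z)"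
  using assms by (metis R.m_comm smult_assoc1)

lemma sm_add_cancel_left:
  assumes "sm N" "y \<in> N" "z \<in> carrier M" "y \<oplus>\<^sub>M z \<in> N" shows "z \<in> N"
  using sm_minus[OF assms(1,4,2)] assms sm_mem by auto

lemma sm_add_cancel_right:
  assumes "sm N" "z \<in> N" "y \<in> carrier M" "y \<oplus>\<^sub>M z \<in> N" shows "y \<in> N"
  using sm_minus[OF assms(1,4,2)] assms sm_mem by auto

lemma sm_diff_cancel:
  assumes "sm N" "y \<in> carrier M" "z \<in> N" "y \<ominus>\<^sub>M z \<in> N" shows "y \<in> N"
  using sm_add[OF assms(1,4,3)] assms sm_mem by auto

lemma smI:
  assumes "H \<subseteq> carrier M" "\<zero>\<^sub>M \<in> H"
    and "\<And>a b. a \<in> H \<Longrightarrow> b \<in> H \<Longrightarrow> a \<oplus>\<^sub>M b \<in> H"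
    and "\<And>a x. a \<in> carrier R \<Longrightarrow> x \<in> H \<Longrightarrow> a \<bullet> x \<in> H"
  shows "sm H"
proof (rule submoduleI)
  fix a assume a: "a \<in> H"
  have "\<ominus>\<^bsub>M\<^esub> a = (\<ominus> \<one>) \<bullet> a"
    using a assms(1) by (simp add: smult_l_minus subsetD)
  thus "\<ominus>\<^bsub>M\<^esub> a \<in> H" using assms(4)[OF _ a] by simp
qed (use assms in auto)

lemma sm_carrier_whole: "sm (carrier M)"
  by (rule carrier_is_submodule)

lemma sm_zero_set: "sm {\<zero>\<^sub>M}"
  by (rule smI) auto

lemma sm_Int: "sm N \<Longrightarrow> sm N' \<Longrightarrow> sm (N \<inter> N')"
  by (rule smI) (auto simp: sm_mem sm_zero sm_add sm_smult)

lemma sm_UN_chain: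
  assumes sm: "\<And>n::nat. sm (F n)" and mono: "\<And>n. F n \<subseteq> F (Suc n)"
  shows "sm (\<Union>n. F n)"
proof (rule smI)
  have le: "F m \<subseteq> F n" if "m \<le> n" for m n by (rule lift_Suc_mono_le[of F, OF mono that])
  fix a b assume "a \<in> (\<Union>n. F n)" "b \<in> (\<Union>n. F n)"
  then obtain m n where "a \<in> F m" "b \<in> F n" by auto
  hence "a \<in> F (max m n)" "b \<in> F (max m n)" using le[of m "max m n"] le[of n "max m n"] by auto
  thus "a \<oplus>\<^sub>M b \<in> (\<Union>n. F n)" using sm_add[OF sm] by blast
next
  show "(\<Union>n. F n) \<subseteq> carrier M" using sm_carrier[OF sm] by blast
  show "\<zero>\<^sub>M \<in> (\<Union>n. F n)" using sm_zero[OF sm] by blast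
  show "a \<bullet> x \<in> (\<Union>n. F n)" if "a \<in> carrier R" "x \<in> (\<Union>n. F n)" for a x
    using sm_smult[OF sm] that by blast
qed

lemma mem_ssum: "z \<in> N \<uplus> N' \<longleftrightarrow> (\<exists>a\<in>N. \<exists>b\<in>N'. z = a \<oplus>\<^sub>M b)"
  by (auto simp: set_add_def')

lemma ssumI: "a \<in> N \<Longrightarrow> b \<in> N' \<Longrightarrow> a \<oplus>\<^sub>M b \<in> N \<uplus> N'"
  by (auto simp: mem_ssum)

lemma sm_ssum:
  assumes "sm N" "sm N'" shows "sm (N \<uplus> N')"
proof (rule smI)
  show "N \<uplus> N' \<subseteq> carrier M" using assms by (auto simp: mem_ssum sm_mem)
  have "\<zero>\<^sub>M \<oplus>\<^sub>M \<zero>\<^sub>M \<in> N \<uplus> N'" using assms by (blast intro: ssumI sm_zero)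
  thus "\<zero>\<^sub>M \<in> N \<uplus> N'" by simp
next
  fix y z assume "y \<in> N \<uplus> N'" "z \<in> N \<uplus> N'"
  then obtain a b a' b' where *: "a \<in> N" "a' \<in> N" "b \<in> N'" "b' \<in> N'"
    "y = a \<oplus>\<^sub>M b" "z = a' \<oplus>\<^sub>M b'" by (auto simp: mem_ssum)
  have "y \<oplus>\<^sub>M z = (a \<oplus>\<^sub>M a') \<oplus>\<^sub>M (b \<oplus>\<^sub>M b')"
    using * assms sm_mem by (simp add: M.a_ac)
  thus "y \<oplus>\<^sub>M z \<in> N \<uplus> N'" using * assms by (simp add: ssumI sm_add)
next
  fix c z assume c: "c \<in> carrier R" "z \<in> N \<uplus> N'"
  then obtain a b where *: "a \<in> N" "b \<in> N'" "z = a \<oplus>\<^sub>M b" by (auto simp: mem_ssum)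
  have "c \<bullet> z = c \<bullet> a \<oplus>\<^sub>M c \<bullet> b"
    using * c assms sm_mem by (simp add: smult_r_distr)
  thus "c \<bullet> z \<in> N \<uplus> N'" using * c assms by (simp add: ssumI sm_smult)
qed

lemma ssum_ub1: "N \<subseteq> carrier M \<Longrightarrow> sm N' \<Longrightarrow> N \<subseteq> N \<uplus> N'"
proof
  fix z assume z: "N \<subseteq> carrier M" "sm N'" "z \<in> N"
  hence "z \<oplus>\<^sub>M \<zero>\<^sub>M \<in> N \<uplus> N'" by (blast intro: ssumI sm_zero)
  thus "z \<in> N \<uplus> N'" using z by auto
qed

lemma ssum_ub2: "sm N \<Longrightarrow> N' \<subseteq> carrier M \<Longrightarrow> N' \<subseteq> N \<uplus> N'"
proof
  fix z assume z: "sm N" "N' \<subseteq> carrier M" "z \<in> N'"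
  hence "\<zero>\<^sub>M \<oplus>\<^sub>M z \<in> N \<uplus> N'" by (blast intro: ssumI sm_zero)
  thus "z \<in> N \<uplus> N'" using z by auto
qed

lemma ssum_least: "sm T \<Longrightarrow> N \<subseteq> T \<Longrightarrow> N' \<subseteq> T \<Longrightarrow> N \<uplus> N' \<subseteq> T"
  by (auto simp: mem_ssum sm_add subset_iff)

lemma ssum_mono: "N \<subseteq> T \<Longrightarrow> N' \<subseteq> T' \<Longrightarrow> N \<uplus> N' \<subseteq> T \<uplus> T'"
  by (auto simp: mem_ssum subset_iff)

lemma ssum_absorb1: "sm T \<Longrightarrow> sm N \<Longrightarrow> N \<subseteq> T \<Longrightarrow> T \<uplus> N = T"
  using ssum_least[of T T N] ssum_ub1[of T N] sm_carrier[of T] by auto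

lemma ssum_commute: "sm N \<Longrightarrow> sm N' \<Longrightarrow> N \<uplus> N' = N' \<uplus> N"
  by (intro equalityI ssum_least ssum_ub1 ssum_ub2 sm_ssum sm_carrier)

lemma ssum_assoc:
  assumes "sm N" "sm N'" "sm N''"
  shows "N \<uplus> N' \<uplus> N'' = N \<uplus> (N' \<uplus> N'')"
proof -
  have c: "N \<subseteq> carrier M" "N' \<subseteq> carrier M" "N'' \<subseteq> carrier M" using assms by (simp_all add: sm_carrier)
  have s: "sm (N \<uplus> N')" "sm (N' \<uplus> N'')" using assms by (simp_all add: sm_ssum)
  show ?thesis
  proof (intro equalityI ssum_least sm_ssum s assms)
    show "N \<subseteq> N \<uplus> (N' \<uplus> N'')" using c s by (intro ssum_ub1)
    show "N' \<subseteq> N \<uplus> (N' \<uplus> N'')"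
      using ssum_ub1[of N' N''] ssum_ub2[of N "N' \<uplus> N''"] c s assms sm_carrier by blast
    show "N'' \<subseteq> N \<uplus> (N' \<uplus> N'')"
      using ssum_ub2[of N' N''] ssum_ub2[of N "N' \<uplus> N''"] c s assms sm_carrier by blast
    show "N \<subseteq> N \<uplus> N' \<uplus> N''"
      using ssum_ub1[of N N'] ssum_ub1[of "N \<uplus> N'" N''] c s assms sm_carrier by blast
    show "N' \<subseteq> N \<uplus> N' \<uplus> N''"
      using ssum_ub2[of N N'] ssum_ub1[of "N \<uplus> N'" N''] c s assms sm_carrier by blast
    show "N'' \<subseteq> N \<uplus> N' \<uplus> N''" using c s by (intro ssum_ub2)
  qed
qed

text \<open>Dedekind's modular law. By it, nested submodules with equal traces and equal sums
  coincide, on which additivity of length and the second isomorphism theorem for lengths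
  rest.\<close>

lemma sm_modular:
  assumes "sm X" "sm Z" "Y \<subseteq> X" "Y \<subseteq> carrier M"
  shows "X \<inter> (Y \<uplus> Z) = Y \<uplus> (X \<inter> Z)"
proof
  show "X \<inter> (Y \<uplus> Z) \<subseteq> Y \<uplus> (X \<inter> Z)"
  proof
    fix z assume "z \<in> X \<inter> (Y \<uplus> Z)"
    then obtain y w where *: "z \<in> X" "y \<in> Y" "w \<in> Z" "z = y \<oplus>\<^sub>M w" by (auto simp: mem_ssum)
    hence "w \<in> X" using sm_add_cancel_left[of X y w] assms sm_mem by auto
    thus "z \<in> Y \<uplus> (X \<inter> Z)" using * by (auto simp: mem_ssum)
  qed
  show "Y \<uplus> (X \<inter> Z) \<subseteq> X \<inter> (Y \<uplus> Z)"
    using assms by (auto simp: mem_ssum sm_add subset_iff)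
qed

lemma ideal_smult_incl: "a \<in> I \<Longrightarrow> z \<in> N \<Longrightarrow> a \<bullet> z \<in> ideal_smult M I N"
  unfolding ideal_smult_def by (rule generate.incl) auto

lemma ideal_smult_least:
  assumes "sm T" "\<And>a z. a \<in> I \<Longrightarrow> z \<in> N \<Longrightarrow> a \<bullet> z \<in> T"
  shows "ideal_smult M I N \<subseteq> T"
proof
  fix z assume "z \<in> ideal_smult M I N"
  thus "z \<in> T" unfolding ideal_smult_def
  proof (induct rule: generate.induct)
    case (inv h)
    hence "h \<in> T" using assms(2) by auto
    thus ?case using sm_uminus[OF assms(1)] by (simp add: a_inv_def)
  qed (use assms sm_zero[OF assms(1)] sm_add[OF assms(1)] in auto)
qed

lemma sm_ideal_smult:
  assumes "ideal I R" "N \<subseteq> carrier M" shows "sm (ideal_smult M I N)"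
proof (rule smI)
  have sub: "{a \<bullet> x | a x. a \<in> I \<and> x \<in> N} \<subseteq> carrier M"
    using assms ideal.Icarr by fastforce
  show c: "ideal_smult M I N \<subseteq> carrier M"
    using M.add.generate_incl[OF sub] unfolding ideal_smult_def by simp
  show "\<zero>\<^sub>M \<in> ideal_smult M I N"
    unfolding ideal_smult_def using generate.one[of "add_monoid M"] by simp
  fix z assume z: "z \<in> ideal_smult M I N"
  { fix y assume "y \<in> ideal_smult M I N"
    thus "z \<oplus>\<^sub>M y \<in> ideal_smult M I N"
      using generate.eng[of _ "add_monoid M"] z unfolding ideal_smult_def by simp }
  note add = this
  fix c assume c': "c \<in> carrier R"
  from z show "c \<bullet> z \<in> ideal_smult M I N"
    unfolding ideal_smult_def
  proof (induct rule: generate.induct)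
    case one
    show ?case using generate.one[of "add_monoid M"] c' by simp
  next
    case (incl h)
    then obtain a x where *: "h = a \<bullet> x" "a \<in> I" "x \<in> N" by auto
    hence "c \<bullet> h = (c \<otimes> a) \<bullet> x"
      using c' assms by (simp add: smult_assoc1 ideal.Icarr subsetD)
    moreover have "c \<otimes> a \<in> I" using * c' assms(1) by (simp add: ideal.I_l_closed)
    ultimately show ?case using * by (intro generate.incl) auto
  next
    case (inv h)
    then obtain a x where *: "h = a \<bullet> x" "a \<in> I" "x \<in> N" by auto
    hence "c \<bullet> (\<ominus>\<^bsub>M\<^esub> h) = (c \<otimes> (\<ominus> a)) \<bullet> x"
      using c' assms by (simp add: smult_assoc1 ideal.Icarr subsetD smult_l_minus)
    moreover have "c \<otimes> (\<ominus> a) \<in> I"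
      using * c' assms(1) by (simp add: ideal.I_l_closed additive_subgroup.a_inv_closed ideal.axioms)
    ultimately show ?case using * unfolding a_inv_def[symmetric] by (intro generate.incl) auto
  next
    case (eng h1 h2)
    have "h1 \<in> carrier M" "h2 \<in> carrier M"
      using eng c unfolding ideal_smult_def by auto
    thus ?case using generate.eng[OF eng(2,4)] c' by (simp add: smult_r_distr)
  qed
qed

lemma ideal_smult_mono: "I \<subseteq> I' \<Longrightarrow> N \<subseteq> N' \<Longrightarrow> ideal_smult M I N \<subseteq> ideal_smult M I' N'"
  unfolding ideal_smult_def by (rule M.add.mono_generate) blast

lemma ideal_smult_le: "ideal I R \<Longrightarrow> sm N \<Longrightarrow> ideal_smult M I N \<subseteq> N"
  by (rule ideal_smult_least) (auto simp: sm_smult ideal.Icarr)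

lemma ideal_smult_carrier_id: "sm N \<Longrightarrow> ideal_smult M (carrier R) N = N"
proof
  assume N: "sm N"
  show "ideal_smult M (carrier R) N \<subseteq> N" by (rule ideal_smult_le[OF oneideal N])
  show "N \<subseteq> ideal_smult M (carrier R) N"
  proof
    fix z assume "z \<in> N"
    thus "z \<in> ideal_smult M (carrier R) N"
      using ideal_smult_incl[of \<one> "carrier R" z N] sm_mem[OF N] by simp
  qed
qed

text \<open>\<open>ideal_smult_least\<close> reduces an inclusion to products of generators. Mapping
  into a colon submodule makes it applicable to elements that are still to be multiplied by an
  ideal.\<close>

lemma sm_colon:
  assumes "ideal I R" "sm T" shows "sm {z \<in> carrier M. \<forall>a\<in>I. a \<bullet> z \<in> T}"
proof (rule smI)
  fix c x assume c: "c \<in> carrier R" and x: "x \<in> {z \<in> carrier M. \<forall>a\<in>I. a \<bullet> z \<in> T}"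
  have "a \<bullet> (c \<bullet> x) \<in> T" if "a \<in> I" for a
    using smult_commute[of a c x] ideal.Icarr[OF assms(1) that] that c x sm_smult[OF assms(2)] by auto
  thus "c \<bullet> x \<in> {z \<in> carrier M. \<forall>a\<in>I. a \<bullet> z \<in> T}" using c x by auto
qed (use assms in \<open>auto simp: sm_zero sm_add smult_r_distr ideal.Icarr\<close>)

lemma ideal_prod_smult:
  assumes I: "ideal I R" and J: "ideal J R" and N: "sm N"
  shows "ideal_smult M (I \<cdot>\<^bsub>R\<^esub> J) N = ideal_smult M I (ideal_smult M J N)"
proof
  have sJ: "sm (ideal_smult M J N)" by (rule sm_ideal_smult[OF J sm_carrier[OF N]])
  have sIJ: "sm (ideal_smult M I (ideal_smult M J N))" by (rule sm_ideal_smult[OF I sm_carrier[OF sJ]])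
  have sP: "sm (ideal_smult M (I \<cdot>\<^bsub>R\<^esub> J) N)"
    by (rule sm_ideal_smult[OF ideal_prod_is_ideal[OF I J] sm_carrier[OF N]])
  show "ideal_smult M (I \<cdot>\<^bsub>R\<^esub> J) N \<subseteq> ideal_smult M I (ideal_smult M J N)"
  proof (rule ideal_smult_least[OF sIJ])
    fix c z assume c: "c \<in> I \<cdot>\<^bsub>R\<^esub> J" and z: "z \<in> N"
    have zc: "z \<in> carrier M" using z N sm_mem by blast
    from c show "c \<bullet> z \<in> ideal_smult M I (ideal_smult M J N)"
    proof (induct c rule: ideal_prod.induct)
      case (prod i j)
      have "(i \<otimes> j) \<bullet> z = i \<bullet> (j \<bullet> z)"
        using prod zc by (simp add: smult_assoc1 ideal.Icarr[OF I] ideal.Icarr[OF J])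
      thus ?case using prod z by (simp add: ideal_smult_incl)
    next
      case (sum s1 s2)
      have "s1 \<in> carrier R" "s2 \<in> carrier R" using sum ideal_prod_in_carrier[OF I J] by auto
      thus ?case using sum zc by (simp add: smult_l_distr sm_add[OF sIJ])
    qed
  qed
  show "ideal_smult M I (ideal_smult M J N) \<subseteq> ideal_smult M (I \<cdot>\<^bsub>R\<^esub> J) N"
  proof (rule ideal_smult_least[OF sP])
    fix a w assume a: "a \<in> I" and w: "w \<in> ideal_smult M J N"
    have "ideal_smult M J N \<subseteq> {z \<in> carrier M. \<forall>a\<in>I. a \<bullet> z \<in> ideal_smult M (I \<cdot>\<^bsub>R\<^esub> J) N}"
    proof (rule ideal_smult_least[OF sm_colon[OF I sP]])
      fix b z assume b: "b \<in> J" and z: "z \<in> N"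
      have zc: "z \<in> carrier M" using z N sm_mem by blast
      have "a \<bullet> (b \<bullet> z) \<in> ideal_smult M (I \<cdot>\<^bsub>R\<^esub> J) N" if "a \<in> I" for a
        using ideal_smult_incl[OF ideal_prod.prod[of a I b J R, OF that b] z] that b zc
        by (simp add: smult_assoc1 ideal.Icarr[OF I] ideal.Icarr[OF J])
      thus "b \<bullet> z \<in> {z \<in> carrier M. \<forall>a\<in>I. a \<bullet> z \<in> ideal_smult M (I \<cdot>\<^bsub>R\<^esub> J) N}"
        using b zc by (auto simp: ideal.Icarr[OF J])
    qed
    thus "a \<bullet> w \<in> ideal_smult M (I \<cdot>\<^bsub>R\<^esub> J) N" using a w by blast
  qed
qed

lemma ideal_smult_ssum:
  assumes I: "ideal I R" and N: "sm N" "sm N'"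
  shows "ideal_smult M I (N \<uplus> N') = ideal_smult M I N \<uplus> ideal_smult M I N'"
proof
  have s: "sm (ideal_smult M I N)" "sm (ideal_smult M I N')"
    using sm_ideal_smult[OF I] N sm_carrier by auto
  show "ideal_smult M I (N \<uplus> N') \<subseteq> ideal_smult M I N \<uplus> ideal_smult M I N'"
  proof (rule ideal_smult_least[OF sm_ssum[OF s]])
    fix a z assume a: "a \<in> I" and "z \<in> N \<uplus> N'"
    then obtain y w where *: "y \<in> N" "w \<in> N'" "z = y \<oplus>\<^sub>M w" by (auto simp: mem_ssum)
    hence "a \<bullet> z = a \<bullet> y \<oplus>\<^sub>M a \<bullet> w"
      using a N sm_mem by (simp add: smult_r_distr ideal.Icarr[OF I])
    thus "a \<bullet> z \<in> ideal_smult M I N \<uplus> ideal_smult M I N'"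
      using a * by (simp add: ssumI ideal_smult_incl)
  qed
  show "ideal_smult M I N \<uplus> ideal_smult M I N' \<subseteq> ideal_smult M I (N \<uplus> N')"
    using N by (intro ssum_least sm_ideal_smult[OF I] ideal_smult_mono ssum_ub1 ssum_ub2 sm_carrier sm_ssum) auto
qed

lemma sm_elem_smult: "x \<in> carrier R \<Longrightarrow> sm N \<Longrightarrow> sm (elem_smult M x N)"
  unfolding elem_smult_def
proof (rule smI)
  assume x: "x \<in> carrier R" and N: "sm N"
  show "(\<lambda>y. x \<bullet> y) ` N \<subseteq> carrier M" using x N sm_mem by auto
  show "\<zero>\<^sub>M \<in> (\<lambda>y. x \<bullet> y) ` N" using sm_zero[OF N] x by (metis image_eqI smult_r_null)
  fix a assume a: "a \<in> (\<lambda>y. x \<bullet> y) ` N"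
  { fix b assume "b \<in> (\<lambda>y. x \<bullet> y) ` N"
    with a obtain y z where *: "a = x \<bullet> y" "b = x \<bullet> z" "y \<in> N" "z \<in> N" by auto
    hence "a \<oplus>\<^sub>M b = x \<bullet> (y \<oplus>\<^sub>M z)" using x N sm_mem by (simp add: smult_r_distr)
    thus "a \<oplus>\<^sub>M b \<in> (\<lambda>y. x \<bullet> y) ` N" using * sm_add[OF N] by auto }
  fix c assume c: "c \<in> carrier R"
  from a obtain y where *: "a = x \<bullet> y" "y \<in> N" by auto
  hence "c \<bullet> a = x \<bullet> (c \<bullet> y)" using x c N sm_mem smult_commute by auto
  thus "c \<bullet> a \<in> (\<lambda>y. x \<bullet> y) ` N" using * sm_smult[OF N c] by auto
qed

lemma elem_smult_incl: "z \<in> N \<Longrightarrow> x \<bullet> z \<in> elem_smult M x N"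
  by (auto simp: elem_smult_def)

lemma elem_smult_mono: "N \<subseteq> N' \<Longrightarrow> elem_smult M x N \<subseteq> elem_smult M x N'"
  by (auto simp: elem_smult_def)

lemma ideal_smult_elem_smult:
  assumes I: "ideal I R" and x: "x \<in> carrier R" and N: "sm N"
  shows "ideal_smult M I (elem_smult M x N) = elem_smult M x (ideal_smult M I N)"
proof
  have s: "sm (ideal_smult M I N)" using sm_ideal_smult[OF I] N sm_carrier by auto
  have sx: "sm (ideal_smult M I (elem_smult M x N))"
    using sm_ideal_smult[OF I] sm_elem_smult[OF x N] sm_carrier by auto
  show "ideal_smult M I (elem_smult M x N) \<subseteq> elem_smult M x (ideal_smult M I N)"
  proof (rule ideal_smult_least[OF sm_elem_smult[OF x s]])
    fix a z assume a: "a \<in> I" and "z \<in> elem_smult M x N"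
    then obtain y where *: "y \<in> N" "z = x \<bullet> y" by (auto simp: elem_smult_def)
    thus "a \<bullet> z \<in> elem_smult M x (ideal_smult M I N)"
      using a x N sm_mem smult_commute[of a x y]
      by (simp add: ideal.Icarr[OF I] elem_smult_incl ideal_smult_incl)
  qed
  \<comment> \<open>\<open>sm_colon\<close> takes an ideal, so the principal ideal of
    \<open>x\<close> stands in for \<open>x\<close> itself.\<close>
  have "ideal_smult M I N \<subseteq> {z \<in> carrier M. \<forall>a\<in>PIdl x. a \<bullet> z \<in> ideal_smult M I (elem_smult M x N)}"
  proof (rule ideal_smult_least[OF sm_colon[OF cgenideal_ideal[OF x] sx]])
    fix a z assume a: "a \<in> I" and z: "z \<in> N"
    have ac: "a \<in> carrier R" and zc: "z \<in> carrier M" using a z N sm_mem ideal.Icarr[OF I] by auto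
    { fix r assume r: "r \<in> carrier R"
      have "a \<bullet> (x \<bullet> (r \<bullet> z)) \<in> ideal_smult M I (elem_smult M x N)"
        using a sm_smult[OF N r z] by (intro ideal_smult_incl elem_smult_incl)
      moreover have "(r \<otimes> x) \<bullet> (a \<bullet> z) = a \<bullet> (x \<bullet> (r \<bullet> z))"
        using r x ac zc by (simp add: smult_assoc1[symmetric] R.m_ac)
      ultimately have "(r \<otimes> x) \<bullet> (a \<bullet> z) \<in> ideal_smult M I (elem_smult M x N)" by simp }
    thus "a \<bullet> z \<in> {z \<in> carrier M. \<forall>a\<in>PIdl x. a \<bullet> z \<in> ideal_smult M I (elem_smult M x N)}"
      using ac zc by (auto simp: cgenideal_def)
  qed
  thus "elem_smult M x (ideal_smult M I N) \<subseteq> ideal_smult M I (elem_smult M x N)"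
    using cgenideal_self[OF x] by (auto simp: elem_smult_def)
qed

lemma sm_elem_colon:
  assumes "x \<in> carrier R" "sm T" "sm N" shows "sm {z \<in> N. x \<bullet> z \<in> T}"
proof (rule smI)
  fix c z assume c: "c \<in> carrier R" and z: "z \<in> {z \<in> N. x \<bullet> z \<in> T}"
  have "x \<bullet> (c \<bullet> z) = c \<bullet> (x \<bullet> z)"
    using assms c z sm_mem[of N z] by (intro smult_commute) auto
  thus "c \<bullet> z \<in> {z \<in> N. x \<bullet> z \<in> T}"
    using c z sm_smult[OF assms(2)] sm_smult[OF assms(3)] by auto
qed (use assms in \<open>auto simp: sm_zero sm_add smult_r_distr sm_mem\<close>)

lemma sm_mult_image:
  assumes I: "ideal I R" and z: "z \<in> carrier M" shows "sm ((\<lambda>c. c \<bullet> z) ` I)"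
proof (rule smI)
  have IR: "c \<in> carrier R" if "c \<in> I" for c by (rule ideal.Icarr[OF I that])
  show "(\<lambda>c. c \<bullet> z) ` I \<subseteq> carrier M" using IR z by auto
  have "\<zero> \<in> I" by (rule additive_subgroup.zero_closed[OF ideal.axioms(1)[OF I]])
  thus "\<zero>\<^sub>M \<in> (\<lambda>c. c \<bullet> z) ` I" using z smult_l_null[OF z] by (metis image_eqI)
  show "a \<oplus>\<^sub>M b \<in> (\<lambda>c. c \<bullet> z) ` I" if "a \<in> (\<lambda>c. c \<bullet> z) ` I" "b \<in> (\<lambda>c. c \<bullet> z) ` I" for a b
    using that IR z additive_subgroup.a_closed[OF ideal.axioms(1)[OF I]] by (auto simp: smult_l_distr[symmetric])
  show "a \<bullet> x \<in> (\<lambda>c. c \<bullet> z) ` I" if "a \<in> carrier R" "x \<in> (\<lambda>c. c \<bullet> z) ` I" for a x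
    using that IR z ideal.I_l_closed[OF I] by (auto simp: smult_assoc1[symmetric])
qed

text \<open>The ring elements that carry \<open>z\<close> into \<open>T\<close> form an ideal, so
  testing generators suffices.\<close>

lemma colon_genideal:
  assumes S: "S \<subseteq> carrier R" and T: "sm T" and z: "z \<in> carrier M"
    and "\<And>a. a \<in> S \<Longrightarrow> a \<bullet> z \<in> T" and a: "a \<in> Idl S"
  shows "a \<bullet> z \<in> T"
proof -
  have "ideal {a \<in> carrier R. a \<bullet> z \<in> T} R"
    by (rule R.cring_idealI) (use z T in \<open>auto simp: sm_zero sm_add sm_smult smult_l_distr smult_assoc1\<close>)
  hence "Idl S \<subseteq> {a \<in> carrier R. a \<bullet> z \<in> T}"
    using assms by (intro genideal_minimal) auto
  thus ?thesis using a by auto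
qed

end

section \<open>Powers of a family of ideals\<close>

lemma ideals_set_simps:
  "carrier (ideals_set R) = {I. ideal I R}"
  "I \<otimes>\<^bsub>ideals_set R\<^esub> J = I \<cdot>\<^bsub>R\<^esub> J"
  "\<one>\<^bsub>ideals_set R\<^esub> = carrier R"
  by (simp_all add: ideals_set_def)

locale power_family = module R M
  for R :: "('a, 'r) ring_scheme" (structure) and M :: "('a, 'b, 'm) module_scheme" (structure) +
  fixes d :: nat and K :: "nat \<Rightarrow> 'a set"
  assumes K_ideal: "i \<le> d \<Longrightarrow> ideal (K i) R"
begin

abbreviation PP :: "(nat \<Rightarrow> nat) \<Rightarrow> 'a set" where "PP v \<equiv> power_product R d K v"
abbreviation pw :: "(nat \<Rightarrow> nat) \<Rightarrow> 'b set \<Rightarrow> 'b set" where "pw v N \<equiv> ideal_smult M (PP v) N"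
abbreviation U :: "(nat \<Rightarrow> nat) \<Rightarrow> 'b set" where "U v \<equiv> power_submodule R d K M v"
abbreviation inc :: "nat \<Rightarrow> (nat \<Rightarrow> nat) \<Rightarrow> nat \<Rightarrow> nat" where "inc j v \<equiv> v(j := Suc (v j))"

lemma K_pow_ideal: "i \<le> d \<Longrightarrow> ideal (K i [^]\<^bsub>ideals_set R\<^esub> (n::nat)) R"
proof -
  interpret I: comm_monoid "ideals_set R" by (rule R.ideals_set_is_comm_monoid)
  show "i \<le> d \<Longrightarrow> ideal (K i [^]\<^bsub>ideals_set R\<^esub> (n::nat)) R"
    using I.nat_pow_closed[of "K i" n] K_ideal by (simp add: ideals_set_def)
qed

lemma PP_ideal: "ideal (PP v) R"
proof -
  interpret I: comm_monoid "ideals_set R" by (rule R.ideals_set_is_comm_monoid)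
  have "PP v \<in> carrier (ideals_set R)"
    unfolding power_product_def
    by (rule I.finprod_closed) (auto simp: ideals_set_simps K_pow_ideal)
  thus ?thesis by (simp add: ideals_set_def)
qed

lemma PP_carrier: "PP v \<subseteq> carrier R"
  using ideal.Icarr[OF PP_ideal] by blast

lemma PP_add: "PP (\<lambda>i. v i + w i) = PP v \<cdot>\<^bsub>R\<^esub> PP w"
proof -
  interpret I: comm_monoid "ideals_set R" by (rule R.ideals_set_is_comm_monoid)
  have c: "(\<lambda>i. K i [^]\<^bsub>ideals_set R\<^esub> v i) \<in> {0..d} \<rightarrow> carrier (ideals_set R)" for v :: "nat \<Rightarrow> nat"
    using K_pow_ideal by (auto simp: ideals_set_simps)
  have "PP (\<lambda>i. v i + w i) =
      (\<Otimes>\<^bsub>ideals_set R\<^esub>i\<in>{0..d}. K i [^]\<^bsub>ideals_set R\<^esub> v i \<otimes>\<^bsub>ideals_set R\<^esub> K i [^]\<^bsub>ideals_set R\<^esub> w i)"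
    unfolding power_product_def
    by (rule I.finprod_cong') (use K_ideal K_pow_ideal in \<open>auto simp: I.nat_pow_mult ideals_set_simps(1) simp del: I.nat_pow_Suc\<close>)
  also have "\<dots> = PP v \<otimes>\<^bsub>ideals_set R\<^esub> PP w"
    unfolding power_product_def by (rule I.finprod_multf) (rule c)+
  finally show ?thesis by (simp add: ideals_set_simps)
qed

text \<open>Exponents are total functions on \<open>nat\<close>, although only their values up to
  \<open>d\<close> have a meaning. Every family indexed by exponents therefore needs a congruence of
  this kind; \<open>degreewise\<close> requires it of abstract families.\<close>

lemma PP_cong: "(\<And>i. i \<le> d \<Longrightarrow> v i = w i) \<Longrightarrow> PP v = PP w"
proof -
  interpret I: comm_monoid "ideals_set R" by (rule R.ideals_set_is_comm_monoid)
  assume "\<And>i. i \<le> d \<Longrightarrow> v i = w i"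
  thus ?thesis unfolding power_product_def
    by (intro I.finprod_cong') (use K_pow_ideal in \<open>auto simp: ideals_set_simps\<close>)
qed

lemma PP_0: "PP (\<lambda>_. 0) = carrier R"
proof -
  interpret I: comm_monoid "ideals_set R" by (rule R.ideals_set_is_comm_monoid)
  have "PP (\<lambda>_. 0) = \<one>\<^bsub>ideals_set R\<^esub>" unfolding power_product_def by simp
  thus ?thesis by (simp add: ideals_set_simps)
qed

lemma PP_single:
  assumes "j \<le> d" shows "PP ((\<lambda>_. 0)(j := n)) = K j [^]\<^bsub>ideals_set R\<^esub> n"
proof -
  interpret I: comm_monoid "ideals_set R" by (rule R.ideals_set_is_comm_monoid)
  have "PP ((\<lambda>_. 0)(j := n)) =
    (\<Otimes>\<^bsub>ideals_set R\<^esub>i\<in>{0..d}. if j = i then K i [^]\<^bsub>ideals_set R\<^esub> n else \<one>\<^bsub>ideals_set R\<^esub>)"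
    unfolding power_product_def
    by (rule I.finprod_cong') (use K_pow_ideal in \<open>auto simp: ideals_set_simps oneideal\<close>)
  also have "\<dots> = K j [^]\<^bsub>ideals_set R\<^esub> n"
    by (rule I.finprod_singleton) (use K_pow_ideal assms in \<open>auto simp: ideals_set_simps\<close>)
  finally show ?thesis .
qed

lemma PP_unit: "j \<le> d \<Longrightarrow> PP ((\<lambda>_. 0)(j := 1)) = K j"
proof -
  interpret I: comm_monoid "ideals_set R" by (rule R.ideals_set_is_comm_monoid)
  assume j: "j \<le> d"
  hence "K j \<in> carrier (ideals_set R)" using K_ideal by (simp add: ideals_set_simps)
  thus ?thesis using PP_single[OF j, of 1] I.nat_pow_Suc[of "K j" 0] by simp
qed

lemma sm_pw: "N \<subseteq> carrier M \<Longrightarrow> sm (pw v N)"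
  by (rule sm_ideal_smult[OF PP_ideal])

lemma pw_le: "sm N \<Longrightarrow> pw v N \<subseteq> N"
  by (rule ideal_smult_le[OF PP_ideal])

lemma pw_mono: "N \<subseteq> N' \<Longrightarrow> pw v N \<subseteq> pw v N'"
  by (rule ideal_smult_mono) auto

lemma pw_pw: "sm N \<Longrightarrow> pw v (pw w N) = pw (\<lambda>i. v i + w i) N"
  by (simp add: PP_add ideal_prod_smult PP_ideal)

lemma pw_0: "sm N \<Longrightarrow> pw (\<lambda>_. 0) N = N"
  by (simp add: PP_0 ideal_smult_carrier_id)

lemma pw_cong: "(\<And>i. i \<le> d \<Longrightarrow> v i = w i) \<Longrightarrow> pw v N = pw w N"
  using PP_cong[of v w] by simp

lemma pw_inc: "sm N \<Longrightarrow> j \<le> d \<Longrightarrow> pw (inc j v) N = ideal_smult M (K j) (pw v N)"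
proof -
  assume N: "sm N" and j: "j \<le> d"
  have "(\<lambda>i. ((\<lambda>_. 0)(j := 1)) i + v i) = inc j v" by auto
  thus ?thesis using pw_pw[OF N, of "(\<lambda>_. 0)(j := 1)" v] PP_unit[OF j] by simp
qed

lemma pw_ssum: "sm N \<Longrightarrow> sm N' \<Longrightarrow> pw v (N \<uplus> N') = pw v N \<uplus> pw v N'"
  by (rule ideal_smult_ssum[OF PP_ideal])

lemma pw_elem: "x \<in> carrier R \<Longrightarrow> sm N \<Longrightarrow> pw v (elem_smult M x N) = elem_smult M x (pw v N)"
  by (rule ideal_smult_elem_smult[OF PP_ideal])

lemma U_pw: "U v = pw v (carrier M)"
  by (simp add: power_submodule_def)

lemma sm_U: "sm (U v)"
  by (simp add: U_pw sm_pw)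

lemma U_carrier: "U v \<subseteq> carrier M"
  by (rule sm_carrier[OF sm_U])

lemma pw_U: "pw w (U v) = U (\<lambda>i. w i + v i)"
  by (simp add: U_pw pw_pw sm_carrier_whole)

lemma U_0: "U (\<lambda>_. 0) = carrier M"
  by (simp add: U_pw pw_0 sm_carrier_whole)

lemma U_cong: "(\<And>i. i \<le> d \<Longrightarrow> v i = w i) \<Longrightarrow> U v = U w"
  unfolding U_pw by (rule pw_cong)

lemma U_antimono: "(\<And>i. i \<le> d \<Longrightarrow> v i \<le> w i) \<Longrightarrow> U w \<subseteq> U v"
proof -
  assume *: "\<And>i. i \<le> d \<Longrightarrow> v i \<le> w i"
  have "U w = U (\<lambda>i. (w i - v i) + v i)" by (rule U_cong) (use * in auto)
  also have "\<dots> = pw (\<lambda>i. w i - v i) (U v)" by (simp add: pw_U)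
  also have "\<dots> \<subseteq> U v" by (rule pw_le[OF sm_U])
  finally show ?thesis .
qed

lemma U_inc: "j \<le> d \<Longrightarrow> U (inc j v) = ideal_smult M (K j) (U v)"
  by (simp add: U_pw pw_inc sm_carrier_whole)

lemma K_mem: "i \<le> d \<Longrightarrow> x \<in> K i \<Longrightarrow> x \<in> carrier R"
  using ideal.Icarr[OF K_ideal] by blast

lemma K_smult_U: "j \<le> d \<Longrightarrow> a \<in> K j \<Longrightarrow> z \<in> U v \<Longrightarrow> a \<bullet> z \<in> U (inc j v)"
  by (simp add: U_inc ideal_smult_incl)

text \<open>Induction on the sum of the exponents up to \<open>d\<close>. Increments from zero reach
  only functions that vanish beyond \<open>d\<close>; the first premise carries the property to all
  others.\<close>

lemma multiindex_induct:
  assumes ext: "\<And>v w. (\<And>i. i \<le> d \<Longrightarrow> v i = w i) \<Longrightarrow> P v \<Longrightarrow> P w"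
    and zero: "P (\<lambda>_. 0)"
    and inc: "\<And>v j. j \<le> d \<Longrightarrow> P v \<Longrightarrow> P (inc j v)"
  shows "P v"
proof (induct "\<Sum>i\<le>d. v i" arbitrary: v)
  case 0
  hence "\<And>i. i \<le> d \<Longrightarrow> v i = 0" by simp
  thus ?case using ext[OF _ zero] by metis
next
  case (Suc n)
  then obtain j where j: "j \<le> d" "v j > 0"
    by (metis Zero_not_Suc atMost_iff gr_zeroI sum.neutral)
  have "(\<Sum>i\<le>d. v i) = v j + (\<Sum>i\<in>{..d} - {j}. v i)" using j by (simp add: sum.remove)
  moreover have "(\<Sum>i\<le>d. (v(j := v j - 1)) i) = (v j - 1) + (\<Sum>i\<in>{..d} - {j}. v i)"
    using j by (subst sum.remove[of _ j]) auto
  ultimately have "n = (\<Sum>i\<le>d. (v(j := v j - 1)) i)" using Suc(2) j by simp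
  moreover have "inc j (v(j := v j - 1)) = v" using j by (auto simp: fun_eq_iff)
  ultimately show ?case using inc[OF j(1) Suc(1)] by metis
qed

definition degreewise :: "((nat \<Rightarrow> nat) \<Rightarrow> 'b set) \<Rightarrow> bool" where
  "degreewise F \<longleftrightarrow> (\<forall>v w. (\<forall>i\<le>d. v i = w i) \<longrightarrow> F v = F w)"

text \<open>A \<open>graded_sub\<close> is a graded submodule of the Rees module \<open>\<Oplus>v. U v\<close>, given by its components.\<close>

definition graded_sub :: "((nat \<Rightarrow> nat) \<Rightarrow> 'b set) \<Rightarrow> bool" where
  "graded_sub F \<longleftrightarrow> degreewise F \<and> (\<forall>v. sm (F v) \<and> F v \<subseteq> U v) \<and>
     (\<forall>v. \<forall>j\<le>d. \<forall>a\<in>K j. \<forall>z\<in>F v. a \<bullet> z \<in> F (inc j v))"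

lemma graded_subI:
  assumes "\<And>v w. (\<And>i. i \<le> d \<Longrightarrow> v i = w i) \<Longrightarrow> F v = F w"
    and "\<And>v. sm (F v)" and "\<And>v. F v \<subseteq> U v"
    and "\<And>v j a z. j \<le> d \<Longrightarrow> a \<in> K j \<Longrightarrow> z \<in> F v \<Longrightarrow> a \<bullet> z \<in> F (inc j v)"
  shows "graded_sub F"
  using assms unfolding graded_sub_def degreewise_def by blast

lemma graded_subD:
  assumes "graded_sub F"
  shows "sm (F v)" "F v \<subseteq> U v" "F v \<subseteq> carrier M"
    "(\<And>i. i \<le> d \<Longrightarrow> v i = w i) \<Longrightarrow> F v = F w"
    "j \<le> d \<Longrightarrow> a \<in> K j \<Longrightarrow> z \<in> F v \<Longrightarrow> a \<bullet> z \<in> F (inc j v)"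
  using assms U_carrier unfolding graded_sub_def degreewise_def by blast+

lemma graded_sub_U: "graded_sub U"
  by (rule graded_subI) (use U_cong sm_U K_smult_U in blast)+

lemma graded_sub_Int:
  assumes F: "graded_sub F" and G: "graded_sub G" shows "graded_sub (\<lambda>v. F v \<inter> G v)"
proof (rule graded_subI)
  show "F v \<inter> G v = F w \<inter> G w" if "\<And>i. i \<le> d \<Longrightarrow> v i = w i" for v w
    using graded_subD(4)[OF F that] graded_subD(4)[OF G that] by simp
  show "sm (F v \<inter> G v)" for v by (intro sm_Int graded_subD(1)[OF F] graded_subD(1)[OF G])
  show "F v \<inter> G v \<subseteq> U v" for v using graded_subD(2)[OF F] by blast
  show "a \<bullet> z \<in> F (inc j v) \<inter> G (inc j v)" if "j \<le> d" "a \<in> K j" "z \<in> F v \<inter> G v" for v j a z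
    using graded_subD(5)[OF F that(1,2)] graded_subD(5)[OF G that(1,2)] that(3) by blast
qed

lemma graded_sub_pw:
  assumes F: "graded_sub F" shows "pw w (F v) \<subseteq> F (\<lambda>i. w i + v i)"
proof (induct w rule: multiindex_induct)
  case (1 w w')
  have "pw w' (F v) = pw w (F v)" by (rule pw_cong) (use 1 in auto)
  moreover have "F (\<lambda>i. w' i + v i) = F (\<lambda>i. w i + v i)" by (rule graded_subD(4)[OF F]) (use 1 in auto)
  ultimately show ?case using 1 by simp
next
  case 2
  show ?case using pw_0[OF graded_subD(1)[OF F]] by simp
next
  case (3 w j)
  have e: "inc j (\<lambda>i. w i + v i) = (\<lambda>i. inc j w i + v i)" by auto
  have "pw (inc j w) (F v) = ideal_smult M (K j) (pw w (F v))"
    by (rule pw_inc[OF graded_subD(1)[OF F] 3(1)])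
  also have "\<dots> \<subseteq> ideal_smult M (K j) (F (\<lambda>i. w i + v i))" by (rule ideal_smult_mono) (use 3 in auto)
  also have "\<dots> \<subseteq> F (inc j (\<lambda>i. w i + v i))"
    by (rule ideal_smult_least[OF graded_subD(1)[OF F] graded_subD(5)[OF F 3(1)]])
  finally show ?case unfolding e .
qed

end

section \<open>The ascending chain condition as a property of predicates on ordered types\<close>

definition acc :: "('x::order \<Rightarrow> bool) \<Rightarrow> bool" where
  "acc P \<longleftrightarrow> (\<forall>F::nat \<Rightarrow> 'x. (\<forall>n. P (F n)) \<longrightarrow> (\<forall>n. F n \<le> F (Suc n)) \<longrightarrow> (\<exists>n0. \<forall>n\<ge>n0. F n = F n0))"

lemma accD:
  assumes "acc P" "\<And>n::nat. P (F n)" "\<And>n. F n \<le> F (Suc n)"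
  obtains n0 where "\<And>n. n \<ge> n0 \<Longrightarrow> F n = F n0"
  using assms unfolding acc_def by blast

lemma acc_subset: "acc P \<Longrightarrow> (\<And>x. Q x \<Longrightarrow> P x) \<Longrightarrow> acc Q"
  unfolding acc_def by blast

text \<open>The diagonal becomes constant at some \<open>m0\<close> and squeezes every entry with
  both indices at least \<open>m0\<close> to the same value. Only the columns \<open>n < m0\<close>
  remain; each becomes constant on its own, and being finitely many they have a common
  bound.\<close>

lemma acc_double:
  assumes acc: "acc P" and P: "\<And>s n. P (G s n)"
    and m1: "\<And>s n. G s n \<le> G (Suc s) n" and m2: "\<And>s n. G s n \<le> G s (Suc n)"
  obtains s0 where "\<And>s n. s \<ge> s0 \<Longrightarrow> G s n = G s0 n"
proof -
  have m1': "G s n \<le> G s' n" if "s \<le> s'" for s s' n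
    by (rule lift_Suc_mono_le[of "\<lambda>s. G s n", OF m1 that])
  have m2': "G s n \<le> G s n'" if "n \<le> n'" for s n n'
    by (rule lift_Suc_mono_le[of "G s", OF m2 that])
  obtain m0 where m0: "\<And>m. m \<ge> m0 \<Longrightarrow> G m m = G m0 m0"
    using accD[of P "\<lambda>m. G m m", OF acc P] m1 m2 by (metis order_trans)
  have big: "G s n = G m0 m0" if "s \<ge> m0" "n \<ge> m0" for s n
  proof (rule antisym)
    have "G s n \<le> G (max s n) (max s n)"
      using m1'[of s "max s n" n] m2'[of n "max s n" "max s n"] by (meson max.cobounded1 max.cobounded2 order_trans)
    thus "G s n \<le> G m0 m0" using m0[of "max s n"] that by (simp add: le_max_iff_disj)
    show "G m0 m0 \<le> G s n" using m1'[of m0 s m0] m2'[of m0 n s] that order_trans by blast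
  qed
  have "\<forall>n. \<exists>sn. \<forall>s\<ge>sn. G s n = G sn n"
    using accD[OF acc, of "\<lambda>s. G s _", OF P m1] by metis
  then obtain sn where sn: "\<And>n s. s \<ge> sn n \<Longrightarrow> G s n = G (sn n) n" by metis
  define s0 where "s0 = max m0 (Max (sn ` {..m0}))"
  have "G s n = G s0 n" if "s \<ge> s0" for s n
  proof (cases "n \<ge> m0")
    case True
    thus ?thesis using big[of s n] big[of s0 n] that by (simp add: s0_def)
  next
    case False
    hence "sn n \<le> Max (sn ` {..m0})" by (intro Max_ge) auto
    hence "sn n \<le> s0" by (simp add: s0_def)
    thus ?thesis using sn[of n s] sn[of n s0] that by simp
  qed
  thus ?thesis using that by blast
qed

lemma (in noetherian_ring) acc_ideals: "acc (\<lambda>I. ideal I R)"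
  unfolding acc_def
proof (intro allI impI)
  fix F :: "nat \<Rightarrow> 'a set"
  assume F: "\<forall>n. ideal (F n) R" "\<forall>n. F n \<subseteq> F (Suc n)"
  have le: "F m \<subseteq> F n" if "m \<le> n" for m n by (rule lift_Suc_mono_le[of F]) (use F that in auto)
  have lin: "F m \<subseteq> F n \<or> F n \<subseteq> F m" for m n using le[of m n] le[of n m] nat_le_linear by metis
  have "subset.chain {I. ideal I R} (range F)"
    unfolding pred_on.chain_def using F(1) lin by blast
  hence "\<Union>(range F) \<in> range F" by (intro ideal_chain_is_trivial) auto
  then obtain n0 where "\<Union>(range F) = F n0" by auto
  hence "\<forall>n\<ge>n0. F n = F n0" using le by blast
  thus "\<exists>n0. \<forall>n\<ge>n0. F n = F n0" ..
qed

section \<open>Ascending chains in the Rees module\<close>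

context module
begin

text \<open>With one more generator \<open>m\<close>, a submodule is controlled by its trace on the
  span \<open>S\<close> of the others and by the ideal of coefficients that \<open>m\<close> takes
  modulo \<open>S\<close>. Both chains become constant, and nested submodules that agree in both are
  equal.\<close>

lemma acc_submodules_span:
  assumes noeth: "noetherian_ring R" and fin: "finite G" and G: "G \<subseteq> carrier M"
  shows "acc (\<lambda>N. sm N \<and> N \<subseteq> ideal_smult M (carrier R) G)"
  using fin G
proof (induct G rule: finite_induct)
  case empty
  have "ideal_smult M (carrier R) {} \<subseteq> {\<zero>\<^sub>M}" by (rule ideal_smult_least[OF sm_zero_set]) auto
  hence "N = {\<zero>\<^sub>M}" if "sm N" "N \<subseteq> ideal_smult M (carrier R) {}" for N
    using that sm_zero[OF that(1)] by blast
  thus ?case unfolding acc_def by metis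
next
  case (insert m G)
  define S where "S = ideal_smult M (carrier R) G"
  have S: "sm S" unfolding S_def using insert by (intro sm_ideal_smult[OF oneideal]) auto
  have m: "m \<in> carrier M" using insert by auto
  have span: "\<exists>c\<in>carrier R. z \<ominus>\<^sub>M c \<bullet> m \<in> S"
    if "z \<in> ideal_smult M (carrier R) (insert m G)" for z
  proof -
    let ?T = "(\<lambda>c. c \<bullet> m) ` carrier R"
    have T: "sm ?T" by (rule sm_mult_image[OF R.oneideal m])
    have "ideal_smult M (carrier R) (insert m G) \<subseteq> S \<uplus> ?T"
    proof (rule ideal_smult_least[OF sm_ssum[OF S T]])
      fix a z assume a: "a \<in> carrier R" "z \<in> insert m G"
      show "a \<bullet> z \<in> S \<uplus> ?T"
      proof (cases "z = m")
        case True
        thus ?thesis using a ssum_ub2[OF S sm_carrier[OF T]] by blast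
      next
        case False
        hence "a \<bullet> z \<in> S" using a by (simp add: S_def ideal_smult_incl)
        thus ?thesis using ssum_ub1[OF sm_carrier[OF S] T] by blast
      qed
    qed
    hence "z \<in> S \<uplus> ?T" using that by blast
    then obtain s c where *: "s \<in> S" "c \<in> carrier R" "z = s \<oplus>\<^sub>M c \<bullet> m"
      unfolding mem_ssum by blast
    hence "z \<ominus>\<^sub>M c \<bullet> m = s" using m sm_mem[OF S] by simp
    thus ?thesis using *(1,2) by (intro bexI[of _ c]) simp_all
  qed
  show ?case unfolding acc_def
  proof (intro allI impI)
    fix F :: "nat \<Rightarrow> 'c set"
    assume F: "\<forall>n. sm (F n) \<and> F n \<subseteq> ideal_smult M (carrier R) (insert m G)"
      and mono: "\<forall>n. F n \<subseteq> F (Suc n)"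
    have smF: "sm (F n)" for n using F by blast
    define I where "I n = {c \<in> carrier R. \<exists>w\<in>F n. w \<ominus>\<^sub>M c \<bullet> m \<in> S}" for n
    have I_I: "c \<in> I n" if "c \<in> carrier R" "w \<in> F n" "w \<ominus>\<^sub>M c \<bullet> m \<in> S" for c w n
      using that unfolding I_def by blast
    have mono': "F m \<subseteq> F n" if "m \<le> n" for m n by (rule lift_Suc_mono_le[of F]) (use mono that in auto)
    have I: "ideal (I n) R" for n
    proof -
      have smul: "x \<otimes> c \<in> I n" if c: "c \<in> I n" and x: "x \<in> carrier R" for c x
      proof -
        obtain w where w: "w \<in> F n" "w \<ominus>\<^sub>M c \<bullet> m \<in> S" "c \<in> carrier R" using c by (auto simp: I_def)
        have "x \<bullet> w \<ominus>\<^sub>M (x \<otimes> c) \<bullet> m = x \<bullet> (w \<ominus>\<^sub>M c \<bullet> m)"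
          using w x m sm_mem[OF smF] by (simp add: smult_diff smult_assoc1)
        thus ?thesis using w x sm_smult[OF S x] sm_smult[OF smF x] by (intro I_I[of _ "x \<bullet> w"]) auto
      qed
      show ?thesis
      proof (rule R.cring_idealI[OF _ _ _ smul])
        show "I n \<subseteq> carrier R" by (auto simp: I_def)
        have "\<zero>\<^sub>M \<ominus>\<^sub>M \<zero> \<bullet> m \<in> S" using m sm_minus[OF S sm_zero[OF S] sm_zero[OF S]] by simp
        thus "\<zero> \<in> I n" by (rule I_I[OF R.zero_closed sm_zero[OF smF]])
        show "a \<oplus> b \<in> I n" if ab: "a \<in> I n" "b \<in> I n" for a b
        proof -
          obtain v w where w: "w \<in> F n" "w \<ominus>\<^sub>M a \<bullet> m \<in> S" "a \<in> carrier R"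
            "v \<in> F n" "v \<ominus>\<^sub>M b \<bullet> m \<in> S" "b \<in> carrier R" using ab by (auto simp: I_def)
          have "(w \<oplus>\<^sub>M v) \<ominus>\<^sub>M (a \<oplus> b) \<bullet> m = (w \<ominus>\<^sub>M a \<bullet> m) \<oplus>\<^sub>M (v \<ominus>\<^sub>M b \<bullet> m)"
            using w m sm_mem[OF smF] by (simp add: smult_l_distr M.minus_eq M.minus_add M.a_ac)
          hence "(w \<oplus>\<^sub>M v) \<ominus>\<^sub>M (a \<oplus> b) \<bullet> m \<in> S" using w sm_add[OF S] by simp
          thus ?thesis using w sm_add[OF smF] by (auto intro!: I_I[of _ "w \<oplus>\<^sub>M v"])
        qed
      qed
    qed
    have Imono: "I n \<subseteq> I (Suc n)" for n using mono by (auto simp: I_def)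
    have Smono: "F n \<inter> S \<subseteq> F (Suc n) \<inter> S" for n using mono by auto
    obtain n1 where n1: "\<And>n. n \<ge> n1 \<Longrightarrow> I n = I n1"
      using accD[OF noetherian_ring.acc_ideals[OF noeth], of I, OF I Imono] by metis
    have "acc (\<lambda>N. sm N \<and> N \<subseteq> S)" using insert by (simp add: S_def)
    then obtain n2 where n2: "\<And>n. n \<ge> n2 \<Longrightarrow> F n \<inter> S = F n2 \<inter> S"
      using accD[of _ "\<lambda>n. F n \<inter> S"] Smono sm_Int[OF smF S] by (metis (mono_tags, lifting) inf_le2)
    have "F n \<subseteq> F (max n1 n2)" if n: "n \<ge> max n1 n2" for n
    proof
      fix z assume z: "z \<in> F n"
      then obtain c where c: "c \<in> carrier R" "z \<ominus>\<^sub>M c \<bullet> m \<in> S" using F span by blast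
      hence "c \<in> I n" using z I_I by blast
      hence "c \<in> I (max n1 n2)" using n1[of n] n1[of "max n1 n2"] n by simp
      \<comment> \<open>\<open>w\<close> lies in the stable term and has the same coefficient as
        \<open>z\<close>, so that \<open>z - w\<close> falls into the stable trace on
        \<open>S\<close>.\<close>
      then obtain w where w: "w \<in> F (max n1 n2)" "w \<ominus>\<^sub>M c \<bullet> m \<in> S" by (auto simp: I_def)
      have wn: "w \<in> F n" using w mono'[OF n] by blast
      have car: "z \<in> carrier M" "w \<in> carrier M" "c \<bullet> m \<in> carrier M" using z wn c m sm_mem[OF smF] by auto
      have "z \<ominus>\<^sub>M w = (z \<ominus>\<^sub>M c \<bullet> m) \<ominus>\<^sub>M (w \<ominus>\<^sub>M c \<bullet> m)"
        using car by (simp add: M.minus_eq M.minus_add M.a_ac M.r_neg M.r_neg2 M.r_neg1)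
      hence "z \<ominus>\<^sub>M w \<in> F n \<inter> S" using c w sm_minus[OF S] sm_minus[OF smF z wn] by simp
      hence "z \<ominus>\<^sub>M w \<in> F (max n1 n2)" using n2[of n] n2[of "max n1 n2"] n by auto
      thus "z \<in> F (max n1 n2)" using sm_diff_cancel[OF smF] w car by blast
    qed
    hence "\<forall>n\<ge>max n1 n2. F n = F (max n1 n2)" using mono' by blast
    thus "\<exists>n0. \<forall>n\<ge>n0. F n = F n0" ..
  qed
qed

lemma acc_submodules:
  assumes noeth: "noetherian_ring R" and fg: "finitely_generated_module R M"
  shows "acc sm"
proof -
  obtain G where G: "finite G" "G \<subseteq> carrier M" "carrier M = ideal_smult M (carrier R) G"
    using fg unfolding finitely_generated_module_def by blast
  show ?thesis
    by (rule acc_subset[OF acc_submodules_span[OF noeth G(1,2)]]) (use G(3) sm_carrier in blast)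
qed

end

lemma (in module) diff_diff_diff:
  assumes "x \<in> carrier M" "y \<in> carrier M" "z \<in> carrier M"
  shows "(x \<ominus>\<^sub>M z) \<ominus>\<^sub>M (y \<ominus>\<^sub>M z) = x \<ominus>\<^sub>M y"
proof -
  have "(x \<ominus>\<^sub>M y) \<oplus>\<^sub>M (y \<ominus>\<^sub>M z) = x \<ominus>\<^sub>M z"
    using assms by (simp add: M.minus_eq M.a_assoc M.r_neg1)
  thus ?thesis using diff_add_cancel(3)[of "x \<ominus>\<^sub>M y" "y \<ominus>\<^sub>M z"] assms by simp
qed

section \<open>Hilbert's basis theorem for families of graded components\<close>

locale noetherian_power_family = power_family R M d K
  for R :: "('a, 'r) ring_scheme" (structure) and M :: "('a, 'b, 'm) module_scheme" (structure)
    and d :: nat and K :: "nat \<Rightarrow> 'a set" +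
  assumes noetherian: "noetherian_ring R" and fin_gen: "finitely_generated_module R M"
begin

text \<open>Weaker than \<open>graded_sub\<close>: closure under the listed elements only and no
  bound by \<open>U\<close>. Generators can thus be added one at a time, as variables are in
  Hilbert's basis theorem.\<close>

definition gen_closed :: "('a \<times> nat) list \<Rightarrow> ((nat \<Rightarrow> nat) \<Rightarrow> 'b set) \<Rightarrow> bool" where
  "gen_closed gs F \<longleftrightarrow> degreewise F \<and> (\<forall>v. sm (F v)) \<and>
     (\<forall>(a, j)\<in>set gs. \<forall>v. \<forall>z\<in>F v. a \<bullet> z \<in> F (inc j v))"

fun low :: "('a \<times> nat) \<Rightarrow> ((nat \<Rightarrow> nat) \<Rightarrow> 'b set) \<Rightarrow> nat \<Rightarrow> (nat \<Rightarrow> nat) \<Rightarrow> 'b set" where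
  "low (a, j) B 0 v = {\<zero>\<^sub>M}"
| "low (a, j) B (Suc n) v = low (a, j) B n v \<uplus>
     (if n \<le> v j then elem_smult M (a [^] n) (B (v(j := v j - n))) else {\<zero>\<^sub>M})"

text \<open>The component of degree \<open>v\<close> of \<open>M[X\<^sub>1, \<dots>, X\<^sub>q]\<close> mapped into \<open>M\<close> by sending the variables to
  the elements of the list, the element \<open>(a, j)\<close> having degree \<open>e\<^sub>j\<close>; \<open>low p B n\<close> is the part of
  degree less than \<open>n\<close> in the variable of \<open>p\<close>.\<close>

primrec gen_comp :: "('a \<times> nat) list \<Rightarrow> (nat \<Rightarrow> nat) \<Rightarrow> 'b set" where
  "gen_comp [] v = (if \<forall>i\<le>d. v i = 0 then carrier M else {\<zero>\<^sub>M})"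
| "gen_comp (p # gs) v = (\<Union>n. low p (gen_comp gs) n v)"

lemma gen_closedD:
  assumes "gen_closed gs F"
  shows "sm (F v)" "(\<And>i. i \<le> d \<Longrightarrow> v i = w i) \<Longrightarrow> F v = F w"
    "(a, j) \<in> set gs \<Longrightarrow> z \<in> F v \<Longrightarrow> a \<bullet> z \<in> F (inc j v)"
  using assms unfolding gen_closed_def degreewise_def by blast+

lemma gen_closedI:
  assumes "\<And>v w. (\<And>i. i \<le> d \<Longrightarrow> v i = w i) \<Longrightarrow> F v = F w" "\<And>v. sm (F v)"
    "\<And>a j v z. (a, j) \<in> set gs \<Longrightarrow> z \<in> F v \<Longrightarrow> a \<bullet> z \<in> F (inc j v)"
  shows "gen_closed gs F"
  using assms unfolding gen_closed_def degreewise_def by blast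

context
  fixes a :: 'a and j :: nat and gs :: "('a \<times> nat) list" and B :: "(nat \<Rightarrow> nat) \<Rightarrow> 'b set"
  assumes aR: "a \<in> carrier R" and j: "j \<le> d" and gs_mem: "\<forall>(b, i)\<in>set gs. b \<in> carrier R \<and> i \<le> d"
    and B: "gen_closed gs B"
begin

lemma gsR: "(b, i) \<in> set gs \<Longrightarrow> b \<in> carrier R \<and> i \<le> d"
  using gs_mem by blast

lemma sm_summand: "sm (if n \<le> v j then elem_smult M (a [^] (n::nat)) (B (v(j := v j - n))) else {\<zero>\<^sub>M})"
  using sm_elem_smult[OF R.nat_pow_closed[OF aR] gen_closedD(1)[OF B]] sm_zero_set by simp

lemma sm_low: "sm (low (a, j) B n v)"
  by (induct n) (simp_all only: low.simps sm_zero_set sm_ssum sm_summand)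

lemma low_Suc: "low (a, j) B n v \<subseteq> low (a, j) B (Suc n) v"
  unfolding low.simps by (rule ssum_ub1[OF sm_carrier[OF sm_low] sm_summand])

lemma low_top: "n \<le> v j \<Longrightarrow> u \<in> B (v(j := v j - n)) \<Longrightarrow> a [^] n \<bullet> u \<in> low (a, j) B (Suc n) v"
  using ssum_ub2[OF sm_low sm_carrier[OF sm_summand], of n v n v] elem_smult_incl by auto

lemma low_cong: "(\<And>i. i \<le> d \<Longrightarrow> v i = w i) \<Longrightarrow> low (a, j) B n v = low (a, j) B n w"
proof (induct n)
  case (Suc n)
  have "B (v(j := v j - n)) = B (w(j := w j - n))"
    by (rule gen_closedD(2)[OF B]) (use Suc(2) j in auto)
  thus ?case using Suc j by simp
qed simp

lemma low_gens:
  assumes b: "(b, i) \<in> set gs" and z: "z \<in> low (a, j) B n v"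
  shows "b \<bullet> z \<in> low (a, j) B n (inc i v)"
  using z
proof (induct n arbitrary: z)
  case 0
  thus ?case using gsR[OF b] by simp
next
  case (Suc n)
  have bR: "b \<in> carrier R" using gsR[OF b] by simp
  from Suc(2) obtain y w where *: "y \<in> low (a, j) B n v" "z = y \<oplus>\<^sub>M w"
    "w \<in> (if n \<le> v j then elem_smult M (a [^] n) (B (v(j := v j - n))) else {\<zero>\<^sub>M})"
    unfolding low.simps mem_ssum by blast
  have car: "y \<in> carrier M" "w \<in> carrier M" using * sm_mem[OF sm_low] sm_mem[OF sm_summand] by blast+
  have "b \<bullet> w \<in> low (a, j) B (Suc n) (inc i v)"
  proof (cases "n \<le> v j")
    case True
    then obtain u where u: "u \<in> B (v(j := v j - n))" "w = a [^] n \<bullet> u"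
      using * by (auto simp: elem_smult_def)
    have e: "inc i (v(j := v j - n)) = (inc i v)(j := inc i v j - n)"
      using True by (simp add: fun_eq_iff Suc_diff_le)
    have "b \<bullet> u \<in> B ((inc i v)(j := inc i v j - n))"
      using gen_closedD(3)[OF B, OF b u(1)] by (simp only: e)
    hence "a [^] n \<bullet> (b \<bullet> u) \<in> low (a, j) B (Suc n) (inc i v)"
      using True by (intro low_top) auto
    moreover have "a [^] n \<bullet> (b \<bullet> u) = b \<bullet> w"
      unfolding u using sm_mem[OF gen_closedD(1)[OF B] u(1)] aR bR by (intro smult_commute) auto
    ultimately show ?thesis by simp
  next
    case False
    hence "b \<bullet> w = \<zero>\<^sub>M" using * bR by simp
    thus ?thesis by (simp only: sm_zero[OF sm_low])
  qed
  moreover have "b \<bullet> y \<in> low (a, j) B (Suc n) (inc i v)" using Suc(1)[OF *(1)] low_Suc by blast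
  ultimately show ?case using * car bR sm_add[OF sm_low] by (simp only: smult_r_distr)
qed

lemma low_step:
  assumes z: "z \<in> low (a, j) B n v"
  shows "a \<bullet> z \<in> low (a, j) B (Suc n) (inc j v)"
  using z
proof (induct n arbitrary: z)
  case 0
  hence "a \<bullet> z = \<zero>\<^sub>M" using aR by simp
  thus ?case using sm_zero[OF sm_low, of "Suc 0" "inc j v"] by (simp only:)
next
  case (Suc n)
  from Suc(2) obtain y w where *: "y \<in> low (a, j) B n v" "z = y \<oplus>\<^sub>M w"
    "w \<in> (if n \<le> v j then elem_smult M (a [^] n) (B (v(j := v j - n))) else {\<zero>\<^sub>M})"
    unfolding low.simps mem_ssum by blast
  have car: "y \<in> carrier M" "w \<in> carrier M" using * sm_mem[OF sm_low] sm_mem[OF sm_summand] by blast+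
  have "a \<bullet> w \<in> low (a, j) B (Suc (Suc n)) (inc j v)"
  proof (cases "n \<le> v j")
    case True
    then obtain u where u: "u \<in> B (v(j := v j - n))" "w = a [^] n \<bullet> u"
      using * by (auto simp: elem_smult_def)
    have "v(j := v j - n) = (inc j v)(j := inc j v j - Suc n)" by auto
    hence "a [^] Suc n \<bullet> u \<in> low (a, j) B (Suc (Suc n)) (inc j v)"
      using True u(1) by (intro low_top) auto
    moreover have "a [^] Suc n \<bullet> u = a \<bullet> w"
      unfolding u using sm_mem[OF gen_closedD(1)[OF B] u(1)] aR
      by (simp add: smult_assoc1[symmetric] R.m_comm)
    ultimately show ?thesis by simp
  next
    case False
    hence "a \<bullet> w = \<zero>\<^sub>M" using * aR by simp
    thus ?thesis by (simp only: sm_zero[OF sm_low])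
  qed
  moreover have "a \<bullet> y \<in> low (a, j) B (Suc (Suc n)) (inc j v)" using Suc(1)[OF *(1)] low_Suc by blast
  ultimately show ?case using * car aR sm_add[OF sm_low] by (simp only: smult_r_distr)
qed

text \<open>Leading coefficients of degree \<open>n\<close> in the variable that is sent to
  \<open>a\<close>. As everything takes place in \<open>M\<close>, representations are not unique,
  so \<open>u\<close> counts as soon as some element of \<open>F\<close> differs from
  \<open>a [^] n \<bullet> u\<close> by terms of lower degree.\<close>

definition initial :: "nat \<Rightarrow> ((nat \<Rightarrow> nat) \<Rightarrow> 'b set) \<Rightarrow> (nat \<Rightarrow> nat) \<Rightarrow> 'b set" where
  "initial n F v = {u \<in> B v. \<exists>w\<in>F (v(j := v j + n)). w \<ominus>\<^sub>M a [^] n \<bullet> u \<in> low (a, j) B n (v(j := v j + n))}"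

lemma initialI:
  "u \<in> B v \<Longrightarrow> w \<in> F (v(j := v j + n)) \<Longrightarrow> w \<ominus>\<^sub>M a [^] n \<bullet> u \<in> low (a, j) B n (v(j := v j + n)) \<Longrightarrow>
     u \<in> initial n F v"
  unfolding initial_def by blast

lemma initialE:
  assumes "u \<in> initial n F v"
  obtains w where "u \<in> B v" "w \<in> F (v(j := v j + n))"
    "w \<ominus>\<^sub>M a [^] n \<bullet> u \<in> low (a, j) B n (v(j := v j + n))"
  using assms unfolding initial_def by blast

text \<open>The target degree \<open>v'\<close> is left free to cover both scalars, with
  \<open>v' = v\<close>, and the elements of \<open>gs\<close>, which raise the degree.\<close>

lemma initial_smult:
  assumes F: "\<And>v. sm (F v)" and u: "u \<in> initial n F v" and c: "c \<in> carrier R"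
    and B': "c \<bullet> u \<in> B v'"
    and F': "\<And>w. w \<in> F (v(j := v j + n)) \<Longrightarrow> c \<bullet> w \<in> F (v'(j := v' j + n))"
    and l': "\<And>w. w \<in> low (a, j) B n (v(j := v j + n)) \<Longrightarrow> c \<bullet> w \<in> low (a, j) B n (v'(j := v' j + n))"
  shows "c \<bullet> u \<in> initial n F v'"
proof -
  obtain w where w: "u \<in> B v" "w \<in> F (v(j := v j + n))"
    "w \<ominus>\<^sub>M a [^] n \<bullet> u \<in> low (a, j) B n (v(j := v j + n))" by (rule initialE[OF u])
  have car: "u \<in> carrier M" "w \<in> carrier M" using w sm_mem[OF F] sm_mem[OF gen_closedD(1)[OF B]] by blast+
  have "c \<bullet> w \<ominus>\<^sub>M a [^] n \<bullet> (c \<bullet> u) = c \<bullet> (w \<ominus>\<^sub>M a [^] n \<bullet> u)"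
    using car c aR by (simp add: smult_diff smult_commute[of "a [^] n" c u])
  thus ?thesis using l'[OF w(3)] F'[OF w(2)] B' by (intro initialI) auto
qed

lemma gen_closed_initial:
  assumes F: "gen_closed ((a, j) # gs) F" shows "gen_closed gs (initial n F)"
proof (rule gen_closedI)
  note smF = gen_closedD(1)[OF F] and smB = gen_closedD(1)[OF B]
  show "initial n F v = initial n F w" if vw: "\<And>i. i \<le> d \<Longrightarrow> v i = w i" for v w
  proof -
    have "B v = B w" "F (v(j := v j + n)) = F (w(j := w j + n))"
      "low (a, j) B n (v(j := v j + n)) = low (a, j) B n (w(j := w j + n))"
      by (rule gen_closedD(2)[OF B] gen_closedD(2)[OF F] low_cong; use vw j in auto)+
    thus ?thesis by (simp add: initial_def)
  qed
  show "sm (initial n F v)" for v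
  proof (rule smI)
    show "initial n F v \<subseteq> carrier M" using sm_carrier[OF smB] unfolding initial_def by blast
    show "\<zero>\<^sub>M \<in> initial n F v"
      by (rule initialI[OF sm_zero[OF smB] sm_zero[OF smF]])
        (use aR sm_minus[OF sm_low sm_zero[OF sm_low] sm_zero[OF sm_low]] in simp)
    show "c \<bullet> u \<in> initial n F v" if "c \<in> carrier R" "u \<in> initial n F v" for c u
      by (rule initial_smult[OF smF that(2,1) sm_smult[OF smB that(1)] sm_smult[OF smF that(1)]
            sm_smult[OF sm_low that(1)]]) (use that in \<open>auto simp: initial_def\<close>)
    show "u \<oplus>\<^sub>M u' \<in> initial n F v" if u: "u \<in> initial n F v" and u': "u' \<in> initial n F v" for u u'
    proof -
      let ?v = "v(j := v j + n)"
      obtain w where w: "u \<in> B v" "w \<in> F ?v" "w \<ominus>\<^sub>M a [^] n \<bullet> u \<in> low (a, j) B n ?v"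
        by (rule initialE[OF u])
      obtain w' where w': "u' \<in> B v" "w' \<in> F ?v" "w' \<ominus>\<^sub>M a [^] n \<bullet> u' \<in> low (a, j) B n ?v"
        by (rule initialE[OF u'])
      have car: "u \<in> carrier M" "w \<in> carrier M" "u' \<in> carrier M" "w' \<in> carrier M"
        using w w' sm_mem[OF smF] sm_mem[OF smB] by blast+
      have "(w \<oplus>\<^sub>M w') \<ominus>\<^sub>M a [^] n \<bullet> (u \<oplus>\<^sub>M u') =
          (w \<ominus>\<^sub>M a [^] n \<bullet> u) \<oplus>\<^sub>M (w' \<ominus>\<^sub>M a [^] n \<bullet> u')"
        using car aR by (simp add: smult_r_distr M.minus_eq M.minus_add M.a_ac)
      thus ?thesis using w w' sm_add[OF smB] sm_add[OF smF] sm_add[OF sm_low]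
        by (intro initialI[of _ _ "w \<oplus>\<^sub>M w'"]) auto
    qed
  qed
  show "b \<bullet> u \<in> initial n F (inc i v)" if b: "(b, i) \<in> set gs" and u: "u \<in> initial n F v" for b i v u
  proof (rule initial_smult[OF smF u])
    have e: "inc i (v(j := v j + n)) = (inc i v)(j := inc i v j + n)" by auto
    show "b \<in> carrier R" using gsR[OF b] by simp
    show "b \<bullet> u \<in> B (inc i v)" using gen_closedD(3)[OF B, OF b] u by (auto simp: initial_def)
    show "b \<bullet> w \<in> F ((inc i v)(j := inc i v j + n))" if "w \<in> F (v(j := v j + n))" for w
      using gen_closedD(3)[OF F, OF _ that, of b i] b unfolding e by simp
    show "b \<bullet> w \<in> low (a, j) B n ((inc i v)(j := inc i v j + n))" if "w \<in> low (a, j) B n (v(j := v j + n))" for w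
      using low_gens[OF b that] unfolding e[symmetric] .
  qed
qed

text \<open>Multiplication by \<open>a\<close> keeps the leading coefficient and raises the degree
  by one. This is the monotonicity in \<open>n\<close> that \<open>acc_double\<close> asks
  for.\<close>

lemma initial_Suc:
  assumes F: "gen_closed ((a, j) # gs) F" shows "initial n F v \<subseteq> initial (Suc n) F v"
proof
  note smF = gen_closedD(1)[OF F] and smB = gen_closedD(1)[OF B]
  fix u assume u: "u \<in> initial n F v"
  obtain w where w: "u \<in> B v" "w \<in> F (v(j := v j + n))"
    "w \<ominus>\<^sub>M a [^] n \<bullet> u \<in> low (a, j) B n (v(j := v j + n))" by (rule initialE[OF u])
  have car: "u \<in> carrier M" "w \<in> carrier M" using w sm_mem[OF smF] sm_mem[OF smB] by blast+
  have e: "inc j (v(j := v j + n)) = v(j := v j + Suc n)" by auto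
  have "a \<bullet> w \<ominus>\<^sub>M a [^] Suc n \<bullet> u = a \<bullet> (w \<ominus>\<^sub>M a [^] n \<bullet> u)"
    using car aR by (simp add: smult_diff smult_assoc1[symmetric] R.m_comm)
  moreover have "a \<bullet> w \<in> F (v(j := v j + Suc n))"
    using gen_closedD(3)[OF F, OF _ w(2), of a j] unfolding e by simp
  ultimately show "u \<in> initial (Suc n) F v"
    using low_step[OF w(3)] w(1) unfolding e by (intro initialI) auto
qed

text \<open>Induction on the degree in the new variable: an element \<open>z\<close> of the larger
  family shares its leading coefficient with some \<open>t\<close> of the smaller one, and
  \<open>z - t\<close> has lower degree and still lies in the larger family.\<close>

lemma initial_eq_imp_eq:
  assumes F: "\<And>v. sm (F v)" and F': "\<And>v. sm (F' v)" and le: "\<And>v. F v \<subseteq> F' v"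
    and bd: "\<And>v. F' v \<subseteq> (\<Union>n. low (a, j) B n v)"
    and eq: "\<And>n. initial n F = initial n F'"
  shows "F = F'"
proof -
  have "z \<in> F v" if "z \<in> F' v" "z \<in> low (a, j) B n v" for z n v
    using that
  proof (induct n arbitrary: z)
    case 0
    thus ?case using sm_zero[OF F] by simp
  next
    case (Suc n)
    from Suc(3) obtain y w where *: "y \<in> low (a, j) B n v" "z = y \<oplus>\<^sub>M w"
      "w \<in> (if n \<le> v j then elem_smult M (a [^] n) (B (v(j := v j - n))) else {\<zero>\<^sub>M})"
      unfolding low.simps mem_ssum by blast
    have car: "y \<in> carrier M" "w \<in> carrier M" using * sm_mem[OF sm_low] sm_mem[OF sm_summand] by blast+
    show ?case
    proof (cases "n \<le> v j")
      case True
      then obtain u where u: "u \<in> B (v(j := v j - n))" "w = a [^] n \<bullet> u"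
        using * by (auto simp: elem_smult_def)
      let ?v = "v(j := v j - n)"
      have e: "?v(j := ?v j + n) = v" using True by auto
      have "z \<ominus>\<^sub>M w \<in> low (a, j) B n v" using * car by simp
      hence "u \<in> initial n F' ?v" using u Suc(2) by (intro initialI[of _ _ z]) (simp_all only: e)
      hence "u \<in> initial n F ?v" by (simp add: eq)
      then obtain t where t: "t \<in> F v" "t \<ominus>\<^sub>M w \<in> low (a, j) B n v"
        unfolding e u(2) by (rule initialE[of u n F ?v, unfolded e]) auto
      have tc: "t \<in> carrier M" using t sm_mem[OF F] by blast
      have "z \<ominus>\<^sub>M t = (z \<ominus>\<^sub>M w) \<ominus>\<^sub>M (t \<ominus>\<^sub>M w)"
        using diff_diff_diff[of z t w] car tc * by simp
      hence "z \<ominus>\<^sub>M t \<in> low (a, j) B n v" using sm_minus[OF sm_low] t \<open>z \<ominus>\<^sub>M w \<in> _\<close> by simp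
      moreover have "z \<ominus>\<^sub>M t \<in> F' v" by (rule sm_minus[OF F' Suc(2) subsetD[OF le t(1)]])
      ultimately have "z \<ominus>\<^sub>M t \<in> F v" using Suc(1) by blast
      moreover have "z \<in> carrier M" by (rule sm_mem[OF F' Suc(2)])
      ultimately show ?thesis using sm_diff_cancel[OF F _ t(1)] by blast
    next
      case False
      thus ?thesis using Suc * car by simp
    qed
  qed
  thus ?thesis using le bd by (intro ext) blast
qed

end

end

text \<open>Noetherian induction, with the hypothesis available for all strictly larger elements. A
  counterexample would start a strictly increasing chain by dependent choice.\<close>

lemma acc_induct [consumes 2, case_names step]:
  assumes acc: "acc Q" and x: "Q x"
    and step: "\<And>x. Q x \<Longrightarrow> (\<And>y. Q y \<Longrightarrow> x < y \<Longrightarrow> P y) \<Longrightarrow> P x"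
  shows "P x"
proof (rule ccontr)
  assume nP: "\<not> P x"
  have "\<exists>f. f 0 = x \<and> (\<forall>n::nat. (Q (f n) \<and> \<not> P (f n)) \<and> f n < f (Suc n))"
  proof -
    have "\<exists>f. \<forall>n. ((Q (f n) \<and> \<not> P (f n)) \<and> (n = 0 \<longrightarrow> f n = x)) \<and> f n < f (Suc n)"
    proof (rule dependent_nat_choice[where P = "\<lambda>n y. (Q y \<and> \<not> P y) \<and> (n = 0 \<longrightarrow> y = x)"
        and Q = "\<lambda>n y z. y < z"])
      show "\<exists>y. (Q y \<and> \<not> P y) \<and> (0 = (0::nat) \<longrightarrow> y = x)" using x nP by blast
      fix y and n :: nat
      assume y: "(Q y \<and> \<not> P y) \<and> (n = 0 \<longrightarrow> y = x)"
      then obtain z where "Q z" "y < z" "\<not> P z" using step by blast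
      thus "\<exists>z. ((Q z \<and> \<not> P z) \<and> (Suc n = 0 \<longrightarrow> z = x)) \<and> y < z" by blast
    qed
    thus ?thesis by blast
  qed
  then obtain f where f: "\<And>n. Q (f n)" "\<And>n. f n < f (Suc n)" by blast
  obtain n0 where "\<And>n. n \<ge> n0 \<Longrightarrow> f n = f n0"
    using accD[OF acc, of f] f less_imp_le by metis
  from this[of "Suc n0"] f(2)[of n0] show False by simp
qed

lemma acc_maximal:
  assumes acc: "acc Q" and x: "Q x"
  obtains y where "Q y" "x \<le> y" "\<And>z. Q z \<Longrightarrow> y \<le> z \<Longrightarrow> z = y"
proof -
  have "\<exists>y. Q y \<and> x \<le> y \<and> (\<forall>z. Q z \<longrightarrow> y \<le> z \<longrightarrow> z = y)"
    using acc x
  proof (induct x rule: acc_induct)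
    case (step x)
    show ?case
    proof (cases "\<forall>z. Q z \<longrightarrow> x \<le> z \<longrightarrow> z = x")
      case True
      thus ?thesis using step(1) by blast
    next
      case False
      then obtain z where "Q z" "x < z" by (metis order_le_less)
      thus ?thesis using step(2)[of z] by (metis order_less_imp_le order_trans)
    qed
  qed
  thus ?thesis using that by blast
qed

context noetherian_power_family
begin

lemma gen_closed_gen_comp:
  assumes "\<forall>(b, i)\<in>set gs. b \<in> carrier R \<and> i \<le> d"
  shows "gen_closed gs (gen_comp gs)"
  using assms
proof (induct gs)
  case Nil
  show ?case
    by (rule gen_closedI) (auto simp: sm_carrier_whole sm_zero_set)
next
  case (Cons p gs)
  obtain a j where p: "p = (a, j)" by (cases p)
  have aR: "a \<in> carrier R" and j: "j \<le> d" using Cons(2) p by auto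
  have gsR: "\<forall>(b, i)\<in>set gs. b \<in> carrier R \<and> i \<le> d" using Cons(2) by auto
  have B: "gen_closed gs (gen_comp gs)" using Cons(1) gsR by blast
  note ctx = aR j gsR B
  show ?case unfolding p
  proof (rule gen_closedI)
    fix v w :: "nat \<Rightarrow> nat" assume vw: "\<And>i. i \<le> d \<Longrightarrow> v i = w i"
    have "low (a, j) (gen_comp gs) n v = low (a, j) (gen_comp gs) n w" for n
      by (rule low_cong[OF ctx vw])
    thus "gen_comp ((a, j) # gs) v = gen_comp ((a, j) # gs) w" by simp
  next
    show "sm (gen_comp ((a, j) # gs) v)" for v
      unfolding gen_comp.simps by (rule sm_UN_chain[of "\<lambda>n. low (a, j) (gen_comp gs) n v", OF sm_low[OF ctx] low_Suc[OF ctx]])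
  next
    fix b i v z assume b: "(b, i) \<in> set ((a, j) # gs)" and z: "z \<in> gen_comp ((a, j) # gs) v"
    then obtain n where n: "z \<in> low (a, j) (gen_comp gs) n v" by auto
    show "b \<bullet> z \<in> gen_comp ((a, j) # gs) (inc i v)"
    proof (cases "(b, i) = (a, j)")
      case True
      thus ?thesis using low_step[OF ctx n] by (auto simp del: low.simps)
    next
      case False
      hence "(b, i) \<in> set gs" using b by auto
      from low_gens[OF ctx this n] show ?thesis by (auto simp del: low.simps)
    qed
  qed
qed

text \<open>Each generator is one step of Hilbert's basis theorem. Without generators only degree
  zero is left, where the chain condition of \<open>M\<close> applies. With one more, the leading
  coefficients form a double chain for the shorter list; \<open>acc_double\<close> makes it constant
  uniformly in \<open>n\<close>, and \<open>initial_eq_imp_eq\<close> concludes.\<close>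

lemma acc_gen_closed:
  assumes "\<forall>(b, i)\<in>set gs. b \<in> carrier R \<and> i \<le> d"
  shows "acc (\<lambda>F. gen_closed gs F \<and> F \<le> gen_comp gs)"
  using assms
proof (induct gs)
  case Nil
  show ?case unfolding acc_def
  proof (intro allI impI)
    fix F :: "nat \<Rightarrow> (nat \<Rightarrow> nat) \<Rightarrow> 'b set"
    assume F: "\<forall>n. gen_closed [] (F n) \<and> F n \<le> gen_comp []" and mono: "\<forall>n. F n \<le> F (Suc n)"
    have F1: "gen_closed [] (F n)" for n using F by blast
    obtain n0 where n0: "\<And>n. n \<ge> n0 \<Longrightarrow> F n (\<lambda>_. 0) = F n0 (\<lambda>_. 0)"
      using accD[OF acc_submodules[OF noetherian fin_gen], of "\<lambda>n. F n (\<lambda>_. 0)"]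
        gen_closedD(1)[OF F1] mono by (auto simp: le_fun_def)
    have "F n v = F n0 v" if "n \<ge> n0" for n v
    proof (cases "\<forall>i\<le>d. v i = 0")
      case True
      hence "F n v = F n (\<lambda>_. 0)" for n by (intro gen_closedD(2)[OF F1]) auto
      thus ?thesis using n0[OF that] by simp
    next
      case False
      have "F n v \<subseteq> gen_comp [] v" for n using F by (auto simp only: le_fun_def)
      hence "F n v \<subseteq> {\<zero>\<^sub>M}" for n using False by (simp only: gen_comp.simps if_False)
      hence "F n v = {\<zero>\<^sub>M}" for n using sm_zero[OF gen_closedD(1)[OF F1]] by blast
      thus ?thesis by simp
    qed
    hence "\<forall>n\<ge>n0. F n = F n0" by blast
    thus "\<exists>n0. \<forall>n\<ge>n0. F n = F n0" ..
  qed
next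
  case (Cons p gs)
  obtain a j where p: "p = (a, j)" by (cases p)
  have aR: "a \<in> carrier R" and j: "j \<le> d" using Cons(2) p by auto
  have gsR: "\<forall>(b, i)\<in>set gs. b \<in> carrier R \<and> i \<le> d" using Cons(2) by auto
  have B: "gen_closed gs (gen_comp gs)" using gsR by (rule gen_closed_gen_comp)
  have acc: "acc (\<lambda>F. gen_closed gs F \<and> F \<le> gen_comp gs)" using Cons(1) gsR by blast
  note ctx = aR j gsR B
  show ?case unfolding acc_def
  proof (intro allI impI)
    fix F :: "nat \<Rightarrow> (nat \<Rightarrow> nat) \<Rightarrow> 'b set"
    assume F: "\<forall>n. gen_closed (p # gs) (F n) \<and> F n \<le> gen_comp (p # gs)" and mono: "\<forall>n. F n \<le> F (Suc n)"
    have F1: "gen_closed ((a, j) # gs) (F n)" for n using F p by blast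
    have F2: "F n v \<subseteq> (\<Union>m. low (a, j) (gen_comp gs) m v)" for n v using F p by (auto simp: le_fun_def)
    have mono': "F m \<le> F n" if "m \<le> n" for m n using lift_Suc_mono_le[of F m n] mono that by blast
    let ?G = "\<lambda>s n. initial a j (gen_comp gs) n (F s)"
    have G1: "gen_closed gs (?G s n) \<and> ?G s n \<le> gen_comp gs" for s n
      using gen_closed_initial[OF ctx F1] by (blast intro: le_funI elim: initialE[OF ctx])
    have G2: "?G s n \<le> ?G (Suc s) n" for s n
      using mono by (fastforce simp: initial_def[OF ctx] le_fun_def)
    have G3: "?G s n \<le> ?G s (Suc n)" for s n
      using initial_Suc[OF ctx F1] by (simp add: le_fun_def)
    obtain s0 where s0: "\<And>s n. s \<ge> s0 \<Longrightarrow> ?G s n = ?G s0 n"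
      using acc_double[of _ ?G, OF acc G1 G2 G3] by blast
    have "F s = F s0" if "s \<ge> s0" for s
      by (rule initial_eq_imp_eq[OF ctx, symmetric])
        (use gen_closedD(1)[OF F1] F2 mono'[OF that] s0[OF that] in \<open>auto simp: le_fun_def\<close>)
    thus "\<exists>n0. \<forall>n\<ge>n0. F n = F n0" by blast
  qed
qed

lemma ideal_gens:
  assumes "ideal I R" obtains S where "finite S" "S \<subseteq> I" "I = Idl S"
proof -
  obtain S where "S \<subseteq> carrier R" "finite S" "I = Idl S"
    using noetherian_ring.finetely_gen[OF noetherian assms] by blast
  thus ?thesis using that R.genideal_self by blast
qed

text \<open>Finite generating sets of the ideals \<open>K i\<close>, tagged with their degrees, form
  a list \<open>gs\<close>. The Rees module lies inside \<open>gen_comp gs\<close>, because the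
  latter contains \<open>M\<close> in degree zero and is closed under all of \<open>K i\<close>;
  hence the chain condition for \<open>gs\<close> applies.\<close>

theorem acc_graded_sub: "acc graded_sub"
proof -
  have "\<forall>i. \<exists>S. i \<le> d \<longrightarrow> finite S \<and> S \<subseteq> K i \<and> K i = Idl S"
    using ideal_gens[OF K_ideal] by metis
  then obtain S where S: "\<And>i. i \<le> d \<Longrightarrow> finite (S i)" "\<And>i. i \<le> d \<Longrightarrow> S i \<subseteq> K i"
    "\<And>i. i \<le> d \<Longrightarrow> K i = Idl (S i)" by metis
  have "finite (\<Union>i\<in>{..d}. S i \<times> {i})" using S by auto
  then obtain gs where gs: "set gs = (\<Union>i\<in>{..d}. S i \<times> {i})" using finite_list by metis
  have gsR: "\<forall>(b, i)\<in>set gs. b \<in> carrier R \<and> i \<le> d"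
    using S(2) K_mem unfolding gs by auto
  have cl: "gen_closed gs (gen_comp gs)" using gsR by (rule gen_closed_gen_comp)
  have K: "a \<bullet> z \<in> gen_comp gs (inc i v)" if i: "i \<le> d" and a: "a \<in> K i" and z: "z \<in> gen_comp gs v" for a i v z
  proof (rule colon_genideal[of "S i"])
    show "S i \<subseteq> carrier R" using S(2)[OF i] K_mem[OF i] by blast
    show "b \<bullet> z \<in> gen_comp gs (inc i v)" if "b \<in> S i" for b
      using gen_closedD(3)[OF cl, OF _ z] that i gs by blast
    show "a \<in> Idl (S i)" using a S(3)[OF i] by simp
    show "z \<in> carrier M" by (rule sm_mem[OF gen_closedD(1)[OF cl] z])
  qed (rule gen_closedD(1)[OF cl])
  have zero: "gen_comp gs (\<lambda>_. 0) = carrier M"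
    using gsR
  proof (induct gs)
    case (Cons p gs)
    obtain a j where p: "p = (a, j)" by (cases p)
    have *: "\<forall>(b, i)\<in>set gs. b \<in> carrier R \<and> i \<le> d" using Cons(2) by auto
    have aR: "a \<in> carrier R" and j: "j \<le> d" using Cons(2) p by auto
    have B: "gen_closed gs (gen_comp gs)" using * by (rule gen_closed_gen_comp)
    note ctx = aR j * B
    have "carrier M \<subseteq> low (a, j) (gen_comp gs) (Suc 0) (\<lambda>_. 0)"
    proof
      fix z assume z: "z \<in> carrier M"
      have "(\<lambda>_. 0)(j := (0::nat) - 0) = (\<lambda>_. 0)" by auto
      hence "a [^] (0::nat) \<bullet> z \<in> low (a, j) (gen_comp gs) (Suc 0) (\<lambda>_. 0)"
        using Cons(1)[OF *] z by (intro low_top[OF ctx]) simp_all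
      thus "z \<in> low (a, j) (gen_comp gs) (Suc 0) (\<lambda>_. 0)" using z by (simp del: low.simps)
    qed
    moreover have "gen_comp ((a, j) # gs) (\<lambda>_. 0) \<subseteq> carrier M"
      by (rule sm_carrier[OF gen_closedD(1)[OF gen_closed_gen_comp]]) (use Cons(2) p in auto)
    ultimately show ?case unfolding p by (auto simp del: low.simps)
  qed simp
  have U: "U v \<subseteq> gen_comp gs v" for v
  proof (induct v rule: multiindex_induct)
    case (1 v w)
    thus ?case using U_cong[of v w] gen_closedD(2)[OF cl, of v w] by simp
  next
    case 2
    show ?case using zero U_0 by simp
  next
    case (3 v j)
    show ?case unfolding U_inc[OF 3(1)]
      by (rule ideal_smult_least[OF gen_closedD(1)[OF cl]]) (use K 3 in blast)
  qed
  show ?thesis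
  proof (rule acc_subset)
    show "acc (\<lambda>F. gen_closed gs F \<and> F \<le> gen_comp gs)" using gsR by (rule acc_gen_closed)
    fix F assume F: "graded_sub F"
    have "gen_closed gs F"
    proof (rule gen_closedI)
      show "F v = F w" if "\<And>i. i \<le> d \<Longrightarrow> v i = w i" for v w by (rule graded_subD(4)[OF F that])
      show "sm (F v)" for v by (rule graded_subD(1)[OF F])
      show "a \<bullet> z \<in> F (inc j v)" if "(a, j) \<in> set gs" "z \<in> F v" for a j v z
        using graded_subD(5)[OF F] that S(2) gs by blast
    qed
    thus "gen_closed gs F \<and> F \<le> gen_comp gs" using graded_subD(2)[OF F] U by (auto simp: le_fun_def)
  qed
qed

text \<open>The parts generated in degrees bounded by \<open>s\<close> in every coordinate form an
  ascending chain of graded submodules, so some bound \<open>D\<close> achieves as much as any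
  larger one. In a given degree \<open>v\<close>, a bound above all coordinates of \<open>v\<close>
  already yields all of \<open>F v\<close>.\<close>

theorem graded_sub_bounded_gen:
  assumes F: "graded_sub F"
  obtains D where "\<And>v. F v = pw (\<lambda>i. v i - min (v i) D) (F (\<lambda>i. min (v i) D))"
proof -
  \<comment> \<open>Among the degrees below \<open>v\<close> with coordinates at most
    \<open>s\<close>, the truncation \<open>min v s\<close> is the largest, so this one term
    generates the whole part.\<close>
  define G where "G s v = pw (\<lambda>i. v i - min (v i) s) (F (\<lambda>i. min (v i) s))" for s v
  have smF: "sm (F v)" for v by (rule graded_subD(1)[OF F])
  have G: "graded_sub (G s)" for s
  proof (rule graded_subI)
    show "G s v = G s w" if vw: "\<And>i. i \<le> d \<Longrightarrow> v i = w i" for v w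
    proof -
      have "F (\<lambda>i. min (v i) s) = F (\<lambda>i. min (w i) s)" by (rule graded_subD(4)[OF F]) (simp add: vw)
      thus ?thesis unfolding G_def by (simp only:) (rule pw_cong, simp add: vw)
    qed
    show "sm (G s v)" for v unfolding G_def by (rule sm_pw[OF graded_subD(3)[OF F]])
    have "G s v \<subseteq> F (\<lambda>i. (v i - min (v i) s) + min (v i) s)" for v
      unfolding G_def by (rule graded_sub_pw[OF F])
    hence "G s v \<subseteq> F v" for v by simp
    thus "G s v \<subseteq> U v" for v using graded_subD(2)[OF F] by blast
    show "a \<bullet> z \<in> G s (inc j v)" if j: "j \<le> d" and a: "a \<in> K j" and z: "z \<in> G s v" for v j a z
    proof (cases "v j < s")
      case True
      have e1: "(\<lambda>i. min (inc j v i) s) = inc j (\<lambda>i. min (v i) s)" using True by auto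
      have "pw (\<lambda>i. v i - min (v i) s) (F (\<lambda>i. min (v i) s))
        \<subseteq> {z \<in> carrier M. \<forall>a\<in>K j. a \<bullet> z \<in> G s (inc j v)}"
      proof (rule ideal_smult_least[OF sm_colon[OF K_ideal[OF j]]])
        show "sm (G s (inc j v))" unfolding G_def by (rule sm_pw[OF graded_subD(3)[OF F]])
        fix b w assume b: "b \<in> PP (\<lambda>i. v i - min (v i) s)" and w: "w \<in> F (\<lambda>i. min (v i) s)"
        have bR: "b \<in> carrier R" and wM: "w \<in> carrier M" using b w PP_carrier sm_mem[OF smF] by auto
        { fix a assume a: "a \<in> K j"
          have aR: "a \<in> carrier R" using K_mem[OF j a] .
          have "a \<bullet> w \<in> F (\<lambda>i. min (inc j v i) s)" unfolding e1 by (rule graded_subD(5)[OF F, OF j a w])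
          hence "b \<bullet> (a \<bullet> w) \<in> pw (\<lambda>i. v i - min (v i) s) (F (\<lambda>i. min (inc j v i) s))"
            using b by (intro ideal_smult_incl)
          also have "pw (\<lambda>i. v i - min (v i) s) (F (\<lambda>i. min (inc j v i) s)) = G s (inc j v)"
            unfolding G_def by (rule pw_cong) (use True in auto)
          finally have "a \<bullet> (b \<bullet> w) \<in> G s (inc j v)" by (simp only: smult_commute[OF aR bR wM]) }
        thus "b \<bullet> w \<in> {z \<in> carrier M. \<forall>a\<in>K j. a \<bullet> z \<in> G s (inc j v)}" using bR wM by auto
      qed
      thus ?thesis using a z unfolding G_def by blast
    next
      case False
      \<comment> \<open>Coordinate \<open>j\<close> has reached \<open>s\<close>: the truncated
        degree stays, and the new factor \<open>K j\<close> joins the product in front.\<close>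
      have e1: "(\<lambda>i. min (inc j v i) s) = (\<lambda>i. min (v i) s)" using False by auto
      have e2: "(\<lambda>i. inc j v i - min (inc j v i) s) = inc j (\<lambda>i. v i - min (v i) s)" using False by (auto simp: fun_eq_iff)
      have "G s (inc j v) = pw (inc j (\<lambda>i. v i - min (v i) s)) (F (\<lambda>i. min (v i) s))"
        unfolding G_def e2 e1 ..
      also have "\<dots> = ideal_smult M (K j) (G s v)" unfolding G_def by (rule pw_inc[OF smF j])
      finally show ?thesis using ideal_smult_incl[OF a z] by simp
    qed
  qed
  have mono: "G s \<le> G (Suc s)" for s
  proof (rule le_funI)
    fix v :: "nat \<Rightarrow> nat"
    let ?u = "\<lambda>i. min (v i) (Suc s) - min (v i) s"
    have "G s v = pw (\<lambda>i. (v i - min (v i) (Suc s)) + ?u i) (F (\<lambda>i. min (v i) s))"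
      unfolding G_def by (rule pw_cong) auto
    also have "\<dots> = pw (\<lambda>i. v i - min (v i) (Suc s)) (pw ?u (F (\<lambda>i. min (v i) s)))"
      by (rule pw_pw[OF smF, symmetric])
    also have "\<dots> \<subseteq> pw (\<lambda>i. v i - min (v i) (Suc s)) (F (\<lambda>i. ?u i + min (v i) s))"
      by (rule pw_mono[OF graded_sub_pw[OF F]])
    also have "F (\<lambda>i. ?u i + min (v i) s) = F (\<lambda>i. min (v i) (Suc s))"
      by (rule graded_subD(4)[OF F]) auto
    finally show "G s v \<subseteq> G (Suc s) v" unfolding G_def .
  qed
  obtain D where D: "\<And>s. s \<ge> D \<Longrightarrow> G s = G D"
    using accD[OF acc_graded_sub, of G, OF G mono] by blast
  have "F v = G D v" for v
  proof -
    define s where "s = max D (Max (v ` {..d}))"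
    have s: "v i \<le> s" if "i \<le> d" for i
      using that Max_ge[of "v ` {..d}" "v i"] by (auto simp: s_def intro: le_max_iff_disj[THEN iffD2])
    have "G s v = pw (\<lambda>_. 0) (F v)"
    proof -
      have "F (\<lambda>i. min (v i) s) = F v" by (rule graded_subD(4)[OF F]) (simp add: s min_def)
      thus ?thesis unfolding G_def by (simp only:) (rule pw_cong, simp add: s)
    qed
    thus ?thesis using D[of s] pw_0[OF smF] by (simp add: s_def)
  qed
  thus ?thesis using that unfolding G_def by blast
qed

end

section \<open>Existence of weak-(FC)-elements\<close>

text \<open>For a single operator the last bad iterate works. The operators are added one by one:
  iterating the next one keeps what was achieved, since the operators commute and preserve goodness.
  Applied to multiplications it yields socle elements: elements outside a submodule that all chosen
  ring elements carry into it.\<close>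

lemma commuting_last_bad:
  assumes "finite S" and s: "s \<in> X" "\<not> G s"
    and commute: "\<And>a b s. a \<in> S \<Longrightarrow> b \<in> S \<Longrightarrow> s \<in> X \<Longrightarrow> act a (act b s) = act b (act a s)"
    and closed: "\<And>a s. a \<in> S \<Longrightarrow> s \<in> X \<Longrightarrow> act a s \<in> X"
    and good: "\<And>a s. a \<in> S \<Longrightarrow> s \<in> X \<Longrightarrow> G s \<Longrightarrow> G (act a s)"
    and ev: "\<And>a s. a \<in> S \<Longrightarrow> s \<in> X \<Longrightarrow> \<exists>n::nat. G ((act a ^^ n) s)"
  obtains s' where "s' \<in> X" "\<not> G s'" "\<And>a. a \<in> S \<Longrightarrow> G (act a s')"
proof -
  have "\<exists>s'. s' \<in> X \<and> \<not> G s' \<and> (\<forall>a\<in>S. G (act a s'))"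
    using assms
  proof (induct S rule: finite_induct)
    case empty
    thus ?case by blast
  next
    case (insert a S)
    have "\<exists>s'. s' \<in> X \<and> \<not> G s' \<and> (\<forall>b\<in>S. G (act b s'))"
    proof (rule insert(3)[OF insert(4,5)])
      show "act b (act c s) = act c (act b s)" if "b \<in> S" "c \<in> S" "s \<in> X" for b c s
        by (rule insert(6)) (use that in auto)
      show "act b s \<in> X" if "b \<in> S" "s \<in> X" for b s by (rule insert(7)) (use that in auto)
      show "G (act b s)" if "b \<in> S" "s \<in> X" "G s" for b s by (rule insert(8)) (use that in auto)
      show "\<exists>n. G ((act b ^^ n) s)" if "b \<in> S" "s \<in> X" for b s by (rule insert(9)) (use that in auto)
    qed
    then obtain s' where s': "s' \<in> X" "\<not> G s'" "\<And>b. b \<in> S \<Longrightarrow> G (act b s')" by blast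
    have X: "(act a ^^ n) s \<in> X" if "s \<in> X" for n s
      by (induct n) (use that insert(7) in auto)
    define n where "n = (LEAST n. G ((act a ^^ n) s'))"
    have "\<exists>n. G ((act a ^^ n) s')" by (rule insert(9)[OF insertI1 s'(1)])
    hence n: "G ((act a ^^ n) s')" unfolding n_def by (rule LeastI_ex)
    have "n \<noteq> 0" using n s'(2) by (metis funpow_0)
    then obtain m where m: "n = Suc m" using not0_implies_Suc by blast
    have "\<not> G ((act a ^^ m) s')" using not_less_Least[of m "\<lambda>n. G ((act a ^^ n) s')"] m n_def by simp
    moreover have "G (act b ((act a ^^ m) s'))" if b: "b \<in> S" for b
    proof -
      have "act b ((act a ^^ k) s') = (act a ^^ k) (act b s')" for k
      proof (induct k)
        case (Suc k)
        have "act b ((act a ^^ Suc k) s') = act a (act b ((act a ^^ k) s'))"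
          using insert(6)[OF insertI2[OF b] insertI1 X[OF s'(1)]] by simp
        thus ?case using Suc by simp
      qed simp
      moreover have "G ((act a ^^ k) (act b s'))" for k
      proof (induct k)
        case (Suc k)
        thus ?case using insert(8)[OF insertI1 X[OF insert(7)[OF insertI2[OF b] s'(1)]]] by simp
      qed (simp add: s'(3)[OF b])
      ultimately show ?thesis by simp
    qed
    moreover have "G (act a ((act a ^^ m) s'))" using n m by simp
    ultimately show ?case using X[OF s'(1), of m] by blast
  qed
  thus ?thesis using that by blast
qed

lemma (in module) ideal_prod_smult_mem:
  assumes I: "ideal I R" and J: "ideal J R" and T: "sm T" and z: "z \<in> carrier M" and c: "c \<in> I \<cdot>\<^bsub>R\<^esub> J"
    and IJ: "\<And>a b. a \<in> I \<Longrightarrow> b \<in> J \<Longrightarrow> a \<bullet> (b \<bullet> z) \<in> T"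
  shows "c \<bullet> z \<in> T"
  using c
proof (induct c rule: ideal_prod.induct)
  case (prod i j)
  thus ?case using IJ z ideal.Icarr[OF I] ideal.Icarr[OF J] by (simp add: smult_assoc1)
next
  case (sum s1 s2)
  have "s1 \<in> carrier R" "s2 \<in> carrier R" using sum ideal_prod_in_carrier[OF I J] by auto
  thus ?case using sum z sm_add[OF T] by (simp add: smult_l_distr)
qed

section \<open>Homogeneous elements acting on the Rees module\<close>

context power_family
begin

abbreviation shift :: "nat \<Rightarrow> nat \<Rightarrow> (nat \<Rightarrow> nat) \<Rightarrow> nat \<Rightarrow> nat" where
  "shift i n v \<equiv> v(i := v i + n)"

abbreviation single :: "nat \<Rightarrow> nat \<Rightarrow> nat \<Rightarrow> nat" where
  "single i n \<equiv> (\<lambda>_. 0)(i := n)"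

lemma PP_single_add: "PP (single i (m + n)) = PP (single i m) \<cdot>\<^bsub>R\<^esub> PP (single i n)"
proof -
  have "(\<lambda>k. single i m k + single i n k) = single i (m + n)" by auto
  thus ?thesis using PP_add[of "single i m" "single i n"] by simp
qed

lemma PP_single_smult_mem:
  assumes "sm T" "z \<in> carrier M" "c \<in> PP (single i (m + n))"
    and "\<And>a b. a \<in> PP (single i m) \<Longrightarrow> b \<in> PP (single i n) \<Longrightarrow> a \<bullet> (b \<bullet> z) \<in> T"
  shows "c \<bullet> z \<in> T"
  by (rule ideal_prod_smult_mem[OF PP_ideal PP_ideal assms(1,2)])
    (use assms(3) assms(4) in \<open>simp_all only: PP_single_add\<close>)

lemma PP_single_U:
  assumes E: "graded_sub E" and c: "c \<in> PP (single i n)" and z: "z \<in> E v"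
  shows "c \<bullet> z \<in> E (shift i n v)"
proof -
  have "c \<bullet> z \<in> pw (single i n) (E v)" by (rule ideal_smult_incl[OF c z])
  also have "\<dots> \<subseteq> E (\<lambda>k. single i n k + v k)" by (rule graded_sub_pw[OF E])
  also have "(\<lambda>k. single i n k + v k) = shift i n v" by auto
  finally show ?thesis .
qed

lemma pow_smult:
  assumes E: "graded_sub E" and i: "i \<le> d" and x: "x \<in> K i" and z: "z \<in> E v"
  shows "x [^] (n::nat) \<bullet> z \<in> E (shift i n v)"
proof (induct n)
  case 0
  have "z \<in> carrier M" by (rule sm_mem[OF graded_subD(1)[OF E] z])
  thus ?case using z by simp
next
  case (Suc n)
  have zM: "z \<in> carrier M" by (rule sm_mem[OF graded_subD(1)[OF E] z])
  have xR: "x \<in> carrier R" by (rule K_mem[OF i x])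
  have "x \<bullet> (x [^] n \<bullet> z) \<in> E (inc i (shift i n v))"
    by (rule graded_subD(5)[OF E, OF i x Suc])
  moreover have "inc i (shift i n v) = shift i (Suc n) v" by auto
  moreover have "x [^] Suc n \<bullet> z = x \<bullet> (x [^] n \<bullet> z)"
    using xR zM by (simp add: smult_assoc1[symmetric] R.m_comm)
  ultimately show ?case by (simp only:)
qed

text \<open>The graded colon by a set \<open>C\<close> whose elements are given the degree
  \<open>n e_i\<close>; it is applied to a power of one element of \<open>K i\<close> and to a power
  of \<open>K i\<close>.\<close>

lemma graded_sub_colon:
  assumes E: "graded_sub E" and i: "i \<le> d" and CR: "C \<subseteq> carrier R"
  shows "graded_sub (\<lambda>v. {z \<in> U v. \<forall>c\<in>C. c \<bullet> z \<in> E (shift i n v)})"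
proof (rule graded_subI)
  show "{z \<in> U v. \<forall>c\<in>C. c \<bullet> z \<in> E (shift i n v)} = {z \<in> U w. \<forall>c\<in>C. c \<bullet> z \<in> E (shift i n w)}"
    if vw: "\<And>i. i \<le> d \<Longrightarrow> v i = w i" for v w
  proof -
    have "E (shift i n v) = E (shift i n w)" by (rule graded_subD(4)[OF E]) (simp add: vw i)
    thus ?thesis using U_cong[of v w] vw by simp
  qed
  show "sm {z \<in> U v. \<forall>c\<in>C. c \<bullet> z \<in> E (shift i n v)}" for v
  proof (rule smI)
    fix a x assume a: "a \<in> carrier R" and x: "x \<in> {z \<in> U v. \<forall>c\<in>C. c \<bullet> z \<in> E (shift i n v)}"
    have "c \<bullet> (a \<bullet> x) = a \<bullet> (c \<bullet> x)" if "c \<in> C" for c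
      by (rule smult_commute) (use a x that CR U_carrier in auto)
    thus "a \<bullet> x \<in> {z \<in> U v. \<forall>c\<in>C. c \<bullet> z \<in> E (shift i n v)}"
      using x sm_smult[OF sm_U a] sm_smult[OF graded_subD(1)[OF E] a] by simp
  next
    show "{z \<in> U v. \<forall>c\<in>C. c \<bullet> z \<in> E (shift i n v)} \<subseteq> carrier M" using U_carrier by blast
    show "\<zero>\<^sub>M \<in> {z \<in> U v. \<forall>c\<in>C. c \<bullet> z \<in> E (shift i n v)}"
      using sm_zero[OF sm_U] sm_zero[OF graded_subD(1)[OF E]] CR by (auto simp: subset_iff)
    fix x y assume x: "x \<in> {z \<in> U v. \<forall>c\<in>C. c \<bullet> z \<in> E (shift i n v)}"
      and y: "y \<in> {z \<in> U v. \<forall>c\<in>C. c \<bullet> z \<in> E (shift i n v)}"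
    have "c \<bullet> (x \<oplus>\<^sub>M y) = c \<bullet> x \<oplus>\<^sub>M c \<bullet> y" if "c \<in> C" for c
      by (rule smult_r_distr) (use x y that CR U_carrier in auto)
    thus "x \<oplus>\<^sub>M y \<in> {z \<in> U v. \<forall>c\<in>C. c \<bullet> z \<in> E (shift i n v)}"
      using x y sm_add[OF sm_U] sm_add[OF graded_subD(1)[OF E]] by simp
  qed
  show "a \<bullet> z \<in> {z \<in> U (inc j v). \<forall>c\<in>C. c \<bullet> z \<in> E (shift i n (inc j v))}"
    if j: "j \<le> d" and a: "a \<in> K j" and z: "z \<in> {z \<in> U v. \<forall>c\<in>C. c \<bullet> z \<in> E (shift i n v)}" for v j a z
  proof -
    have e: "inc j (shift i n v) = shift i n (inc j v)" by auto
    have "c \<bullet> (a \<bullet> z) \<in> E (shift i n (inc j v))" if c: "c \<in> C" for c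
    proof -
      have "a \<bullet> (c \<bullet> z) \<in> E (inc j (shift i n v))"
        using z c by (intro graded_subD(5)[OF E, OF j a]) auto
      moreover have "c \<bullet> (a \<bullet> z) = a \<bullet> (c \<bullet> z)"
        by (rule smult_commute) (use c CR K_mem[OF j a] z U_carrier in auto)
      ultimately show ?thesis by (simp only: e)
    qed
    moreover have "a \<bullet> z \<in> U (inc j v)" using z by (intro K_smult_U[OF j a]) simp
    ultimately show ?thesis by blast
  qed
qed auto

text \<open>\<open>E\<close> enlarged by the multiples of \<open>x [^] n\<close>, an element of
  degree \<open>n e_i\<close>. Degrees whose coordinate \<open>i\<close> is below \<open>n\<close>
  contain no such multiples, and truncated subtraction would produce a wrong degree there; hence the
  case distinction.\<close>

lemma graded_sub_plus_elem:
  assumes E: "graded_sub E" and i: "i \<le> d" and x: "x \<in> K i"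
  shows "graded_sub (\<lambda>v. E v \<uplus>
    (if n \<le> v i then elem_smult M (x [^] n) (U (v(i := v i - n))) else {\<zero>\<^sub>M}))"
    (is "graded_sub (\<lambda>v. E v \<uplus> ?X v)")
proof (rule graded_subI)
  have xR: "x \<in> carrier R" by (rule K_mem[OF i x])
  have X: "sm (?X v)" for v
    using sm_elem_smult[OF R.nat_pow_closed[OF xR] sm_U] sm_zero_set by simp
  have XU: "?X v \<subseteq> U v" for v
  proof (cases "n \<le> v i")
    case True
    have "x [^] n \<bullet> z \<in> U v" if "z \<in> U (v(i := v i - n))" for z
    proof -
      have "shift i n (v(i := v i - n)) = v" using True by (simp add: fun_eq_iff)
      thus ?thesis using pow_smult[OF graded_sub_U i x, OF that, of n] by (simp only:)
    qed
    thus ?thesis using True by (auto simp: elem_smult_def)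
  qed (use sm_zero[OF sm_U] in simp)
  show "E v \<uplus> ?X v = E w \<uplus> ?X w" if vw: "\<And>i. i \<le> d \<Longrightarrow> v i = w i" for v w
  proof -
    have "E v = E w" by (rule graded_subD(4)[OF E vw])
    moreover have "U (v(i := v i - n)) = U (w(i := w i - n))" by (rule U_cong) (simp add: vw i)
    ultimately show ?thesis using vw[OF i] by simp
  qed
  show "sm (E v \<uplus> ?X v)" for v by (rule sm_ssum[OF graded_subD(1)[OF E] X])
  show "E v \<uplus> ?X v \<subseteq> U v" for v by (rule ssum_least[OF sm_U graded_subD(2)[OF E] XU])
  show "a \<bullet> z \<in> E (inc j v) \<uplus> ?X (inc j v)"
    if j: "j \<le> d" and a: "a \<in> K j" and z: "z \<in> E v \<uplus> ?X v" for v j a z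
  proof -
    have aR: "a \<in> carrier R" by (rule K_mem[OF j a])
    obtain e w where ew: "e \<in> E v" "w \<in> ?X v" "z = e \<oplus>\<^sub>M w" using z unfolding mem_ssum by blast
    have car: "e \<in> carrier M" "w \<in> carrier M"
      using ew sm_mem[OF graded_subD(1)[OF E]] sm_mem[OF X] by blast+
    have "a \<bullet> w \<in> ?X (inc j v)"
    proof (cases "n \<le> v i")
      case True
      then obtain u where u: "u \<in> U (v(i := v i - n))" "w = x [^] n \<bullet> u"
        using ew by (auto simp: elem_smult_def)
      have e: "inc j (v(i := v i - n)) = (inc j v)(i := inc j v i - n)"
        using True by (simp add: fun_eq_iff Suc_diff_le)
      have "a \<bullet> u \<in> U ((inc j v)(i := inc j v i - n))" using K_smult_U[OF j a u(1)] by (simp only: e)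
      moreover have "a \<bullet> w = x [^] n \<bullet> (a \<bullet> u)"
        unfolding u using u(1) U_carrier aR xR by (intro smult_commute) auto
      moreover have "n \<le> inc j v i" using True by auto
      ultimately show ?thesis by (auto simp: elem_smult_def simp del: fun_upd_apply)
    next
      case False
      hence "a \<bullet> w = \<zero>\<^sub>M" using ew aR by simp
      thus ?thesis using sm_zero[OF X] by (simp only:)
    qed
    moreover have "a \<bullet> e \<in> E (inc j v)" by (rule graded_subD(5)[OF E, OF j a ew(1)])
    moreover have "a \<bullet> z = a \<bullet> e \<oplus>\<^sub>M a \<bullet> w" using ew car aR by (simp add: smult_r_distr)
    ultimately show ?thesis by (simp only: ssumI)
  qed
qed

end

context noetherian_power_family
begin

text \<open>\<open>x\<close> is taken as an element of degree \<open>e_i\<close> of the Rees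
  algebra, acting on the quotient of the Rees module by \<open>E\<close>; the exponent is uniform in
  the degree. In the same sense \<open>inj_on_mod\<close> says that this action is
  injective.\<close>

definition nilp_on :: "nat \<Rightarrow> ((nat \<Rightarrow> nat) \<Rightarrow> 'b set) \<Rightarrow> 'a \<Rightarrow> bool" where
  "nilp_on i E x \<longleftrightarrow> (\<exists>m::nat. \<forall>v. \<forall>z\<in>U v. x [^] m \<bullet> z \<in> E (shift i m v))"

definition inj_on_mod :: "nat \<Rightarrow> ((nat \<Rightarrow> nat) \<Rightarrow> 'b set) \<Rightarrow> 'a \<Rightarrow> bool" where
  "inj_on_mod i E x \<longleftrightarrow> (\<forall>v. \<forall>z\<in>U v. x \<bullet> z \<in> E (inc i v) \<longrightarrow> z \<in> E v)"

text \<open>\<open>commuting_last_bad\<close> for pairs of a degree and an element of that degree,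
  the good pairs being those in \<open>E\<close>.\<close>

lemma nilp_last_bad:
  assumes E: "graded_sub E" and i: "i \<le> d" and S: "finite S" "S \<subseteq> K i"
    and nil: "\<And>x. x \<in> S \<Longrightarrow> nilp_on i E x" and z: "z \<in> U v" "z \<notin> E v"
  obtains v' w where "w \<in> U v'" "w \<notin> E v'" "\<And>x. x \<in> S \<Longrightarrow> x \<bullet> w \<in> E (inc i v')"
proof -
  define X where "X = {(v, z). z \<in> U v}"
  define G where "G s \<longleftrightarrow> snd s \<in> E (fst s)" for s :: "(nat \<Rightarrow> nat) \<times> 'b"
  define act where "act a s = (inc i (fst s), a \<bullet> snd s)" for a and s :: "(nat \<Rightarrow> nat) \<times> 'b"
  have act_Pair: "act a (v, z) = (inc i v, a \<bullet> z)" for a v z by (simp add: act_def)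
  have SR: "x \<in> carrier R" if "x \<in> S" for x using that S K_mem[OF i] by blast
  have pow: "(act x ^^ n) s = (shift i n (fst s), x [^] n \<bullet> snd s)" if x: "x \<in> S" and s: "s \<in> X" for x n s
  proof (induct n)
    case 0
    have "snd s \<in> carrier M" using s sm_mem[OF sm_U] by (auto simp: X_def)
    thus ?case by simp
  next
    case (Suc n)
    have sM: "snd s \<in> carrier M" using s sm_mem[OF sm_U] by (auto simp: X_def)
    have "inc i (shift i n (fst s)) = shift i (Suc n) (fst s)" by auto
    moreover have "x [^] Suc n \<bullet> snd s = x \<bullet> (x [^] n \<bullet> snd s)"
      using SR[OF x] sM by (simp add: smult_assoc1[symmetric] R.m_comm)
    moreover have "(act x ^^ Suc n) s = act x (shift i n (fst s), x [^] n \<bullet> snd s)"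
      by (simp only: funpow.simps comp_apply Suc)
    ultimately show ?case by (simp only: act_Pair)
  qed
  obtain s' where s': "s' \<in> X" "\<not> G s'" "\<And>a. a \<in> S \<Longrightarrow> G (act a s')"
  proof (rule commuting_last_bad[of S "(v, z)" X G act])
    show "finite S" by (rule S)
    show "(v, z) \<in> X" "\<not> G (v, z)" using z by (simp_all add: X_def G_def)
    show "act a (act b s) = act b (act a s)" if "a \<in> S" "b \<in> S" "s \<in> X" for a b s
    proof -
      have "snd s \<in> carrier M" using that sm_mem[OF sm_U] by (auto simp: X_def)
      thus ?thesis using that SR smult_commute by (simp add: act_def)
    qed
    show "act a s \<in> X" if "a \<in> S" "s \<in> X" for a s
      using K_smult_U[OF i subsetD[OF S(2) that(1)], of "snd s" "fst s"] that(2) by (auto simp: X_def act_def)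
    show "G (act a s)" if "a \<in> S" "s \<in> X" "G s" for a s
      using graded_subD(5)[OF E, OF i subsetD[OF S(2) that(1)], of "snd s" "fst s"] that(3) by (auto simp: G_def act_def)
    show "\<exists>n. G ((act a ^^ n) s)" if a: "a \<in> S" and s: "s \<in> X" for a s
    proof -
      obtain m :: nat where m: "\<forall>v. \<forall>z\<in>U v. a [^] m \<bullet> z \<in> E (shift i m v)"
        using nil[OF a] unfolding nilp_on_def by blast
      have "snd s \<in> U (fst s)" using s by (auto simp: X_def)
      hence "G ((act a ^^ m) s)" unfolding pow[OF a s] G_def fst_conv snd_conv using m by blast
      thus ?thesis by blast
    qed
  qed blast
  show ?thesis
    by (rule that[of "snd s'" "fst s'"]) (use s' in \<open>auto simp: X_def G_def act_def\<close>)
qed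

lemma nilp_on_zero: "graded_sub E \<Longrightarrow> i \<le> d \<Longrightarrow> nilp_on i E \<zero>"
proof -
  assume E: "graded_sub E"
  have "\<zero> [^] (1::nat) \<bullet> z \<in> E (shift i 1 v)" if "z \<in> U v" for z v
    using that U_carrier sm_zero[OF graded_subD(1)[OF E]] by (auto simp: subset_iff)
  thus ?thesis unfolding nilp_on_def by blast
qed

text \<open>Closure under sums is the point. A sum \<open>x + y\<close> that is not nilpotent is
  injective by the dichotomy, whereas some homogeneous element outside \<open>E\<close> is carried
  into \<open>E\<close> by both \<open>x\<close> and \<open>y\<close>, hence by the sum.\<close>

lemma nilp_ideal:
  assumes E: "graded_sub E" and i: "i \<le> d" and dich: "\<And>x. x \<in> K i \<Longrightarrow> inj_on_mod i E x \<or> nilp_on i E x"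
  shows "ideal {x \<in> K i. nilp_on i E x} R"
proof (rule R.cring_idealI)
  note KI = K_ideal[OF i]
  show "{x \<in> K i. nilp_on i E x} \<subseteq> carrier R" using K_mem[OF i] by blast
  show "\<zero> \<in> {x \<in> K i. nilp_on i E x}"
    using nilp_on_zero[OF E i] additive_subgroup.zero_closed[OF ideal.axioms(1)[OF KI]] by simp
  show "c \<otimes> x \<in> {x \<in> K i. nilp_on i E x}" if x: "x \<in> {x \<in> K i. nilp_on i E x}" and c: "c \<in> carrier R" for x c
  proof -
    have xR: "x \<in> carrier R" using x K_mem[OF i] by blast
    obtain m where m: "\<And>v z. z \<in> U v \<Longrightarrow> x [^] (m::nat) \<bullet> z \<in> E (shift i m v)"
      using x unfolding nilp_on_def by blast
    have "(c \<otimes> x) [^] m \<bullet> z \<in> E (shift i m v)" if z: "z \<in> U v" for v z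
    proof -
      have "(c \<otimes> x) [^] m \<bullet> z = c [^] m \<bullet> (x [^] m \<bullet> z)"
        using c xR z U_carrier by (simp add: R.nat_pow_distrib smult_assoc1 subset_iff)
      thus ?thesis using sm_smult[OF graded_subD(1)[OF E] R.nat_pow_closed[OF c] m[OF z]] by simp
    qed
    thus ?thesis using x c ideal.I_l_closed[OF KI] unfolding nilp_on_def by blast
  qed
  show "x \<oplus> y \<in> {x \<in> K i. nilp_on i E x}"
    if x: "x \<in> {x \<in> K i. nilp_on i E x}" and y: "y \<in> {x \<in> K i. nilp_on i E x}" for x y
  proof -
    have xy: "x \<oplus> y \<in> K i"
      using x y additive_subgroup.a_closed[OF ideal.axioms(1)[OF KI]] by blast
    have xR: "x \<in> carrier R" "y \<in> carrier R" using x y K_mem[OF i] by blast+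
    have "nilp_on i E (x \<oplus> y)"
    proof (rule ccontr)
      assume nn: "\<not> nilp_on i E (x \<oplus> y)"
      hence inj: "inj_on_mod i E (x \<oplus> y)" using dich xy by blast
      have "\<exists>v z. z \<in> U v \<and> z \<notin> E v"
      proof (rule ccontr)
        assume "\<not> (\<exists>v z. z \<in> U v \<and> z \<notin> E v)"
        hence "(x \<oplus> y) [^] (0::nat) \<bullet> z \<in> E (shift i 0 v)" if "z \<in> U v" for v z
          using that U_carrier by (auto simp: subset_iff)
        thus False using nn unfolding nilp_on_def by blast
      qed
      then obtain v z where z: "z \<in> U v" "z \<notin> E v" by blast
      obtain v' w where w: "w \<in> U v'" "w \<notin> E v'" "\<And>a. a \<in> {x, y} \<Longrightarrow> a \<bullet> w \<in> E (inc i v')"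
      proof (rule nilp_last_bad[OF E i _ _ _ z, of "{x, y}"])
        show "{x, y} \<subseteq> K i" using x y by blast
        show "nilp_on i E a" if "a \<in> {x, y}" for a using x y that by blast
      qed (simp, blast)
      have "(x \<oplus> y) \<bullet> w = x \<bullet> w \<oplus>\<^sub>M y \<bullet> w"
        using xR w(1) U_carrier by (intro smult_l_distr) auto
      hence "(x \<oplus> y) \<bullet> w \<in> E (inc i v')"
        using sm_add[OF graded_subD(1)[OF E] w(3)[of x] w(3)[of y]] by (simp only: insertI1 insertI2)
      thus False using inj w(1,2) unfolding inj_on_mod_def by blast
    qed
    thus ?thesis using xy by blast
  qed
qed

text \<open>The colons of \<open>E\<close> by the powers of \<open>K i\<close> stop growing at some
  exponent \<open>b\<close>. An element outside the last colon would lead to another one that the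
  generators of \<open>K i\<close>, hence all of \<open>K i\<close>, carry into it; this one lies in
  the colon for \<open>b + 1\<close>, which is the same.\<close>

lemma nilp_all:
  assumes E: "graded_sub E" and i: "i \<le> d" and nil: "\<And>x. x \<in> K i \<Longrightarrow> nilp_on i E x"
  obtains b where "\<And>v c z. c \<in> PP (single i b) \<Longrightarrow> z \<in> U v \<Longrightarrow> c \<bullet> z \<in> E (shift i b v)"
proof -
  define C where "C b v = {z \<in> U v. \<forall>c\<in>PP (single i b). c \<bullet> z \<in> E (shift i b v)}" for b v
  have gC: "graded_sub (C b)" for b
    unfolding C_def by (rule graded_sub_colon[OF E i PP_carrier])
  have EC: "E v \<subseteq> C b v" for b v
  proof
    fix z assume z: "z \<in> E v"
    thus "z \<in> C b v" using subsetD[OF graded_subD(2)[OF E] z] PP_single_U[OF E, OF _ z] unfolding C_def by blast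
  qed
  have mono: "C b \<le> C (Suc b)" for b
  proof (intro le_funI subsetI)
    fix v z assume z: "z \<in> C b v"
    have "c \<bullet> z \<in> E (shift i (Suc b) v)" if c: "c \<in> PP (single i (Suc b))" for c
    proof (rule PP_single_smult_mem[of _ _ _ i 1 b])
      show "sm (E (shift i (Suc b) v))" by (rule graded_subD(1)[OF E])
      show "z \<in> carrier M" using z U_carrier unfolding C_def by blast
      show "c \<in> PP (single i (1 + b))" using c by simp
      show "a \<bullet> (a' \<bullet> z) \<in> E (shift i (Suc b) v)"
        if a: "a \<in> PP (single i 1)" "a' \<in> PP (single i b)" for a a'
      proof -
        have "a' \<bullet> z \<in> E (shift i b v)" using z a unfolding C_def by blast
        from PP_single_U[OF E, OF a(1) this]
        have "a \<bullet> (a' \<bullet> z) \<in> E (shift i 1 (shift i b v))" .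
        moreover have "shift i 1 (shift i b v) = shift i (Suc b) v" by auto
        ultimately show ?thesis by (simp only:)
      qed
    qed
    thus "z \<in> C (Suc b) v" using z unfolding C_def by blast
  qed
  obtain b where b0: "\<And>n. n \<ge> b \<Longrightarrow> C n = C b"
    by (rule accD[of graded_sub C, OF acc_graded_sub gC mono]) blast
  have b: "C (Suc b) = C b" by (rule b0) simp
  have "z \<in> C b v" if z: "z \<in> U v" for z v
  proof (rule ccontr)
    assume nz: "z \<notin> C b v"
    obtain S where S: "finite S" "S \<subseteq> K i" "K i = Idl S" using ideal_gens[OF K_ideal[OF i]] by blast
    have nilC: "nilp_on i (C b) x" if "x \<in> S" for x
      using nil[of x] that S(2) EC unfolding nilp_on_def by blast
    obtain v' w where w: "w \<in> U v'" "w \<notin> C b v'" "\<And>x. x \<in> S \<Longrightarrow> x \<bullet> w \<in> C b (inc i v')"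
      using nilp_last_bad[OF gC i S(1,2) nilC z nz] by metis
    have wM: "w \<in> carrier M" using w(1) U_carrier by blast
    have Kw: "x \<bullet> w \<in> C b (inc i v')" if "x \<in> K i" for x
      by (rule colon_genideal[of S, OF _ graded_subD(1)[OF gC] wM w(3)]) (use S K_mem[OF i] that in auto)
    have "c \<bullet> w \<in> E (shift i (Suc b) v')" if c: "c \<in> PP (single i (Suc b))" for c
    proof (rule PP_single_smult_mem[of _ _ _ i b 1])
      show "sm (E (shift i (Suc b) v'))" by (rule graded_subD(1)[OF E])
      show "w \<in> carrier M" by (rule wM)
      show "c \<in> PP (single i (b + 1))" using c by simp
      show "a' \<bullet> (a \<bullet> w) \<in> E (shift i (Suc b) v')"
        if a: "a' \<in> PP (single i b)" "a \<in> PP (single i 1)" for a a'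
      proof -
        have "a \<bullet> w \<in> C b (inc i v')" using Kw a(2) PP_unit[OF i] by blast
        hence "a' \<bullet> (a \<bullet> w) \<in> E (shift i b (inc i v'))" using a(1) unfolding C_def by blast
        moreover have "shift i b (inc i v') = shift i (Suc b) v'" by auto
        ultimately show ?thesis by (simp only:)
      qed
    qed
    hence "w \<in> C (Suc b) v'" using w(1) unfolding C_def by blast
    thus False using w(2) b by simp
  qed
  thus ?thesis using that unfolding C_def by blast
qed

lemma PP_single_le:
  assumes E: "graded_sub E" and z: "z \<in> carrier M" and le: "b \<le> b'"
    and b: "\<And>c. c \<in> PP (single i b) \<Longrightarrow> c \<bullet> z \<in> E (shift i b v)"
    and c: "c \<in> PP (single i b')"
  shows "c \<bullet> z \<in> E (shift i b' v)"
proof (rule PP_single_smult_mem[of _ _ _ i "b' - b" b])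
  show "sm (E (shift i b' v))" by (rule graded_subD(1)[OF E])
  show "z \<in> carrier M" by (rule z)
  show "c \<in> PP (single i (b' - b + b))" using c le by simp
  show "a \<bullet> (a' \<bullet> z) \<in> E (shift i b' v)"
    if a: "a \<in> PP (single i (b' - b))" "a' \<in> PP (single i b)" for a a'
  proof -
    have "a \<bullet> (a' \<bullet> z) \<in> E (shift i (b' - b) (shift i b v))"
      by (rule PP_single_U[OF E, OF a(1) b[OF a(2)]])
    moreover have "shift i (b' - b) (shift i b v) = shift i b' v" using le by auto
    ultimately show ?thesis by (simp only:)
  qed
qed

text \<open>The graded form of avoiding the associated primes that do not contain \<open>K i\<close>, by the argument
  that irreducible submodules are primary.\<close>

theorem generic_colon:
  assumes E: "graded_sub E" and i: "i \<le> d"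
  shows "\<exists>\<W> \<Gamma> b. finite \<W> \<and> (\<forall>W\<in>\<W>. ideal W R \<and> W \<subset> K i) \<and> graded_sub \<Gamma> \<and>
    (\<forall>v. \<forall>c\<in>PP (single i b). \<forall>z\<in>\<Gamma> v. c \<bullet> z \<in> E (shift i b v)) \<and>
    (\<forall>x\<in>K i - \<Union>\<W>. \<forall>v. \<forall>z\<in>U v. x \<bullet> z \<in> E (inc i v) \<longrightarrow> z \<in> \<Gamma> v)"
  using acc_graded_sub E
proof (induct E rule: acc_induct)
  case (step E)
  note E = step(1)
  show ?case
  proof (cases "\<forall>x\<in>K i. inj_on_mod i E x \<or> nilp_on i E x")
    case True
    hence dich: "\<And>x. x \<in> K i \<Longrightarrow> inj_on_mod i E x \<or> nilp_on i E x" by blast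
    show ?thesis
    proof (cases "\<forall>x\<in>K i. nilp_on i E x")
      case True
      \<comment> \<open>A power of \<open>K i\<close> carries everything into \<open>E\<close>: no
        element has to be avoided, and \<open>\<Gamma>\<close> may be the whole Rees module.\<close>
      then obtain b where b: "\<And>v c z. c \<in> PP (single i b) \<Longrightarrow> z \<in> U v \<Longrightarrow> c \<bullet> z \<in> E (shift i b v)"
        using nilp_all[OF E i] by metis
      show ?thesis
        by (rule exI[of _ "{}"], rule exI[of _ U], rule exI[of _ b])
          (intro conjI ballI allI impI, simp, simp, simp, rule graded_sub_U, erule (1) b, assumption)
    next
      case False
      \<comment> \<open>The primary case: the nilpotent elements form one proper subideal, and
        outside it multiplication is injective modulo \<open>E\<close>, so
        \<open>\<Gamma> = E\<close> and \<open>b = 0\<close> do.\<close>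
      define W where "W = {x \<in> K i. nilp_on i E x}"
      have W: "ideal W R" "W \<subset> K i" using nilp_ideal[OF E i dich] False by (auto simp: W_def)
      have b: "c \<bullet> z \<in> E (shift i 0 v)" if "c \<in> PP (single i 0)" "z \<in> E v" for c v z
        by (rule PP_single_U[OF E, OF that])
      have x: "z \<in> E v" if "x \<in> K i - \<Union>{W}" "z \<in> U v" "x \<bullet> z \<in> E (inc i v)" for x v z
        using that dich[of x] unfolding W_def inj_on_mod_def by blast
      show ?thesis
        by (rule exI[of _ "{W}"], rule exI[of _ E], rule exI[of _ 0])
          (intro conjI ballI allI impI, simp, use W in simp, use W in simp, rule E, erule (1) b, erule (2) x)
    qed
  next
    case False
    then obtain x where x: "x \<in> K i" and ninj: "\<not> inj_on_mod i E x" and nnil: "\<not> nilp_on i E x" by blast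
    have xR: "x \<in> carrier R" by (rule K_mem[OF i x])
    \<comment> \<open>\<open>x\<close> is neither injective nor nilpotent modulo \<open>E\<close>.
      So the stable colon by a power of \<open>x\<close>, and the sum of \<open>E\<close> with the
      multiples of that power, are both strictly larger than \<open>E\<close>, and they meet in
      \<open>E\<close>. The induction applies to both.\<close>
    define C where "C m v = {z \<in> U v. \<forall>c\<in>{x [^] m}. c \<bullet> z \<in> E (shift i m v)}" for m :: nat and v
    have gC: "graded_sub (C m)" for m
      unfolding C_def by (rule graded_sub_colon[OF E i]) (use xR in simp)
    have mono: "C m \<le> C (Suc m)" for m
    proof (intro le_funI subsetI)
      fix v z assume z: "z \<in> C m v"
      have "x \<bullet> (x [^] m \<bullet> z) \<in> E (inc i (shift i m v))"
        using z unfolding C_def by (intro graded_subD(5)[OF E, OF i x]) blast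
      moreover have "inc i (shift i m v) = shift i (Suc m) v" by auto
      moreover have "x [^] Suc m \<bullet> z = x \<bullet> (x [^] m \<bullet> z)"
      proof -
        have "z \<in> carrier M" using graded_subD(3)[OF gC] z by blast
        thus ?thesis using xR by (simp add: smult_assoc1[symmetric] R.m_comm)
      qed
      ultimately have "x [^] Suc m \<bullet> z \<in> E (shift i (Suc m) v)" by (simp only:)
      thus "z \<in> C (Suc m) v" using z unfolding C_def by blast
    qed
    obtain m0 where m0: "\<And>n. n \<ge> m0 \<Longrightarrow> C n = C m0"
      by (rule accD[of graded_sub C, OF acc_graded_sub gC mono]) blast
    \<comment> \<open>The successor ensures \<open>m \<ge> 1\<close>, so that the stable colon
      contains the colon by \<open>x\<close> itself, which exceeds \<open>E\<close>.\<close>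
    define m where "m = Suc m0"
    have Cm: "C (m + m) = C m"
      by (rule trans[OF m0 m0[symmetric]]) (simp_all add: m_def)
    define E2 where "E2 v = E v \<uplus>
      (if m \<le> v i then elem_smult M (x [^] m) (U (v(i := v i - m))) else {\<zero>\<^sub>M})" for v
    have gE2: "graded_sub E2" unfolding E2_def by (rule graded_sub_plus_elem[OF E i x])
    have EC: "E v \<subseteq> C n v" for n v
    proof
      fix z assume z: "z \<in> E v"
      thus "z \<in> C n v"
        using subsetD[OF graded_subD(2)[OF E] z] pow_smult[OF E i x, OF z, of n] unfolding C_def by blast
    qed
    have smX: "sm (if m \<le> v i then elem_smult M (x [^] m) (U (v(i := v i - m))) else {\<zero>\<^sub>M})" for v
      using sm_elem_smult[OF R.nat_pow_closed[OF xR] sm_U] sm_zero_set by simp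
    have EE2: "E v \<subseteq> E2 v" for v
      unfolding E2_def by (rule ssum_ub1[OF graded_subD(3)[OF E] smX])
    have EC1: "E < C m"
    proof -
      obtain v z where z: "z \<in> U v" "x \<bullet> z \<in> E (inc i v)" "z \<notin> E v"
        using ninj unfolding inj_on_mod_def by blast
      have "z \<in> C 1 v" using z xR unfolding C_def by simp
      moreover have "C 1 \<le> C m" by (rule lift_Suc_mono_le[of C, OF mono]) (simp add: m_def)
      ultimately have "z \<in> C m v" by (auto simp: le_fun_def)
      thus ?thesis using z(3) EC[of _ m] unfolding less_fun_def le_fun_def by blast
    qed
    have EE: "E < E2"
    proof -
      obtain v z where z: "z \<in> U v" "x [^] m \<bullet> z \<notin> E (shift i m v)"
        using nnil unfolding nilp_on_def by blast
      have "(shift i m v)(i := shift i m v i - m) = v" by auto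
      hence "x [^] m \<bullet> z \<in> (if m \<le> shift i m v i then
          elem_smult M (x [^] m) (U ((shift i m v)(i := shift i m v i - m))) else {\<zero>\<^sub>M})"
        using elem_smult_incl[OF z(1)] by simp
      hence "x [^] m \<bullet> z \<in> E2 (shift i m v)"
        unfolding E2_def using ssum_ub2[OF graded_subD(1)[OF E] sm_carrier[OF smX]] by blast
      thus ?thesis using z(2) EE2 unfolding less_fun_def le_fun_def by blast
    qed
    obtain W1 G1 b1 where
      H1: "finite W1" "\<forall>W\<in>W1. ideal W R \<and> W \<subset> K i" "graded_sub G1"
        "\<forall>v. \<forall>c\<in>PP (single i b1). \<forall>z\<in>G1 v. c \<bullet> z \<in> C m (shift i b1 v)"
        "\<forall>x\<in>K i - \<Union>W1. \<forall>v. \<forall>z\<in>U v. x \<bullet> z \<in> C m (inc i v) \<longrightarrow> z \<in> G1 v"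
      using step(2)[OF gC EC1] by (elim exE conjE) (rule that; assumption)
    obtain W2 G2 b2 where
      H2: "finite W2" "\<forall>W\<in>W2. ideal W R \<and> W \<subset> K i" "graded_sub G2"
        "\<forall>v. \<forall>c\<in>PP (single i b2). \<forall>z\<in>G2 v. c \<bullet> z \<in> E2 (shift i b2 v)"
        "\<forall>x\<in>K i - \<Union>W2. \<forall>v. \<forall>z\<in>U v. x \<bullet> z \<in> E2 (inc i v) \<longrightarrow> z \<in> G2 v"
      using step(2)[OF gE2 EE] by (elim exE conjE) (rule that; assumption)
    \<comment> \<open>A multiple \<open>x [^] m \<bullet> u\<close> in the colon has
      \<open>x [^] (m + m) \<bullet> u\<close> in \<open>E\<close>; stability puts \<open>u\<close>
      into the colon for \<open>m\<close>, hence the multiple into \<open>E\<close>.\<close>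
    have split: "z \<in> E v" if z: "z \<in> C m v" "z \<in> E2 v" for z v
    proof -
      obtain e w where ew: "e \<in> E v" "z = e \<oplus>\<^sub>M w"
        "w \<in> (if m \<le> v i then elem_smult M (x [^] m) (U (v(i := v i - m))) else {\<zero>\<^sub>M})"
        using z(2) unfolding E2_def mem_ssum by blast
      have car: "e \<in> carrier M" "w \<in> carrier M"
        using ew sm_mem[OF graded_subD(1)[OF E]] sm_mem[OF smX] by blast+
      have wC: "w \<in> C m v"
        by (rule sm_add_cancel_left[OF graded_subD(1)[OF gC] subsetD[OF EC ew(1)] car(2)])
          (use z(1) ew(2) in simp)
      have "w \<in> E v"
      proof (cases "m \<le> v i")
        case True
        then obtain u where u: "u \<in> U (v(i := v i - m))" "w = x [^] m \<bullet> u"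
          using ew by (auto simp: elem_smult_def)
        have uM: "u \<in> carrier M" using u U_carrier by blast
        have e: "shift i m v = shift i (m + m) (v(i := v i - m))" using True by auto
        have "x [^] m \<bullet> w \<in> E (shift i m v)" using wC unfolding C_def by blast
        moreover have "x [^] m \<bullet> w = x [^] (m + m) \<bullet> u"
          using uM xR by (simp add: u(2) smult_assoc1[symmetric] R.nat_pow_mult)
        ultimately have "x [^] (m + m) \<bullet> u \<in> E (shift i (m + m) (v(i := v i - m)))" by (simp only: e)
        hence "u \<in> C (m + m) (v(i := v i - m))" using u(1) unfolding C_def by blast
        hence "u \<in> C m (v(i := v i - m))" unfolding Cm .
        hence "w \<in> E (shift i m (v(i := v i - m)))" unfolding C_def u(2) by blast
        moreover have "shift i m (v(i := v i - m)) = v" using True by auto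
        ultimately show ?thesis by (simp only:)
      next
        case False
        thus ?thesis using ew sm_zero[OF graded_subD(1)[OF E]] by simp
      qed
      thus ?thesis using ew sm_add[OF graded_subD(1)[OF E]] by simp
    qed
    define b where "b = max b1 b2"
    have P1: "c \<bullet> z \<in> E (shift i b v)" if c: "c \<in> PP (single i b)" and z: "z \<in> G1 v \<inter> G2 v" for c z v
    proof (rule split)
      have zM: "z \<in> carrier M" using z graded_subD(3)[OF H1(3)] by blast
      show "c \<bullet> z \<in> C m (shift i b v)"
        by (rule PP_single_le[OF gC zM _ _ c, of b1]) (use H1(4) z in \<open>auto simp: b_def\<close>)
      show "c \<bullet> z \<in> E2 (shift i b v)"
        by (rule PP_single_le[OF gE2 zM _ _ c, of b2]) (use H2(4) z in \<open>auto simp: b_def\<close>)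
    qed
    have P2: "z \<in> G1 v \<inter> G2 v" if y: "y \<in> K i - \<Union>(W1 \<union> W2)" and z: "z \<in> U v" "y \<bullet> z \<in> E (inc i v)" for y v z
    proof -
      have "y \<bullet> z \<in> C m (inc i v)" "y \<bullet> z \<in> E2 (inc i v)"
        using EC EE2 z(2) by blast+
      moreover have "y \<in> K i - \<Union>W1" "y \<in> K i - \<Union>W2" using y by blast+
      ultimately show ?thesis using H1(5) H2(5) z(1) by blast
    qed
    show ?thesis
      by (rule exI[of _ "W1 \<union> W2"], rule exI[of _ "\<lambda>v. G1 v \<inter> G2 v"], rule exI[of _ b])
        (intro conjI ballI allI impI, use H1(1) H2(1) in simp, use H1(2) H2(2) in blast,
          use H1(2) H2(2) in blast, rule graded_sub_Int[OF H1(3) H2(3)], erule (1) P1, erule (2) P2)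
  qed
qed

end

section \<open>Statements for all large exponents\<close>

lemma for_all_largeI: "(\<And>v. (\<And>i. i \<le> d \<Longrightarrow> N \<le> v i) \<Longrightarrow> Q v) \<Longrightarrow> for_all_large d Q"
  unfolding for_all_large_def by blast

lemma for_all_largeE:
  assumes "for_all_large d Q"
  obtains N where "\<And>v. (\<And>i. i \<le> d \<Longrightarrow> N \<le> v i) \<Longrightarrow> Q v"
  using assms unfolding for_all_large_def by blast

lemma for_all_large_conj:
  assumes "for_all_large d P" "for_all_large d Q" shows "for_all_large d (\<lambda>v. P v \<and> Q v)"
proof -
  obtain m where m: "\<And>v. (\<And>i. i \<le> d \<Longrightarrow> m \<le> v i) \<Longrightarrow> P v" using for_all_largeE[OF assms(1)] by blast
  obtain n where n: "\<And>v. (\<And>i. i \<le> d \<Longrightarrow> n \<le> v i) \<Longrightarrow> Q v" using for_all_largeE[OF assms(2)] by blast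
  show ?thesis by (rule for_all_largeI[of _ "max m n"]) (auto intro: m n)
qed

lemma for_all_large_mono: "for_all_large d P \<Longrightarrow> (\<And>v. P v \<Longrightarrow> Q v) \<Longrightarrow> for_all_large d Q"
  unfolding for_all_large_def by blast

lemma for_all_large_ge: "for_all_large d (\<lambda>v. \<forall>i\<le>d. N \<le> v i)"
  by (rule for_all_largeI[of _ N]) auto

lemma for_all_large_comp:
  assumes "for_all_large d Q" and f: "\<And>N. for_all_large d (\<lambda>v. \<forall>i\<le>d. N \<le> f v i)"
  shows "for_all_large d (\<lambda>v. Q (f v))"
proof -
  obtain m where m: "\<And>v. (\<And>i. i \<le> d \<Longrightarrow> m \<le> v i) \<Longrightarrow> Q v" using for_all_largeE[OF assms(1)] by blast
  show ?thesis by (rule for_all_large_mono[OF f[of m]]) (rule m, blast)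
qed

lemma for_all_large_lower:
  assumes "for_all_large d Q" shows "for_all_large d (\<lambda>v. Q (lower i v))"
proof (rule for_all_large_comp[OF assms])
  show "for_all_large d (\<lambda>v. \<forall>k\<le>d. N \<le> lower i v k)" for N
  proof (rule for_all_largeI[of _ "Suc N"])
    fix v assume v: "\<And>i. i \<le> d \<Longrightarrow> Suc N \<le> v i"
    show "\<forall>k\<le>d. N \<le> lower i v k" using v by (auto simp: lower_def dest: Suc_leD intro: diff_le_mono[of "Suc N" _ 1, simplified])
  qed
qed

lemma for_all_large_finite:
  assumes "finite S" "\<And>x. x \<in> S \<Longrightarrow> for_all_large d (Q x)"
  shows "for_all_large d (\<lambda>v. \<forall>x\<in>S. Q x v)"
  using assms
proof (induct S rule: finite_induct)
  case empty
  show ?case by (rule for_all_largeI) simp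
next
  case (insert x S)
  have "for_all_large d (\<lambda>v. Q x v \<and> (\<forall>x\<in>S. Q x v))" using insert by (intro for_all_large_conj) auto
  thus ?case by simp
qed

lemma for_all_large_obtain:
  assumes "for_all_large d Q" obtains v where "Q v" "\<And>i. i \<le> d \<Longrightarrow> N \<le> v i"
proof -
  obtain m where m: "\<And>v. (\<And>i. i \<le> d \<Longrightarrow> m \<le> v i) \<Longrightarrow> Q v" using for_all_largeE[OF assms(1)] by blast
  show ?thesis by (rule that[of "\<lambda>_. max m N"]) (auto intro: m)
qed

context power_family
begin

text \<open>The conditions (FC1) and (FC2) with respect to \<open>M/N\<close>, expressed inside \<open>M\<close>.\<close>

definition rel_FC :: "'b set \<Rightarrow> nat \<Rightarrow> 'a \<Rightarrow> bool" where
  "rel_FC N i x \<longleftrightarrow> i \<le> d \<and> x \<in> K i \<and>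
     for_all_large d (\<lambda>v. (elem_smult M x (carrier M) \<uplus> N) \<inter> (U v \<uplus> N) =
                          elem_smult M x (U (lower i v)) \<uplus> N) \<and>
     (\<forall>z\<in>carrier M. x \<bullet> z \<in> N \<longrightarrow> (\<exists>m. \<forall>a\<in>PP (\<lambda>_. m). a \<bullet> z \<in> N))"

lemma graded_sub_trace: "sm N \<Longrightarrow> graded_sub (\<lambda>v. N \<inter> U v)"
  by (rule graded_subI)
    (use U_cong in blast, auto intro: sm_Int sm_U K_smult_U sm_smult K_mem)

text \<open>Modulo this family the Rees module becomes the associated graded module of
  \<open>M/N\<close> in direction \<open>j\<close>, for which superficial elements are to be
  found.\<close>

lemma graded_sub_next:
  assumes N: "sm N" shows "graded_sub (\<lambda>v. (U (inc j v) \<uplus> N) \<inter> U v)"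
proof (rule graded_subI)
  show "(U (inc j v) \<uplus> N) \<inter> U v = (U (inc j w) \<uplus> N) \<inter> U w" if vw: "\<And>i. i \<le> d \<Longrightarrow> v i = w i" for v w
  proof -
    have "U v = U w" by (rule U_cong[OF vw])
    moreover have "U (inc j v) = U (inc j w)"
      by (rule U_cong) (use vw in \<open>auto\<close>)
    ultimately show ?thesis by simp
  qed
  show "sm ((U (inc j v) \<uplus> N) \<inter> U v)" for v by (intro sm_Int sm_ssum sm_U N)
  show "a \<bullet> z \<in> (U (inc j (inc k v)) \<uplus> N) \<inter> U (inc k v)"
    if k: "k \<le> d" and a: "a \<in> K k" and z: "z \<in> (U (inc j v) \<uplus> N) \<inter> U v" for v k a z
  proof -
    have aR: "a \<in> carrier R" by (rule K_mem[OF k a])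
    obtain y n where y: "y \<in> U (inc j v)" "n \<in> N" "z = y \<oplus>\<^sub>M n" using z unfolding Int_iff mem_ssum by blast
    have "inc k (inc j v) = inc j (inc k v)" by auto
    hence "a \<bullet> y \<in> U (inc j (inc k v))" using K_smult_U[OF k a y(1)] by (simp only:)
    moreover have "a \<bullet> n \<in> N" by (rule sm_smult[OF N aR y(2)])
    moreover have "a \<bullet> z = a \<bullet> y \<oplus>\<^sub>M a \<bullet> n"
      using y aR sm_mem[OF sm_U y(1)] sm_mem[OF N y(2)] by (simp add: smult_r_distr)
    moreover have "a \<bullet> z \<in> U (inc k v)" using z by (intro K_smult_U[OF k a]) blast
    ultimately show ?thesis by (simp only: Int_iff ssumI)
  qed
qed auto

end

context noetherian_power_family
begin

text \<open>\<open>G\<close> is generated in degrees at most \<open>D\<close>, so beyond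
  \<open>D + b\<close> the \<open>b\<close>-th power of \<open>K i\<close> can be split off from the
  generating products, and it carries \<open>G\<close> into \<open>E\<close>.\<close>

lemma graded_sub_high:
  assumes E: "graded_sub E" and G: "graded_sub G" and i: "i \<le> d"
    and b: "\<And>v c z. c \<in> PP (single i b) \<Longrightarrow> z \<in> G v \<Longrightarrow> c \<bullet> z \<in> E (shift i b v)"
  shows "for_all_large d (\<lambda>v. G v \<subseteq> E v)"
proof -
  obtain D where D: "\<And>v. G v = pw (\<lambda>i. v i - min (v i) D) (G (\<lambda>i. min (v i) D))"
    using graded_sub_bounded_gen[OF G] by blast
  show ?thesis
  proof (rule for_all_largeI[of _ "D + b"])
    fix v :: "nat \<Rightarrow> nat" assume v: "\<And>k. k \<le> d \<Longrightarrow> D + b \<le> v k"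
    let ?w = "\<lambda>k. min (v k) D" and ?r = "\<lambda>k. v k - min (v k) D - single i b k"
    have "G v = pw (\<lambda>k. ?r k + single i b k) (G ?w)"
      unfolding D[of v] by (rule pw_cong) (use v[OF i] in auto)
    also have "\<dots> = pw ?r (pw (single i b) (G ?w))" by (rule pw_pw[OF graded_subD(1)[OF G], symmetric])
    also have "\<dots> \<subseteq> pw ?r (E (shift i b ?w))"
      by (rule pw_mono, rule ideal_smult_least[OF graded_subD(1)[OF E] b])
    also have "\<dots> \<subseteq> E (\<lambda>k. ?r k + shift i b ?w k)" by (rule graded_sub_pw[OF E])
    also have "\<dots> = E v" by (rule graded_subD(4)[OF E]) (use v[OF i] in auto)
    finally show "G v \<subseteq> E v" .
  qed
qed

text \<open>The Artin-Rees lemma as bounded generation of the graded trace of \<open>X\<close>;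
  \<open>v k - min (v k) D\<close> is \<open>v k - D\<close>, replaced by zero if negative.\<close>

lemma artin_rees:
  assumes X: "sm X"
  obtains D where "\<And>v. X \<inter> U v \<subseteq> pw (\<lambda>k. v k - min (v k) D) X"
proof -
  obtain D where D: "\<And>v. X \<inter> U v = pw (\<lambda>i. v i - min (v i) D) (X \<inter> U (\<lambda>i. min (v i) D))"
    using graded_sub_bounded_gen[OF graded_sub_trace[OF X]] by blast
  show ?thesis by (rule that[of D], subst D, rule pw_mono) blast
qed

text \<open>The degree \<open>u\<close> is raised one coordinate at a time up to
  \<open>v - e_i\<close>. As long as it is smaller in some coordinate \<open>j\<close>, the degree
  \<open>u + e_i + e_j\<close> is still at most \<open>v\<close>, and \<open>step\<close> replaces
  \<open>z\<close> by an element of degree \<open>u + e_j\<close>, modulo \<open>N\<close>.\<close>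

lemma superficial_climb:
  assumes N: "sm N" and i: "i \<le> d" and xR: "x \<in> carrier R" and vi: "0 < v i"
    and step: "\<And>u j z. j \<le> d \<Longrightarrow> (\<And>k. k \<le> d \<Longrightarrow> B \<le> u k) \<Longrightarrow> z \<in> U u \<Longrightarrow>
        x \<bullet> z \<in> U (inc j (inc i u)) \<uplus> N \<Longrightarrow> z \<in> U (inc j u) \<uplus> N"
    and u: "\<And>k. k \<le> d \<Longrightarrow> B \<le> u k \<and> u k \<le> lower i v k" and z: "z \<in> U u" "x \<bullet> z \<in> U v \<uplus> N"
  shows "x \<bullet> z \<in> elem_smult M x (U (lower i v)) \<uplus> N"
  using u z
proof (induct "\<Sum>k\<le>d. lower i v k - u k" arbitrary: u z rule: less_induct)
  case less
  have smR: "sm (elem_smult M x (U (lower i v)) \<uplus> N)"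
    by (intro sm_ssum sm_elem_smult xR sm_U N)
  have NR: "N \<subseteq> elem_smult M x (U (lower i v)) \<uplus> N"
    by (rule ssum_ub2[OF sm_elem_smult[OF xR sm_U] sm_carrier[OF N]])
  show ?case
  proof (cases "\<forall>k\<le>d. u k = lower i v k")
    case True
    hence "U u = U (lower i v)" by (intro U_cong) auto
    hence "x \<bullet> z \<in> elem_smult M x (U (lower i v))" using less(3) elem_smult_incl by blast
    thus ?thesis using ssum_ub1[OF sm_carrier[OF sm_elem_smult[OF xR sm_U]] N] by blast
  next
    case False
    then obtain j where j: "j \<le> d" "u j < lower i v j" using less(2) by (metis order_le_less)
    have le: "inc j (inc i u) k \<le> v k" if k: "k \<le> d" for k
      using less(2)[OF k] less(2)[OF i] j vi by (auto simp: lower_def split: if_splits)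
    have "U v \<uplus> N \<subseteq> U (inc j (inc i u)) \<uplus> N"
      by (rule ssum_mono[OF U_antimono[OF le] order_refl])
    hence "x \<bullet> z \<in> U (inc j (inc i u)) \<uplus> N" using less(4) by blast
    moreover have "B \<le> u k" if "k \<le> d" for k using less(2)[OF that] by blast
    ultimately have "z \<in> U (inc j u) \<uplus> N" using step[OF j(1) _ less(3)] by blast
    then obtain z' n where z': "z' \<in> U (inc j u)" "n \<in> N" "z = z' \<oplus>\<^sub>M n" unfolding mem_ssum by blast
    have car: "z' \<in> carrier M" "n \<in> carrier M" using z' sm_mem[OF sm_U] sm_mem[OF N] by blast+
    have xz: "x \<bullet> z = x \<bullet> z' \<oplus>\<^sub>M x \<bullet> n" using z' car xR by (simp add: smult_r_distr)
    have xn: "x \<bullet> n \<in> N" by (rule sm_smult[OF N xR z'(2)])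
    have "x \<bullet> z' \<in> elem_smult M x (U (lower i v)) \<uplus> N"
    proof (rule less(1)[of "inc j u"])
      show "(\<Sum>k\<le>d. lower i v k - inc j u k) < (\<Sum>k\<le>d. lower i v k - u k)"
        by (rule sum_strict_mono_ex1) (use j in auto)
      show "B \<le> inc j u k \<and> inc j u k \<le> lower i v k" if "k \<le> d" for k
        using less(2)[OF that] j by auto
      show "z' \<in> U (inc j u)" by (rule z')
      show "x \<bullet> z' \<in> U v \<uplus> N"
        by (rule sm_add_cancel_right[OF sm_ssum[OF sm_U N], of "x \<bullet> n"])
          (use xn ssum_ub2[OF sm_U[of v] sm_carrier[OF N]] less(4) xz xR car in auto)
    qed
    thus ?thesis using sm_add[OF smR] xn NR xz by auto
  qed
qed

text \<open>The ideals to avoid come from \<open>generic_colon\<close>, applied to the associated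
  graded modules in all directions \<open>j\<close> and to the trace of \<open>N\<close>. For (FC1),
  Artin-Rees provides a preimage of slightly too low degree, which \<open>superficial_climb\<close>
  lifts; (FC2) comes from the trace of \<open>N\<close> in degree zero.\<close>

theorem generic_rel_FC:
  assumes N: "sm N" and i: "i \<le> d"
  obtains \<W> where "finite \<W>" "\<And>W. W \<in> \<W> \<Longrightarrow> ideal W R \<and> W \<subset> K i"
    "\<And>x. x \<in> K i - \<Union>\<W> \<Longrightarrow> rel_FC N i x"
proof -
  define E where "E j v = (U (inc j v) \<uplus> N) \<inter> U v" for j v
  have gE: "graded_sub (E j)" for j unfolding E_def by (rule graded_sub_next[OF N])
  define P where "P j \<W> \<Gamma> b \<longleftrightarrow> finite \<W> \<and> (\<forall>W\<in>\<W>. ideal W R \<and> W \<subset> K i) \<and> graded_sub \<Gamma> \<and>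
    (\<forall>v. \<forall>c\<in>PP (single i b). \<forall>z\<in>\<Gamma> v. c \<bullet> z \<in> E j (shift i b v)) \<and>
    (\<forall>x\<in>K i - \<Union>\<W>. \<forall>v. \<forall>z\<in>U v. x \<bullet> z \<in> E j (inc i v) \<longrightarrow> z \<in> \<Gamma> v)" for j \<W> \<Gamma> b
  have "\<exists>\<W> \<Gamma> b. P j \<W> \<Gamma> b" for j
    unfolding P_def by (rule generic_colon[OF gE i])
  then obtain WW GG bb where "\<And>j. P j (WW j) (GG j) (bb j)" by metis
  note H = this[unfolded P_def]
  have H2: "ideal W R \<and> W \<subset> K i" if "W \<in> WW j" for W j using H[of j] that by blast
  obtain WZ GZ bZ where
    HZ: "finite WZ" "\<forall>W\<in>WZ. ideal W R \<and> W \<subset> K i" "graded_sub GZ"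
    "\<forall>v. \<forall>c\<in>PP (single i bZ). \<forall>z\<in>GZ v. c \<bullet> z \<in> N \<inter> U (shift i bZ v)"
    "\<forall>x\<in>K i - \<Union>WZ. \<forall>v. \<forall>z\<in>U v. x \<bullet> z \<in> N \<inter> U (inc i v) \<longrightarrow> z \<in> GZ v"
    using generic_colon[OF graded_sub_trace[OF N] i] by (elim exE conjE) (rule that; assumption)
  have "for_all_large d (\<lambda>v. \<forall>j\<in>{..d}. GG j v \<subseteq> E j v)"
  proof (rule for_all_large_finite)
    show "for_all_large d (\<lambda>v. GG j v \<subseteq> E j v)" for j
      by (rule graded_sub_high[OF gE _ i, of _ "bb j"]) (use H[of j] in blast)+
  qed simp
  then obtain B where B: "\<And>v. \<forall>k\<le>d. B \<le> v k \<Longrightarrow> \<forall>j\<in>{..d}. GG j v \<subseteq> E j v"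
    unfolding for_all_large_def by blast
  define \<W> where "\<W> = WZ \<union> (\<Union>j\<in>{..d}. WW j)"
  show ?thesis
  proof (rule that[of \<W>])
    show "finite \<W>" using HZ(1) H by (simp add: \<W>_def)
    show "ideal W R \<and> W \<subset> K i" if "W \<in> \<W>" for W using that HZ(2) H2 unfolding \<W>_def by blast
    fix x assume x: "x \<in> K i - \<Union>\<W>"
    have xK: "x \<in> K i" using x by blast
    have xR: "x \<in> carrier R" by (rule K_mem[OF i xK])
    have step: "z \<in> U (inc j u) \<uplus> N"
      if j: "j \<le> d" and u: "\<And>k. k \<le> d \<Longrightarrow> B \<le> u k" and z: "z \<in> U u"
        and xz: "x \<bullet> z \<in> U (inc j (inc i u)) \<uplus> N" for u j z
    proof -
      have "x \<bullet> z \<in> E j (inc i u)" using xz K_smult_U[OF i xK z] unfolding E_def by blast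
      moreover have "x \<in> K i - \<Union>(WW j)" using x j unfolding \<W>_def by blast
      ultimately have "z \<in> GG j u" using H[of j] z by blast
      moreover have "\<forall>k\<le>d. B \<le> u k" using u by blast
      ultimately have "z \<in> E j u" using B[of u] j by blast
      thus ?thesis unfolding E_def by blast
    qed
    let ?X = "elem_smult M x (carrier M) \<uplus> N"
    have smx: "sm (elem_smult M x (U v))" for v by (rule sm_elem_smult[OF xR sm_U])
    have smxM: "sm (elem_smult M x (carrier M))" by (rule sm_elem_smult[OF xR sm_carrier_whole])
    have X: "sm ?X" by (rule sm_ssum[OF smxM N])
    obtain D where D: "\<And>v. ?X \<inter> U v \<subseteq> pw (\<lambda>k. v k - min (v k) D) ?X" using artin_rees[OF X] by blast
    have FC1: "for_all_large d (\<lambda>v. ?X \<inter> (U v \<uplus> N) = elem_smult M x (U (lower i v)) \<uplus> N)"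
    \<comment> \<open>\<open>D\<close> is lost to Artin-Rees, one more unit because the climb has to
      start below \<open>v - e_i\<close>, and \<open>B\<close> keeps the start in the range where
      superficiality holds.\<close>
    proof (rule for_all_largeI[of _ "B + Suc D"])
      fix v :: "nat \<Rightarrow> nat" assume v: "\<And>k. k \<le> d \<Longrightarrow> B + Suc D \<le> v k"
      have vi: "0 < v i" using v[OF i] by simp
      let ?Y = "elem_smult M x (U (lower i v)) \<uplus> N"
      have smY: "sm ?Y" by (rule sm_ssum[OF smx N])
      have NY: "N \<subseteq> ?Y" by (rule ssum_ub2[OF smx sm_carrier[OF N]])
      show "?X \<inter> (U v \<uplus> N) = ?Y"
      proof
        show "?X \<inter> (U v \<uplus> N) \<subseteq> ?Y"
        proof
          fix z assume z: "z \<in> ?X \<inter> (U v \<uplus> N)"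
          then obtain y n where y: "y \<in> U v" "n \<in> N" "z = y \<oplus>\<^sub>M n" unfolding Int_iff mem_ssum by blast
          have car: "y \<in> carrier M" "n \<in> carrier M" using y sm_mem[OF sm_U] sm_mem[OF N] by blast+
          have "n \<in> ?X" using y ssum_ub2[OF smxM sm_carrier[OF N]] by blast
          hence yX: "y \<in> ?X" using sm_add_cancel_right[OF X] car y z by blast
          have "y \<in> pw (\<lambda>k. v k - min (v k) D) ?X" using D yX y(1) by blast
          also have "\<dots> = pw (\<lambda>k. v k - min (v k) D) (elem_smult M x (carrier M)) \<uplus> pw (\<lambda>k. v k - min (v k) D) N"
            by (rule pw_ssum[OF smxM N])
          also have "\<dots> \<subseteq> elem_smult M x (U (\<lambda>k. v k - min (v k) D)) \<uplus> N"
            by (rule ssum_mono[OF _ pw_le[OF N]]) (simp add: pw_elem[OF xR sm_carrier_whole] U_pw)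
          finally obtain z0 n0 where z0: "z0 \<in> U (\<lambda>k. v k - min (v k) D)" "n0 \<in> N" "y = x \<bullet> z0 \<oplus>\<^sub>M n0"
            unfolding mem_ssum elem_smult_def by blast
          have car0: "z0 \<in> carrier M" "n0 \<in> carrier M" using z0 sm_mem[OF sm_U] sm_mem[OF N] by blast+
          have "x \<bullet> z0 \<in> ?Y"
          proof (rule superficial_climb[OF N i xR, where u = "\<lambda>k. v k - Suc D" and B = B and v = v])
            show "0 < v i" by (rule vi)
            show "w \<in> U (inc j u) \<uplus> N" if "j \<le> d" "\<And>k. k \<le> d \<Longrightarrow> B \<le> u k" "w \<in> U u"
              "x \<bullet> w \<in> U (inc j (inc i u)) \<uplus> N" for u j w
              using that by (rule step)
            show "B \<le> v k - Suc D \<and> v k - Suc D \<le> lower i v k" if "k \<le> d" for k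
              using v[OF that] by (auto simp: lower_def)
            have "U (\<lambda>k. v k - min (v k) D) \<subseteq> U (\<lambda>k. v k - Suc D)" by (rule U_antimono) auto
            thus "z0 \<in> U (\<lambda>k. v k - Suc D)" using z0 by blast
            show "x \<bullet> z0 \<in> U v \<uplus> N"
            proof (rule sm_add_cancel_right[OF sm_ssum[OF sm_U N], of n0])
              show "n0 \<in> U v \<uplus> N" using z0(2) ssum_ub2[OF sm_U sm_carrier[OF N]] by blast
              show "x \<bullet> z0 \<oplus>\<^sub>M n0 \<in> U v \<uplus> N"
                using y(1) z0(3) ssum_ub1[OF U_carrier N] by blast
            qed (use xR car0 in simp)
          qed
          hence "y \<in> ?Y" using sm_add[OF smY _ subsetD[OF NY z0(2)]] z0(3) by blast
          thus "z \<in> ?Y" using sm_add[OF smY _ subsetD[OF NY y(2)]] y(3) by blast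
        qed
        have e: "inc i (lower i v) = v" using vi by (simp add: lower_def)
        have "elem_smult M x (U (lower i v)) \<subseteq> U v"
        proof
          fix w assume "w \<in> elem_smult M x (U (lower i v))"
          then obtain z where "z \<in> U (lower i v)" "w = x \<bullet> z" unfolding elem_smult_def by blast
          thus "w \<in> U v" using K_smult_U[OF i xK, of z "lower i v"] by (simp only: e)
        qed
        thus "?Y \<subseteq> ?X \<inter> (U v \<uplus> N)"
          using ssum_mono[OF elem_smult_mono[OF U_carrier] order_refl] ssum_mono[OF _ order_refl] by blast
      qed
    qed
    have FC2: "\<exists>m. \<forall>a\<in>PP (\<lambda>_. m). a \<bullet> z \<in> N" if z: "z \<in> carrier M" and xz: "x \<bullet> z \<in> N" for z
    proof (intro exI ballI)
      fix a assume a: "a \<in> PP (\<lambda>_. bZ)"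
      have z0: "z \<in> U (\<lambda>_. 0)" using z U_0 by simp
      have "x \<bullet> z \<in> N \<inter> U (inc i (\<lambda>_. 0))" using xz K_smult_U[OF i xK z0] by blast
      moreover have "x \<in> K i - \<Union>WZ" using x unfolding \<W>_def by blast
      ultimately have zG: "z \<in> GZ (\<lambda>_. 0)" using HZ(5) z0 by blast
      have "PP (\<lambda>_. bZ) = PP (\<lambda>k. (bZ - single i bZ k) + single i bZ k)" by (rule PP_cong) auto
      also have "\<dots> = PP (\<lambda>k. bZ - single i bZ k) \<cdot>\<^bsub>R\<^esub> PP (single i bZ)" by (rule PP_add)
      finally have a': "a \<in> PP (\<lambda>k. bZ - single i bZ k) \<cdot>\<^bsub>R\<^esub> PP (single i bZ)" using a by simp
      show "a \<bullet> z \<in> N"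
      proof (rule ideal_prod_smult_mem[OF PP_ideal PP_ideal N z a'])
        fix r s assume r: "r \<in> PP (\<lambda>k. bZ - single i bZ k)" and s: "s \<in> PP (single i bZ)"
        have "s \<bullet> z \<in> N" using HZ(4) zG s by blast
        thus "r \<bullet> (s \<bullet> z) \<in> N" using r PP_carrier sm_smult[OF N] by blast
      qed
    qed
    show "rel_FC N i x" unfolding rel_FC_def using i xK FC1 FC2 by blast
  qed
qed

end

section \<open>Length and the Nakayama lemma\<close>

context module
begin

text \<open>A chain of \<open>n\<close> strict steps that ends in \<open>X\<close>. Its lowest term
  contains \<open>Y\<close> but may be larger, so that chains can be extended at the top and reused
  for a smaller \<open>Y\<close>.\<close>

primrec chn :: "nat \<Rightarrow> 'c set \<Rightarrow> 'c set \<Rightarrow> bool" where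
  "chn 0 Y X \<longleftrightarrow> sm X \<and> Y \<subseteq> X"
| "chn (Suc n) Y X \<longleftrightarrow> sm X \<and> (\<exists>X'. chn n Y X' \<and> X' \<subset> X)"

text \<open>\<open>has_length Y X l\<close> says that the module \<open>X/Y\<close> has finite length \<open>l\<close>.\<close>

definition has_length :: "'c set \<Rightarrow> 'c set \<Rightarrow> nat \<Rightarrow> bool" where
  "has_length Y X l \<longleftrightarrow> chn l Y X \<and> (\<forall>n. chn n Y X \<longrightarrow> n \<le> l)"

lemma chn_sm: "chn n Y X \<Longrightarrow> sm X"
  by (cases n) auto

lemma chn_subset: "chn n Y X \<Longrightarrow> Y \<subseteq> X"
  by (induct n arbitrary: X) auto

lemma chn_top_mono: "chn n Y X \<Longrightarrow> X \<subseteq> X' \<Longrightarrow> sm X' \<Longrightarrow> chn n Y X'"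
proof (cases n)
  case (Suc m)
  assume "chn n Y X" "X \<subseteq> X'" "sm X'"
  then obtain X'' where "chn m Y X''" "X'' \<subset> X'" using Suc by auto
  thus ?thesis using Suc \<open>sm X'\<close> by auto
qed auto

lemma chn_bot_mono: "chn n Y X \<Longrightarrow> Y' \<subseteq> Y \<Longrightarrow> chn n Y' X"
  by (induct n arbitrary: X) auto

lemma chn_add: "chn a Z Y \<Longrightarrow> chn b Y X \<Longrightarrow> chn (a + b) Z X"
proof (induct b arbitrary: X)
  case 0
  thus ?case using chn_top_mono by simp
qed auto

text \<open>In a strict step the trace on \<open>Y\<close> or the sum with \<open>Y\<close> must
  change, for by the modular law both together determine nested submodules. Each step is counted in
  one of the two chains.\<close>

lemma chn_split:
  assumes Y: "sm Y" and ZY: "Z \<subseteq> Y" and n: "chn n Z X"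
  shows "\<exists>a b. n \<le> a + b \<and> chn a Z (X \<inter> Y) \<and> chn b Y (X \<uplus> Y)"
  using n
proof (induct n arbitrary: X)
  case 0
  hence X: "sm X" "Z \<subseteq> X" by simp_all
  have "chn 0 Z (X \<inter> Y)" using X ZY sm_Int[OF X(1) Y] by simp
  moreover have "chn 0 Y (X \<uplus> Y)"
    using sm_ssum[OF X(1) Y] ssum_ub2[OF X(1) sm_carrier[OF Y]] by simp
  ultimately show ?case by (intro exI[of _ 0]) simp
next
  case (Suc n)
  then obtain X' where X: "sm X" and X': "chn n Z X'" "X' \<subset> X" by auto
  have smX': "sm X'" by (rule chn_sm[OF X'(1)])
  obtain a b where ab: "n \<le> a + b" "chn a Z (X' \<inter> Y)" "chn b Y (X' \<uplus> Y)" using Suc(1)[OF X'(1)] by blast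
  have le: "X' \<uplus> Y \<subseteq> X \<uplus> Y" by (rule ssum_mono) (use X'(2) in auto)
  have sXY: "sm (X \<uplus> Y)" "sm (X \<inter> Y)" using sm_ssum[OF X Y] sm_Int[OF X Y] by auto
  show ?case
  proof (cases "X' \<inter> Y = X \<inter> Y")
    case False
    hence "X' \<inter> Y \<subset> X \<inter> Y" using X'(2) by blast
    hence "chn (Suc a) Z (X \<inter> Y)" using ab(2) sXY by auto
    moreover have "chn b Y (X \<uplus> Y)" by (rule chn_top_mono[OF ab(3) le sXY(1)])
    ultimately show ?thesis using ab(1) by (intro exI[of _ "Suc a"] exI[of _ b]) simp
  next
    case True
    have "X' \<uplus> Y \<noteq> X \<uplus> Y"
    proof
      assume e: "X' \<uplus> Y = X \<uplus> Y"
      have "X = X \<inter> (X' \<uplus> Y)" unfolding e using ssum_ub1[OF sm_carrier[OF X] Y] by blast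
      also have "\<dots> = X' \<uplus> (X \<inter> Y)"
        using sm_modular[OF X Y _ sm_carrier[OF smX']] X'(2) by blast
      also have "\<dots> \<subseteq> X'" using True by (intro ssum_least[OF smX']) auto
      finally show False using X'(2) by blast
    qed
    hence "chn (Suc b) Y (X \<uplus> Y)" using ab(3) le sXY by auto
    moreover have "chn a Z (X \<inter> Y)" using ab(2) True by simp
    ultimately show ?thesis using ab(1) by (intro exI[of _ a] exI[of _ "Suc b"]) simp
  qed
qed

lemma has_length_unique: "has_length Y X l \<Longrightarrow> has_length Y X l' \<Longrightarrow> l = l'"
  unfolding has_length_def by (meson le_antisym)

lemma has_length_sm: "has_length Y X l \<Longrightarrow> sm X \<and> Y \<subseteq> X"
  unfolding has_length_def using chn_sm chn_subset by blast

lemma has_length_exI: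
  assumes "sm X" "Y \<subseteq> X" "\<And>n. chn n Y X \<Longrightarrow> n \<le> b" obtains l where "has_length Y X l"
proof -
  have "chn 0 Y X" using assms by simp
  hence "chn (GREATEST n. chn n Y X) Y X" using assms(3) by (rule GreatestI_nat) blast
  moreover have "n \<le> (GREATEST n. chn n Y X)" if "chn n Y X" for n
    using that assms(3) by (rule Greatest_le_nat) blast
  ultimately show ?thesis using that unfolding has_length_def by blast
qed

lemma has_length_add:
  assumes Y: "sm Y" and a: "has_length Z Y a" and b: "has_length Y X b"
  shows "has_length Z X (a + b)"
  unfolding has_length_def
proof (intro conjI allI impI)
  have X: "sm X" "Y \<subseteq> X" "Z \<subseteq> Y" using has_length_sm[OF a] has_length_sm[OF b] by auto
  show "chn (a + b) Z X" using a b chn_add unfolding has_length_def by blast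
  fix n assume "chn n Z X"
  then obtain p q where pq: "n \<le> p + q" "chn p Z (X \<inter> Y)" "chn q Y (X \<uplus> Y)" using chn_split[OF Y X(3)] by blast
  moreover have "X \<inter> Y = Y" "X \<uplus> Y = X" using X ssum_absorb1[OF X(1) Y X(2)] by auto
  ultimately have "p \<le> a" "q \<le> b" using a b unfolding has_length_def by auto
  thus "n \<le> a + b" using pq by simp
qed

lemma has_length_split:
  assumes c: "has_length Z X c" and Y: "sm Y" "Z \<subseteq> Y" "Y \<subseteq> X"
  obtains a b where "has_length Z Y a" "has_length Y X b" "c = a + b"
proof -
  have X: "sm X" using has_length_sm[OF c] by blast
  have "n \<le> c" if "chn n Z Y" for n
    using chn_top_mono[OF that Y(3) X] c unfolding has_length_def by blast
  then obtain a where a: "has_length Z Y a" by (rule has_length_exI[OF Y(1,2)])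
  have "n \<le> c" if "chn n Y X" for n
    using chn_bot_mono[OF that Y(2)] c unfolding has_length_def by blast
  then obtain b where b: "has_length Y X b" by (rule has_length_exI[OF X Y(3)])
  show ?thesis by (rule that[OF a b has_length_unique[OF c has_length_add[OF Y(1) a b]]])
qed

lemma has_length_0_iff: "sm Y \<Longrightarrow> sm X \<Longrightarrow> Y \<subseteq> X \<Longrightarrow> has_length Y X 0 \<longleftrightarrow> X = Y"
proof
  assume Y: "sm Y" and X: "sm X" "Y \<subseteq> X"
  show "X = Y" if "has_length Y X 0"
  proof (rule ccontr)
    assume "X \<noteq> Y"
    hence "chn 1 Y X" using X Y by auto
    thus False using that unfolding has_length_def by fastforce
  qed
  assume e: "X = Y"
  have "n \<le> 0" if "chn n Y X" for n
    using that e by (cases n) (auto dest: chn_subset)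
  thus "has_length Y X 0" unfolding has_length_def using X by auto
qed

lemma chn_map:
  assumes f: "\<And>S. sm S \<Longrightarrow> Y \<subseteq> S \<Longrightarrow> S \<subseteq> X \<Longrightarrow> sm (f S) \<and> Y' \<subseteq> f S"
    and mono: "\<And>S S'. sm S \<Longrightarrow> sm S' \<Longrightarrow> Y \<subseteq> S \<Longrightarrow> S \<subset> S' \<Longrightarrow> S' \<subseteq> X \<Longrightarrow> f S \<subset> f S'"
  shows "chn n Y S \<Longrightarrow> S \<subseteq> X \<Longrightarrow> chn n Y' (f S)"
proof (induct n arbitrary: S)
  case 0
  thus ?case using f by simp
next
  case (Suc n)
  then obtain S' where S': "sm S" "chn n Y S'" "S' \<subset> S" by auto
  have "chn n Y' (f S')" using Suc S' by blast
  moreover have "f S' \<subset> f S" using mono[of S' S] S' Suc(3) chn_sm[OF S'(2)] chn_subset[OF S'(2)] by blast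
  moreover have "sm (f S)" using f[of S] S' Suc(3) chn_subset[OF Suc(2)] by blast
  ultimately show ?case by auto
qed

text \<open>Strictly monotone maps in both directions between the submodules from \<open>Y\<close>
  to \<open>X\<close> and those from \<open>Y'\<close> to \<open>X'\<close> take the place of an
  isomorphism of quotients: each carries chains to chains.\<close>

lemma has_length_iso:
  assumes X: "sm X" "sm X'" and l: "has_length Y X l"
    and f: "\<And>S. sm S \<Longrightarrow> Y \<subseteq> S \<Longrightarrow> S \<subseteq> X \<Longrightarrow> sm (f S) \<and> Y' \<subseteq> f S \<and> f S \<subseteq> X'"
    and f': "\<And>S S'. sm S \<Longrightarrow> sm S' \<Longrightarrow> Y \<subseteq> S \<Longrightarrow> S \<subset> S' \<Longrightarrow> S' \<subseteq> X \<Longrightarrow> f S \<subset> f S'"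
    and g: "\<And>S. sm S \<Longrightarrow> Y' \<subseteq> S \<Longrightarrow> S \<subseteq> X' \<Longrightarrow> sm (g S) \<and> Y \<subseteq> g S \<and> g S \<subseteq> X"
    and g': "\<And>S S'. sm S \<Longrightarrow> sm S' \<Longrightarrow> Y' \<subseteq> S \<Longrightarrow> S \<subset> S' \<Longrightarrow> S' \<subseteq> X' \<Longrightarrow> g S \<subset> g S'"
  shows "has_length Y' X' l"
  unfolding has_length_def
proof (intro conjI allI impI)
  have "chn l Y X" "Y \<subseteq> X" using l has_length_sm[OF l] unfolding has_length_def by auto
  hence "chn l Y' (f X)" by (intro chn_map[of Y X f, OF _ f']) (use f in auto)
  thus "chn l Y' X'" by (rule chn_top_mono) (use f[of X] X \<open>Y \<subseteq> X\<close> in auto)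
  fix n assume n: "chn n Y' X'"
  have "chn n Y (g X')" by (rule chn_map[of Y' X' g, OF _ g' n]) (use g in auto)
  hence "chn n Y X" by (rule chn_top_mono) (use g[of X'] X chn_subset[OF n] in auto)
  thus "n \<le> l" using l unfolding has_length_def by blast
qed

lemma has_length_second_iso:
  assumes X: "sm X" and Y: "sm Y" and l: "has_length (X \<inter> Y) X l"
  shows "has_length Y (X \<uplus> Y) l"
proof (rule has_length_iso[OF X sm_ssum[OF X Y] l, of "\<lambda>S. S \<uplus> Y" _ "\<lambda>S. S \<inter> X"])
  have X_Y: "sm (X \<uplus> Y)" by (rule sm_ssum[OF X Y])
  show "sm (S \<uplus> Y) \<and> Y \<subseteq> S \<uplus> Y \<and> S \<uplus> Y \<subseteq> X \<uplus> Y"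
    if "sm S" "X \<inter> Y \<subseteq> S" "S \<subseteq> X" for S
    using sm_ssum[OF that(1) Y] ssum_ub2[OF that(1) sm_carrier[OF Y]] ssum_mono[OF that(3) order_refl] by blast
  show "S \<uplus> Y \<subset> S' \<uplus> Y"
    if S: "sm S" "sm S'" "X \<inter> Y \<subseteq> S" "S \<subset> S'" "S' \<subseteq> X" for S S'
  proof -
    have "S \<uplus> Y \<noteq> S' \<uplus> Y"
    proof
      assume e: "S \<uplus> Y = S' \<uplus> Y"
      have "S' = S' \<inter> (S \<uplus> Y)" unfolding e using ssum_ub1[OF sm_carrier[OF S(2)] Y] by blast
      also have "\<dots> = S \<uplus> (S' \<inter> Y)"
        using sm_modular[OF S(2) Y _ sm_carrier[OF S(1)]] S(4) by blast
      also have "\<dots> \<subseteq> S" by (rule ssum_least[OF S(1)]) (use S in auto)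
      finally show False using S(4) by blast
    qed
    thus ?thesis using ssum_mono[of S S' Y Y] S(4) by blast
  qed
  show "sm (S \<inter> X) \<and> X \<inter> Y \<subseteq> S \<inter> X \<and> S \<inter> X \<subseteq> X" if "sm S" "Y \<subseteq> S" "S \<subseteq> X \<uplus> Y" for S
    using sm_Int[OF that(1) X] that by blast
  show "S \<inter> X \<subset> S' \<inter> X" if S: "sm S" "sm S'" "Y \<subseteq> S" "S \<subset> S'" "S' \<subseteq> X \<uplus> Y" for S S'
  proof -
    have eq: "T = Y \<uplus> (T \<inter> X)" if T: "sm T" "Y \<subseteq> T" "T \<subseteq> X \<uplus> Y" for T
    proof -
      have "T = T \<inter> (Y \<uplus> X)" using T(3) ssum_commute[OF X Y] by blast
      also have "\<dots> = Y \<uplus> (T \<inter> X)" by (rule sm_modular[OF T(1) X T(2) sm_carrier[OF Y]])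
      finally show ?thesis .
    qed
    have "S \<inter> X \<noteq> S' \<inter> X" using eq[of S] eq[of S'] S by (metis order_trans psubset_imp_subset psubset_eq)
    thus ?thesis using S(4) by blast
  qed
qed

text \<open>Multiplication by \<open>x\<close> induces an isomorphism of \<open>X/Y\<close> with the
  quotient of the images modulo \<open>N\<close>: by \<open>ker\<close>, whatever it sends into
  \<open>N\<close> already lies in \<open>Y\<close>.\<close>

lemma has_length_elem_smult:
  assumes xR: "x \<in> carrier R" and N: "sm N" and Y: "sm Y" and NY: "N \<subseteq> Y"
    and l: "has_length Y X l" and ker: "\<And>z. z \<in> X \<Longrightarrow> x \<bullet> z \<in> N \<Longrightarrow> z \<in> Y"
  shows "has_length (elem_smult M x Y \<uplus> N) (elem_smult M x X \<uplus> N) l"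
proof -
  have X: "sm X" and YX: "Y \<subseteq> X" using has_length_sm[OF l] by auto
  have smx: "sm (elem_smult M x S \<uplus> N)" if "sm S" for S by (rule sm_ssum[OF sm_elem_smult[OF xR that] N])
  have monox: "elem_smult M x S \<uplus> N \<subseteq> elem_smult M x S' \<uplus> N" if "S \<subseteq> S'" for S S'
    by (rule ssum_mono[OF elem_smult_mono[OF that] order_refl])
  have inx: "x \<bullet> z \<in> elem_smult M x S \<uplus> N" if "sm S" "z \<in> S" for S z
    using ssum_ub1[OF sm_carrier[OF sm_elem_smult[OF xR that(1)]] N] elem_smult_incl[OF that(2)] by blast
  show ?thesis
  proof (rule has_length_iso[OF X smx[OF X] l, of "\<lambda>S. elem_smult M x S \<uplus> N" _ "\<lambda>T. {z \<in> X. x \<bullet> z \<in> T}"])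
    show "sm (elem_smult M x S \<uplus> N) \<and> elem_smult M x Y \<uplus> N \<subseteq> elem_smult M x S \<uplus> N \<and>
        elem_smult M x S \<uplus> N \<subseteq> elem_smult M x X \<uplus> N" if "sm S" "Y \<subseteq> S" "S \<subseteq> X" for S
      using smx[OF that(1)] monox that by blast
    show "elem_smult M x S \<uplus> N \<subset> elem_smult M x S' \<uplus> N"
      if S: "sm S" "sm S'" "Y \<subseteq> S" "S \<subset> S'" "S' \<subseteq> X" for S S'
    proof -
      obtain z where z: "z \<in> S'" "z \<notin> S" using S(4) by blast
      have "x \<bullet> z \<notin> elem_smult M x S \<uplus> N"
      proof
        assume "x \<bullet> z \<in> elem_smult M x S \<uplus> N"
        then obtain s n where s: "s \<in> S" "n \<in> N" "x \<bullet> z = x \<bullet> s \<oplus>\<^sub>M n"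
          unfolding mem_ssum elem_smult_def by blast
        have car: "s \<in> carrier M" "z \<in> carrier M" "n \<in> carrier M"
          using s z sm_mem[OF S(1)] sm_mem[OF S(2)] sm_mem[OF N] by auto
        have "x \<bullet> (z \<ominus>\<^sub>M s) = n" using car s(3) xR by (simp add: smult_diff)
        moreover have "z \<ominus>\<^sub>M s \<in> X" using sm_minus[OF X] z s S by blast
        ultimately have "z \<ominus>\<^sub>M s \<in> S" using ker s(2) S(3) by blast
        thus False using sm_diff_cancel[OF S(1) car(2) s(1)] z(2) by blast
      qed
      thus ?thesis using inx[OF S(2) z(1)] monox[of S S'] S(4) by blast
    qed
    show "sm {z \<in> X. x \<bullet> z \<in> T} \<and> Y \<subseteq> {z \<in> X. x \<bullet> z \<in> T} \<and> {z \<in> X. x \<bullet> z \<in> T} \<subseteq> X"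
      if T: "sm T" "elem_smult M x Y \<uplus> N \<subseteq> T" "T \<subseteq> elem_smult M x X \<uplus> N" for T
      using sm_elem_colon[OF xR T(1) X] T(2) inx[OF Y] YX by blast
    show "{z \<in> X. x \<bullet> z \<in> T} \<subset> {z \<in> X. x \<bullet> z \<in> T'}"
      if T: "sm T" "sm T'" "elem_smult M x Y \<uplus> N \<subseteq> T" "T \<subset> T'" "T' \<subseteq> elem_smult M x X \<uplus> N" for T T'
    proof -
      obtain t where t: "t \<in> T'" "t \<notin> T" using T(4) by blast
      have "t \<in> elem_smult M x X \<uplus> N" using t T(5) by blast
      then obtain z n where z: "z \<in> X" "n \<in> N" "t = x \<bullet> z \<oplus>\<^sub>M n"
        unfolding mem_ssum elem_smult_def by blast
      have car: "z \<in> carrier M" "n \<in> carrier M" using z sm_mem[OF X] sm_mem[OF N] by auto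
      have "N \<subseteq> T" using T(3) ssum_ub2[OF sm_elem_smult[OF xR Y] sm_carrier[OF N]] by blast
      hence n: "n \<in> T" "n \<in> T'" using z(2) T(4) by blast+
      have "x \<bullet> z \<in> T'" using sm_add_cancel_right[OF T(2) n(2)] t z(3) car xR by simp
      moreover have "x \<bullet> z \<notin> T" using sm_add[OF T(1) _ n(1)] t z(3) by blast
      ultimately show ?thesis using z(1) T(4) by blast
    qed
  qed
qed

end

section \<open>Local rings, maximal submodules and Nakayama's lemma\<close>

locale local_power_family = noetherian_power_family R M d K
  for R :: "('a, 'r) ring_scheme" (structure) and M :: "('a, 'b, 'm) module_scheme" (structure)
    and d :: nat and K :: "nat \<Rightarrow> 'a set" +
  fixes \<mm> :: "'a set"
  assumes local: "local_ring R \<mm>" and K0: "K 0 \<subseteq> \<mm>" and infinite_residue: "infinite (carrier (R Quot \<mm>))"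
begin

lemma mm: "maximalideal \<mm> R"
  using local by (simp add: local_ring_def)

lemma mm_ideal: "ideal \<mm> R"
  using mm by (rule maximalideal.axioms(1))

lemma not_mm_unit:
  assumes a: "a \<in> carrier R" "a \<notin> \<mm>" shows "a \<in> Units R"
proof (rule ccontr)
  assume nu: "a \<notin> Units R"
  have "PIdl a \<noteq> carrier R"
  proof
    assume "PIdl a = carrier R"
    then obtain b where "b \<in> carrier R" "\<one> = b \<otimes> a" unfolding cgenideal_def by (smt (verit) R.one_closed mem_Collect_eq)
    thus False using nu a unfolding Units_def by (auto simp: R.m_comm)
  qed
  hence Q: "ideal (PIdl a) R \<and> PIdl a \<noteq> carrier R" using R.cgenideal_ideal[OF a(1)] by blast
  have acc: "acc (\<lambda>I. ideal I R \<and> I \<noteq> carrier R)"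
    by (rule acc_subset[OF noetherian_ring.acc_ideals[OF noetherian]]) blast
  obtain I where I: "ideal I R \<and> I \<noteq> carrier R" "PIdl a \<subseteq> I"
    "\<And>I'. ideal I' R \<and> I' \<noteq> carrier R \<Longrightarrow> I \<subseteq> I' \<Longrightarrow> I' = I"
    by (rule acc_maximal[of "\<lambda>I. ideal I R \<and> I \<noteq> carrier R", OF acc Q]) blast
  have "maximalideal I R" using I by (intro maximalidealI) auto
  hence "I = \<mm>" using local unfolding local_ring_def by blast
  thus False using I(2) R.cgenideal_self[OF a(1)] a(2) by blast
qed

lemma one_minus_unit:
  assumes "j \<in> \<mm>" shows "\<one> \<ominus> j \<in> Units R"
proof (rule not_mm_unit)
  have j: "j \<in> carrier R" by (rule ideal.Icarr[OF mm_ideal assms])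
  show "\<one> \<ominus> j \<in> carrier R" using j by simp
  show "\<one> \<ominus> j \<notin> \<mm>"
  proof
    assume "\<one> \<ominus> j \<in> \<mm>"
    hence "(\<one> \<ominus> j) \<oplus> j \<in> \<mm>" using assms additive_subgroup.a_closed[OF ideal.axioms(1)[OF mm_ideal]] by blast
    moreover have "(\<one> \<ominus> j) \<oplus> j = \<one>" using j by (simp add: R.minus_eq R.a_assoc R.l_neg)
    ultimately have "\<mm> = carrier R" using ideal.one_imp_carrier[OF mm_ideal] by simp
    thus False using maximalideal.I_notcarr[OF mm] by simp
  qed
qed

lemma unit_smult_cancel:
  assumes u: "u \<in> Units R" and N: "sm N" and z: "z \<in> carrier M" and uz: "u \<bullet> z \<in> N" shows "z \<in> N"
proof -
  have uR: "u \<in> carrier R" "inv u \<in> carrier R" using u R.Units_closed[OF u] R.Units_inv_closed[OF u] by simp_all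
  have "inv u \<bullet> (u \<bullet> z) = z" using R.Units_l_inv[OF u] uR z by (simp add: smult_assoc1[symmetric])
  thus ?thesis using sm_smult[OF N uR(2) uz] by simp
qed

text \<open>One representative for each residue class; representatives of distinct classes differ by
  a unit. This is the infinite supply of parameters for the lines \<open>x + t y\<close>.\<close>

lemma residue_representatives:
  obtains T where "infinite T" "T \<subseteq> carrier R" "\<And>s t. s \<in> T \<Longrightarrow> t \<in> T \<Longrightarrow> s \<noteq> t \<Longrightarrow> s \<ominus> t \<in> Units R"
proof -
  define f where "f C = (SOME t. t \<in> carrier R \<and> C = \<mm> +> t)" for C
  have f: "f C \<in> carrier R \<and> C = \<mm> +> f C" if "C \<in> carrier (R Quot \<mm>)" for C
  proof -
    have "\<exists>t. t \<in> carrier R \<and> C = \<mm> +> t"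
      using that by (auto simp: FactRing_def A_RCOSETS_def')
    thus ?thesis unfolding f_def by (rule someI_ex)
  qed
  have "inj_on f (carrier (R Quot \<mm>))" using f by (metis inj_onI)
  hence "infinite (f ` carrier (R Quot \<mm>))" using infinite_residue finite_imageD by blast
  moreover have "f ` carrier (R Quot \<mm>) \<subseteq> carrier R" using f by blast
  moreover have "s \<ominus> t \<in> Units R"
    if st: "s \<in> f ` carrier (R Quot \<mm>)" "t \<in> f ` carrier (R Quot \<mm>)" "s \<noteq> t" for s t
  proof (rule not_mm_unit)
    obtain C D where CD: "C \<in> carrier (R Quot \<mm>)" "D \<in> carrier (R Quot \<mm>)" "s = f C" "t = f D" using st by blast
    have c: "s \<in> carrier R" "t \<in> carrier R" using CD f by auto
    show "s \<ominus> t \<in> carrier R" using c by simp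
    show "s \<ominus> t \<notin> \<mm>"
    proof
      assume "s \<ominus> t \<in> \<mm>"
      hence "\<mm> +> s = \<mm> +> t" using R.quotient_eq_iff_same_a_r_cos[OF mm_ideal c] by blast
      hence "C = D" using f CD by metis
      thus False using CD st by simp
    qed
  qed
  ultimately show ?thesis using that by blast
qed

definition max_sub :: "'b set \<Rightarrow> 'b set \<Rightarrow> bool" where
  "max_sub H Z \<longleftrightarrow> sm H \<and> H \<subset> Z \<and> (\<forall>S. sm S \<and> H \<subseteq> S \<and> S \<subset> Z \<longrightarrow> S = H)"

lemma max_sub_exists:
  assumes "sm H" "H \<subset> Z" obtains H' where "max_sub H' Z" "H \<subseteq> H'"
proof -
  have acc: "acc (\<lambda>S. sm S \<and> S \<subset> Z)" by (rule acc_subset[OF acc_submodules[OF noetherian fin_gen]]) blast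
  obtain H' where "sm H' \<and> H' \<subset> Z" "H \<subseteq> H'" "\<And>S. sm S \<and> S \<subset> Z \<Longrightarrow> H' \<subseteq> S \<Longrightarrow> S = H'"
    by (rule acc_maximal[of "\<lambda>S. sm S \<and> S \<subset> Z", OF acc conjI[OF assms]]) blast
  thus ?thesis by (intro that[of H']) (auto simp: max_sub_def)
qed

text \<open>\<open>Z/H\<close> is simple, so the class of \<open>z\<close> generates it.\<close>

lemma max_sub_span:
  assumes H: "max_sub H Z" and Z: "sm Z" and z: "z \<in> Z" "z \<notin> H" and w: "w \<in> Z"
  obtains c where "c \<in> carrier R" "w \<ominus>\<^sub>M c \<bullet> z \<in> H"
proof -
  have smH: "sm H" and HZ: "H \<subset> Z" using H by (auto simp: max_sub_def)
  have zM: "z \<in> carrier M" using z sm_mem[OF Z] by blast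
  let ?C = "(\<lambda>c. c \<bullet> z) ` carrier R"
  have C: "sm ?C" by (rule sm_mult_image[OF R.oneideal zM])
  have S: "sm (H \<uplus> ?C)" by (rule sm_ssum[OF smH C])
  have "H \<subseteq> H \<uplus> ?C" by (rule ssum_ub1[OF sm_carrier[OF smH] C])
  moreover have "z \<in> H \<uplus> ?C"
  proof -
    have "\<one> \<bullet> z \<in> ?C" by blast
    thus ?thesis using ssum_ub2[OF smH sm_carrier[OF C]] zM by auto
  qed
  moreover have "H \<uplus> ?C \<subseteq> Z" by (rule ssum_least[OF Z]) (use HZ sm_smult[OF Z _ z(1)] in auto)
  ultimately have "H \<uplus> ?C = Z" using H S z(2) unfolding max_sub_def by blast
  hence "w \<in> H \<uplus> ?C" using w by simp
  then obtain h c where hc: "h \<in> H" "c \<in> carrier R" "w = h \<oplus>\<^sub>M c \<bullet> z" unfolding mem_ssum by blast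
  hence "w \<ominus>\<^sub>M c \<bullet> z = h" using zM sm_mem[OF smH] by simp
  thus ?thesis using that hc by blast
qed

text \<open>If \<open>j \<bullet> z\<close> were outside \<open>H\<close>, it would generate
  \<open>Z\<close> modulo \<open>H\<close>, so \<open>(1 - c j) z\<close> would lie in
  \<open>H\<close> for some \<open>c\<close>; as \<open>1 - c j\<close> is a unit, so would
  \<open>z\<close>.\<close>

lemma max_sub_K0:
  assumes H: "max_sub H Z" and Z: "sm Z" shows "ideal_smult M (K 0) Z \<subseteq> H"
proof (rule ideal_smult_least)
  show smH: "sm H" using H by (simp add: max_sub_def)
  fix j z assume j: "j \<in> K 0" and z: "z \<in> Z"
  have jm: "j \<in> \<mm>" and jR: "j \<in> carrier R" using j K0 ideal.Icarr[OF mm_ideal] by auto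
  have zM: "z \<in> carrier M" using z sm_mem[OF Z] by blast
  show "j \<bullet> z \<in> H"
  proof (rule ccontr)
    assume n: "j \<bullet> z \<notin> H"
    obtain c where c: "c \<in> carrier R" "z \<ominus>\<^sub>M c \<bullet> (j \<bullet> z) \<in> H"
      by (rule max_sub_span[OF H Z sm_smult[OF Z jR z] n z])
    have cj: "c \<otimes> j \<in> \<mm>" using c jm ideal.I_l_closed[OF mm_ideal] by blast
    have "(\<one> \<ominus> c \<otimes> j) \<bullet> z = z \<ominus>\<^sub>M c \<bullet> (j \<bullet> z)"
      using c jR zM by (simp add: smult_diff_left smult_assoc1)
    hence "z \<in> H" using unit_smult_cancel[OF one_minus_unit[OF cj] smH zM] c(2) by simp
    thus False using n sm_smult[OF smH jR] by blast
  qed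
qed

text \<open>If \<open>H\<close> were smaller than \<open>Z\<close>, the chain condition would give a
  maximal submodule of \<open>Z\<close> above \<open>H\<close>. It contains \<open>K 0\<close> times
  \<open>Z\<close>, hence would contain \<open>Z\<close>.\<close>

theorem nakayama:
  assumes H: "sm H" and Z: "sm Z" and HZ: "H \<subseteq> Z" and ZJ: "Z \<subseteq> H \<uplus> ideal_smult M (K 0) Z"
  shows "Z = H"
proof (rule ccontr)
  assume "Z \<noteq> H"
  hence "H \<subset> Z" using HZ by blast
  then obtain H' where H': "max_sub H' Z" "H \<subseteq> H'" by (rule max_sub_exists[OF H])
  have "H \<uplus> ideal_smult M (K 0) Z \<subseteq> H'"
    by (rule ssum_least) (use H' max_sub_K0[OF H'(1) Z] in \<open>auto simp: max_sub_def\<close>)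
  thus False using ZJ H' unfolding max_sub_def by blast
qed

end

section \<open>Generic elements\<close>

context local_power_family
begin

text \<open>Two parameters \<open>s\<close>, \<open>t\<close> with values in \<open>W\<close> would
  put \<open>(s - t) y\<close>, hence \<open>y\<close>, into \<open>W\<close>; so there is at most
  one.\<close>

lemma line_finite:
  assumes T: "T \<subseteq> carrier R" "\<And>s t. s \<in> T \<Longrightarrow> t \<in> T \<Longrightarrow> s \<noteq> t \<Longrightarrow> s \<ominus> t \<in> Units R"
    and W: "ideal W R" and x: "x \<in> carrier R" and y: "y \<in> carrier R" "y \<notin> W"
  shows "finite {t \<in> T. x \<oplus> t \<otimes> y \<in> W}"
proof -
  have "s = t" if st: "s \<in> T" "t \<in> T" "x \<oplus> s \<otimes> y \<in> W" "x \<oplus> t \<otimes> y \<in> W" for s t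
  proof (rule ccontr)
    assume "s \<noteq> t"
    hence u: "s \<ominus> t \<in> Units R" using T(2) st by blast
    have c: "s \<in> carrier R" "t \<in> carrier R" using st T(1) by auto
    have "(x \<oplus> s \<otimes> y) \<ominus> (x \<oplus> t \<otimes> y) \<in> W"
      using st W by (simp add: R.minus_eq additive_subgroup.a_closed additive_subgroup.a_inv_closed ideal.axioms(1))
    moreover have "(x \<oplus> s \<otimes> y) \<ominus> (x \<oplus> t \<otimes> y) = (s \<ominus> t) \<otimes> y"
      using c x y by algebra
    ultimately have "inv (s \<ominus> t) \<otimes> ((s \<ominus> t) \<otimes> y) \<in> W"
      using ideal.I_l_closed[OF W] R.Units_inv_closed[OF u] by simp
    moreover have "inv (s \<ominus> t) \<otimes> ((s \<ominus> t) \<otimes> y) = y"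
      using u y(1) R.Units_l_inv[OF u] R.Units_inv_closed[OF u] R.Units_closed[OF u]
      by (simp add: R.m_assoc[symmetric])
    ultimately show False using y(2) by simp
  qed
  hence "{t \<in> T. x \<oplus> t \<otimes> y \<in> W} = {} \<or> (\<exists>t. {t \<in> T. x \<oplus> t \<otimes> y \<in> W} = {t})" by blast
  thus ?thesis by (elim disjE exE) (simp_all only: finite.emptyI finite.insertI)
qed

lemma line_finite_Union:
  assumes T: "T \<subseteq> carrier R" "\<And>s t. s \<in> T \<Longrightarrow> t \<in> T \<Longrightarrow> s \<noteq> t \<Longrightarrow> s \<ominus> t \<in> Units R"
    and W: "finite \<W>" "\<And>W. W \<in> \<W> \<Longrightarrow> ideal W R" and x: "x \<in> carrier R" and y: "y \<in> carrier R" "y \<notin> \<Union>\<W>"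
  shows "finite {t \<in> T. x \<oplus> t \<otimes> y \<in> \<Union>\<W>}"
proof -
  have "{t \<in> T. x \<oplus> t \<otimes> y \<in> \<Union>\<W>} = (\<Union>W\<in>\<W>. {t \<in> T. x \<oplus> t \<otimes> y \<in> W})" by blast
  thus ?thesis using W y line_finite[OF T _ x y(1)] by auto
qed

text \<open>If \<open>y\<close> avoids \<open>\<W>\<close> but lies in the new ideal
  \<open>W\<close>, take \<open>z\<close> outside \<open>W\<close>. Then \<open>z + t y\<close>
  stays outside \<open>W\<close> for every \<open>t\<close>, and outside the union of
  \<open>\<W>\<close> for all but finitely many parameters.\<close>

lemma ideal_avoidance:
  assumes I: "ideal I R" and W: "finite \<W>" "\<And>W. W \<in> \<W> \<Longrightarrow> ideal W R \<and> W \<subset> I"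
  shows "\<exists>y\<in>I. y \<notin> \<Union>\<W>"
proof -
  obtain T where T: "infinite T" "T \<subseteq> carrier R" "\<And>s t. s \<in> T \<Longrightarrow> t \<in> T \<Longrightarrow> s \<noteq> t \<Longrightarrow> s \<ominus> t \<in> Units R"
    by (rule residue_representatives) blast
  from W show ?thesis
  proof (induct \<W> rule: finite_induct)
    case empty
    show ?case using additive_subgroup.zero_closed[OF ideal.axioms(1)[OF I]] by blast
  next
    case (insert W \<W>)
    obtain y where y: "y \<in> I" "y \<notin> \<Union>\<W>" using insert(3,4) by blast
    show ?case
    proof (cases "y \<in> W")
      case False
      thus ?thesis using y by blast
    next
      case True
      have W: "ideal W R" using insert(4) by blast
      obtain z where z: "z \<in> I" "z \<notin> W" using insert(4)[of W] by blast
      have c: "y \<in> carrier R" "z \<in> carrier R" using y z ideal.Icarr[OF I] by auto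
      have "finite {t \<in> T. z \<oplus> t \<otimes> y \<in> \<Union>\<W>}"
        by (rule line_finite_Union[OF T(2,3) insert(1) _ c(2,1) y(2)]) (use insert(4) in auto)
      then obtain t where t: "t \<in> T" "z \<oplus> t \<otimes> y \<notin> \<Union>\<W>"
        using T(1) by (metis (mono_tags, lifting) finite_subset mem_Collect_eq subsetI)
      have tR: "t \<in> carrier R" using t T(2) by blast
      have "z \<oplus> t \<otimes> y \<notin> W"
      proof
        assume a: "z \<oplus> t \<otimes> y \<in> W"
        have "t \<otimes> y \<in> W" using ideal.I_l_closed[OF W True tR] .
        hence "(z \<oplus> t \<otimes> y) \<ominus> t \<otimes> y \<in> W"
          using a W by (simp add: R.minus_eq additive_subgroup.a_closed additive_subgroup.a_inv_closed ideal.axioms(1))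
        moreover have "(z \<oplus> t \<otimes> y) \<ominus> t \<otimes> y = z" using c tR by algebra
        ultimately show False using z(2) by simp
      qed
      moreover have "z \<oplus> t \<otimes> y \<in> I"
        using z y tR I by (simp add: additive_subgroup.a_closed ideal.axioms(1) ideal.I_l_closed)
      ultimately show ?thesis using t(2) by blast
    qed
  qed
qed

text \<open>Surjectivity of \<open>x + t y : L \<rightarrow> X/S\<close> is an open condition on \<open>t\<close>: for bad parameters \<open>t\<close> choose
  maximal submodules \<open>H t\<close> containing the image; like eigenspaces for distinct eigenvalues, these
  are independent, so that finite length of \<open>X/K\<^sub>0X\<close> bounds their number.\<close>

lemma surjective_open:
  assumes T: "T \<subseteq> carrier R" "\<And>s t. s \<in> T \<Longrightarrow> t \<in> T \<Longrightarrow> s \<noteq> t \<Longrightarrow> s \<ominus> t \<in> Units R"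
    and L: "sm L" and S: "sm S" and X: "sm X" and x: "x \<in> carrier R" and y: "y \<in> carrier R"
    and xL: "elem_smult M x L \<subseteq> X" and yL: "elem_smult M y L \<subseteq> X"
    and surj: "X \<subseteq> elem_smult M x L \<uplus> S"
    and len: "has_length Y X c" "Y \<subseteq> ideal_smult M (K 0) X \<uplus> S"
  shows "finite {t \<in> T. \<not> X \<subseteq> elem_smult M (x \<oplus> t \<otimes> y) L \<uplus> S}"
proof -
  define Z where "Z = X \<uplus> S"
  have Z: "sm Z" unfolding Z_def by (rule sm_ssum[OF X S])
  have XZ: "X \<subseteq> Z" and SZ: "S \<subseteq> Z"
    unfolding Z_def using ssum_ub1[OF sm_carrier[OF X] S] ssum_ub2[OF X sm_carrier[OF S]] by auto
  have smx: "sm (elem_smult M x L)" by (rule sm_elem_smult[OF x L])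
  have ZxS: "Z \<subseteq> elem_smult M x L \<uplus> S"
    unfolding Z_def by (rule ssum_least[OF sm_ssum[OF smx S] surj ssum_ub2[OF smx sm_carrier[OF S]]])
  \<comment> \<open>Every maximal submodule of \<open>Z\<close> above \<open>S\<close> contains
    \<open>V\<close>, and \<open>Z/V\<close> has finite length, being an image of
    \<open>X/Y\<close>.\<close>
  define V where "V = ideal_smult M (K 0) X \<uplus> S"
  have K0: "ideal (K 0) R" by (rule K_ideal) simp
  have KX: "sm (ideal_smult M (K 0) X)" by (rule sm_ideal_smult[OF K0 sm_carrier[OF X]])
  have V: "sm V" unfolding V_def by (rule sm_ssum[OF KX S])
  obtain c' where c': "has_length (X \<inter> V) X c'"
    by (rule has_length_split[OF len(1) sm_Int[OF X V]])
      (use len(2) has_length_sm[OF len(1)] in \<open>auto simp: V_def\<close>)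
  have "X \<uplus> V = Z"
  proof
    show "X \<uplus> V \<subseteq> Z"
      using ideal_smult_le[OF K0 X] XZ SZ unfolding V_def by (intro ssum_least Z) auto
    show "Z \<subseteq> X \<uplus> V"
      unfolding Z_def by (rule ssum_mono[OF order_refl]) (simp add: V_def ssum_ub2[OF KX sm_carrier[OF S]])
  qed
  hence lenZ: "has_length V Z c'" using has_length_second_iso[OF X V c'] by simp
  \<comment> \<open>Restricted to units, so that \<open>t\<close> can be cancelled below; at most
    one element of \<open>T\<close> is lost.\<close>
  define bad where "bad = {t \<in> T \<inter> Units R. \<not> X \<subseteq> elem_smult M (x \<oplus> t \<otimes> y) L \<uplus> S}"
  have "\<exists>H. max_sub H Z \<and> elem_smult M (x \<oplus> t \<otimes> y) L \<uplus> S \<subseteq> H" if t: "t \<in> bad" for t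
  proof -
    have tR: "t \<in> carrier R" using t T(1) by (auto simp: bad_def)
    have xt: "x \<oplus> t \<otimes> y \<in> carrier R" using x y tR by simp
    have sm: "sm (elem_smult M (x \<oplus> t \<otimes> y) L \<uplus> S)" by (rule sm_ssum[OF sm_elem_smult[OF xt L] S])
    have "elem_smult M (x \<oplus> t \<otimes> y) L \<subseteq> X"
    proof
      fix w assume "w \<in> elem_smult M (x \<oplus> t \<otimes> y) L"
      then obtain l where l: "l \<in> L" "w = (x \<oplus> t \<otimes> y) \<bullet> l" by (auto simp: elem_smult_def)
      have lM: "l \<in> carrier M" using l sm_mem[OF L] by blast
      have "w = x \<bullet> l \<oplus>\<^sub>M t \<bullet> (y \<bullet> l)"
        using l lM x y tR by (simp add: smult_l_distr smult_assoc1)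
      moreover have "x \<bullet> l \<in> X" "y \<bullet> l \<in> X" using xL yL elem_smult_incl[OF l(1)] by blast+
      ultimately show "w \<in> X" using sm_add[OF X] sm_smult[OF X tR] by simp
    qed
    hence "elem_smult M (x \<oplus> t \<otimes> y) L \<uplus> S \<subseteq> Z" using XZ SZ by (intro ssum_least[OF Z]) auto
    moreover have "\<not> Z \<subseteq> elem_smult M (x \<oplus> t \<otimes> y) L \<uplus> S" using t XZ by (auto simp: bad_def)
    ultimately obtain H where "max_sub H Z" "elem_smult M (x \<oplus> t \<otimes> y) L \<uplus> S \<subseteq> H"
      using max_sub_exists[OF sm] by blast
    thus ?thesis by blast
  qed
  then obtain H where H: "\<And>t. t \<in> bad \<Longrightarrow> max_sub (H t) Z"
    and HS: "\<And>t. t \<in> bad \<Longrightarrow> elem_smult M (x \<oplus> t \<otimes> y) L \<uplus> S \<subseteq> H t" by metis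
  have smH: "sm (H t)" and HZ: "H t \<subset> Z" if "t \<in> bad" for t using H[OF that] by (auto simp: max_sub_def)
  have badR: "t \<in> carrier R" "t \<in> Units R" "t \<in> T" if "t \<in> bad" for t using that T(1) by (auto simp: bad_def)
  have SH: "S \<subseteq> H t" if t: "t \<in> bad" for t
    using ssum_ub2[OF sm_elem_smult[OF _ L] sm_carrier[OF S], of "x \<oplus> t \<otimes> y"] HS[OF t] x y badR(1)[OF t] by auto
  have eig: "x \<bullet> l \<oplus>\<^sub>M t \<bullet> (y \<bullet> l) \<in> H t" if t: "t \<in> bad" and l: "l \<in> L" for t l
  proof -
    have tR: "t \<in> carrier R" by (rule badR(1)[OF t])
    have lM: "l \<in> carrier M" using l sm_mem[OF L] by blast
    have "elem_smult M (x \<oplus> t \<otimes> y) L \<subseteq> H t"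
      using ssum_ub1[OF sm_carrier[OF sm_elem_smult[OF _ L]] S, of "x \<oplus> t \<otimes> y"] HS[OF t] x y tR by auto
    hence "(x \<oplus> t \<otimes> y) \<bullet> l \<in> H t" using elem_smult_incl[OF l] by blast
    thus ?thesis using lM x y tR by (simp add: smult_l_distr smult_assoc1)
  qed
  \<comment> \<open>For \<open>l\<close> in \<open>L\<close>, \<open>x l\<close> is congruent to
    \<open>- t (y l)\<close> modulo \<open>H t\<close>, with \<open>t\<close> in the role of an
    eigenvalue. As for distinct eigenvalues, no \<open>H a\<close> contains the intersection of
    finitely many others.\<close>
  have indep: "\<exists>z\<in>Z. (\<forall>b\<in>B. z \<in> H b) \<and> z \<notin> H a" if "finite B" "B \<subseteq> bad" "a \<in> bad" "a \<notin> B" for a B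
    using that
  proof (induct "card B" arbitrary: B a rule: less_induct)
    case less
    note B = less(2-5)
    show ?case
    proof (rule ccontr)
      assume "\<not> (\<exists>z\<in>Z. (\<forall>b\<in>B. z \<in> H b) \<and> z \<notin> H a)"
      hence con: "z \<in> H a" if "z \<in> Z" "\<And>b. b \<in> B \<Longrightarrow> z \<in> H b" for z using that by blast
      \<comment> \<open>If \<open>H a\<close> contained the intersection over \<open>B\<close>,
        every element \<open>n\<close> that separates \<open>b\<close> from the rest of
        \<open>B\<close> would itself lie in \<open>H a\<close>.\<close>
      have "\<exists>n. n \<in> Z \<and> (\<forall>c\<in>B - {b}. n \<in> H c) \<and> n \<notin> H b \<and> n \<in> H a" if b: "b \<in> B" for b
      proof -
        have "card (B - {b}) < card B" using b B(1) by (meson card_Diff1_less)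
        then obtain n where n: "n \<in> Z" "\<forall>c\<in>B - {b}. n \<in> H c" "n \<notin> H b"
          using less(1)[of "B - {b}" b] B b by blast
        have "n \<in> elem_smult M x L \<uplus> S" using n(1) ZxS by blast
        then obtain l s where l: "l \<in> L" "s \<in> S" "n = x \<bullet> l \<oplus>\<^sub>M s" unfolding mem_ssum elem_smult_def by blast
        define p where "p = x \<bullet> l"
        define q where "q = y \<bullet> l"
        have lM: "l \<in> carrier M" using l sm_mem[OF L] by blast
        have pq: "p \<in> carrier M" "q \<in> carrier M" using lM x y by (auto simp: p_def q_def)
        have sM: "s \<in> carrier M" using l sm_mem[OF S] by blast
        have nps: "n = p \<oplus>\<^sub>M s" using l by (simp add: p_def)
        have pqZ: "p \<in> Z" "q \<in> Z" using xL yL XZ elem_smult_incl[OF l(1)] by (auto simp: p_def q_def)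
        have pH: "p \<in> H c \<longleftrightarrow> n \<in> H c" if c: "c \<in> bad" for c
          using sm_add[OF smH[OF c], of p s] sm_add_cancel_right[OF smH[OF c], of s p] SH[OF c] l(2) nps pq by blast
        have e: "p \<oplus>\<^sub>M t \<bullet> q \<in> H t" if "t \<in> bad" for t using eig[OF that l(1)] by (simp add: p_def q_def)
        have bb: "b \<in> bad" and bR: "b \<in> carrier R" using b B(2) badR(1) by auto
        have aR: "a \<in> carrier R" using B(3) badR(1) by blast
        \<comment> \<open>The combination adapted to the eigenvalue \<open>b\<close>: it lies in
          every \<open>H c\<close> with \<open>c\<close> in \<open>B\<close>, hence in
          \<open>H a\<close>, and comparing it with the relation for \<open>a\<close> leaves
          \<open>(b - a) q\<close>.\<close>
        define r where "r = p \<oplus>\<^sub>M b \<bullet> q"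
        have rH: "r \<in> H c" if c: "c \<in> B" for c
        proof (cases "c = b")
          case True
          thus ?thesis using e[OF bb] by (simp add: r_def)
        next
          case False
          have cb: "c \<in> bad" using c B(2) by blast
          have pc: "p \<in> H c" using pH[OF cb] n(2) c False by blast
          have "c \<bullet> q \<in> H c"
            by (rule sm_add_cancel_left[OF smH[OF cb] pc _ e[OF cb]]) (use pq badR(1)[OF cb] in simp)
          hence "q \<in> H c" by (rule unit_smult_cancel[OF badR(2)[OF cb] smH[OF cb] pq(2)])
          thus ?thesis using pc sm_add[OF smH[OF cb]] sm_smult[OF smH[OF cb] bR] by (simp add: r_def)
        qed
        have "r \<in> Z" using pqZ sm_add[OF Z] sm_smult[OF Z bR] by (simp add: r_def)
        hence ra: "r \<in> H a" using con rH by blast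
        have "(b \<ominus> a) \<bullet> q = r \<ominus>\<^sub>M (p \<oplus>\<^sub>M a \<bullet> q)"
          using pq aR bR by (simp add: r_def smult_diff_left M.minus_eq M.minus_add M.a_ac M.r_neg M.r_neg1 M.r_neg2)
        hence "(b \<ominus> a) \<bullet> q \<in> H a" using sm_minus[OF smH[OF B(3)] ra e[OF B(3)]] by simp
        moreover have "b \<ominus> a \<in> Units R" using T(2) badR(3) bb B b by blast
        ultimately have "q \<in> H a" using unit_smult_cancel[OF _ smH[OF B(3)] pq(2)] by blast
        hence aq: "a \<bullet> q \<in> H a" by (rule sm_smult[OF smH[OF B(3)] aR])
        have "p \<in> H a" by (rule sm_add_cancel_right[OF smH[OF B(3)] aq pq(1) e[OF B(3)]])
        thus ?thesis using n pH[OF B(3)] by blast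
      qed
      then obtain n where n: "\<And>b. b \<in> B \<Longrightarrow> n b \<in> Z" "\<And>b c. b \<in> B \<Longrightarrow> c \<in> B - {b} \<Longrightarrow> n b \<in> H c"
        "\<And>b. b \<in> B \<Longrightarrow> n b \<notin> H b" "\<And>b. b \<in> B \<Longrightarrow> n b \<in> H a" by metis
      \<comment> \<open>The elements \<open>n b\<close> are a dual family: subtracting multiples of
        them, all in \<open>H a\<close>, moves any \<open>z\<close> of \<open>Z\<close> into the
        intersection over \<open>B\<close>, so that \<open>Z \<subseteq> H a\<close> would
        follow.\<close>
      have "\<exists>h\<in>H a. \<forall>b\<in>B'. z \<ominus>\<^sub>M h \<in> H b" if z: "z \<in> Z" and B': "B' \<subseteq> B" for z B'
        using finite_subset[OF B' B(1)] B'
      proof (induct B' rule: finite_induct)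
        case empty
        show ?case using sm_zero[OF smH[OF B(3)]] by blast
      next
        case (insert b B')
        then obtain h where h: "h \<in> H a" "\<And>b. b \<in> B' \<Longrightarrow> z \<ominus>\<^sub>M h \<in> H b" by blast
        have b: "b \<in> B" "b \<in> bad" using insert B by auto
        have wZ: "z \<ominus>\<^sub>M h \<in> Z" using sm_minus[OF Z z] h(1) HZ[OF B(3)] by blast
        obtain c where c: "c \<in> carrier R" "(z \<ominus>\<^sub>M h) \<ominus>\<^sub>M c \<bullet> n b \<in> H b"
          by (rule max_sub_span[OF H[OF b(2)] Z n(1)[OF b(1)] n(3)[OF b(1)] wZ])
        have car: "z \<in> carrier M" "h \<in> carrier M" "n b \<in> carrier M"
          using z h(1) sm_mem[OF Z] sm_mem[OF smH[OF B(3)]] n(1)[OF b(1)] by auto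
        have e: "z \<ominus>\<^sub>M (h \<oplus>\<^sub>M c \<bullet> n b) = (z \<ominus>\<^sub>M h) \<ominus>\<^sub>M c \<bullet> n b"
          using car c by (simp add: M.minus_eq M.minus_add M.a_ac)
        have "z \<ominus>\<^sub>M (h \<oplus>\<^sub>M c \<bullet> n b) \<in> H b'" if b': "b' \<in> insert b B'" for b'
        proof (cases "b' = b")
          case True
          thus ?thesis using c(2) e by simp
        next
          case False
          have bb': "b' \<in> B'" "b' \<in> B" "b' \<in> bad" using b' False insert(4) B(2) by auto
          have "c \<bullet> n b \<in> H b'"
            using n(2)[OF b(1), of b'] bb' False by (intro sm_smult[OF smH[OF bb'(3)] c(1)]) auto
          thus ?thesis using sm_minus[OF smH[OF bb'(3)] h(2)[OF bb'(1)]] e by simp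
        qed
        moreover have "h \<oplus>\<^sub>M c \<bullet> n b \<in> H a"
          using sm_add[OF smH[OF B(3)] h(1)] sm_smult[OF smH[OF B(3)] c(1) n(4)[OF b(1)]] by blast
        ultimately show ?case by blast
      qed
      hence hz: "\<exists>h\<in>H a. \<forall>b\<in>B. z \<ominus>\<^sub>M h \<in> H b" if "z \<in> Z" for z using that by blast
      have "z \<in> H a" if z: "z \<in> Z" for z
      proof -
        obtain h where h: "h \<in> H a" "\<And>b. b \<in> B \<Longrightarrow> z \<ominus>\<^sub>M h \<in> H b" using hz[OF z] by blast
        have "z \<ominus>\<^sub>M h \<in> Z" using sm_minus[OF Z z] h(1) HZ[OF B(3)] by blast
        hence "z \<ominus>\<^sub>M h \<in> H a" using con h(2) by blast
        thus ?thesis using sm_diff_cancel[OF smH[OF B(3)] sm_mem[OF Z z] h(1)] by blast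
      qed
      thus False using HZ[OF B(3)] by blast
    qed
  qed
  have "finite bad"
  proof (rule ccontr)
    assume inf: "infinite bad"
    \<comment> \<open>Independence makes the finite intersections decrease strictly, which yields
      chains of any length between \<open>V\<close> and \<open>Z\<close>.\<close>
    define DD where "DD B = {z \<in> Z. \<forall>b\<in>B. z \<in> H b}" for B
    have VH: "V \<subseteq> H t" if t: "t \<in> bad" for t
    proof -
      have "ideal_smult M (K 0) X \<subseteq> H t"
        using ideal_smult_mono[OF order_refl XZ] max_sub_K0[OF H[OF t] Z] by blast
      thus ?thesis unfolding V_def by (intro ssum_least[OF smH[OF t] _ SH[OF t]])
    qed
    have VZ: "V \<subseteq> Z" using has_length_sm[OF lenZ] by blast
    have smD: "sm (DD B)" if "B \<subseteq> bad" for B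
      unfolding DD_def
    proof (rule smI)
      show "{z \<in> Z. \<forall>b\<in>B. z \<in> H b} \<subseteq> carrier M" using sm_carrier[OF Z] by blast
      show "\<zero>\<^sub>M \<in> {z \<in> Z. \<forall>b\<in>B. z \<in> H b}" using sm_zero[OF Z] sm_zero[OF smH] that by blast
      show "u \<oplus>\<^sub>M w \<in> {z \<in> Z. \<forall>b\<in>B. z \<in> H b}"
        if "u \<in> {z \<in> Z. \<forall>b\<in>B. z \<in> H b}" "w \<in> {z \<in> Z. \<forall>b\<in>B. z \<in> H b}" for u w
        using that \<open>B \<subseteq> bad\<close> sm_add[OF Z] sm_add[OF smH] by blast
      show "u \<bullet> w \<in> {z \<in> Z. \<forall>b\<in>B. z \<in> H b}"
        if "u \<in> carrier R" "w \<in> {z \<in> Z. \<forall>b\<in>B. z \<in> H b}" for u w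
        using that \<open>B \<subseteq> bad\<close> sm_smult[OF Z] sm_smult[OF smH] by blast
    qed
    have "chn r V (DD B)" if "finite B" "B \<subseteq> bad" for r B
      using that
    proof (induct r arbitrary: B)
      case 0
      have "V \<subseteq> DD B" using VZ VH 0 unfolding DD_def by blast
      thus ?case using smD[OF 0(2)] by simp
    next
      case (Suc r)
      obtain a where a: "a \<in> bad" "a \<notin> B" using inf Suc(2) by (metis finite_subset subsetI)
      have "chn r V (DD (insert a B))" using Suc a by simp
      moreover have "DD (insert a B) \<subset> DD B"
        using indep[OF Suc(2,3) a] unfolding DD_def by blast
      ultimately show ?case using smD[OF Suc(3)] by auto
    qed
    from this[of "{}" "Suc c'"] have "chn (Suc c') V Z" by (simp add: DD_def)
    thus False using lenZ unfolding has_length_def by fastforce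
  qed
  moreover have "finite {t \<in> T. t \<notin> Units R}"
  proof -
    have "s = t" if st: "s \<in> T" "t \<in> T" "s \<notin> Units R" "t \<notin> Units R" for s t
    proof (rule ccontr)
      assume "s \<noteq> t"
      hence u: "s \<ominus> t \<in> Units R" using T(2) st by blast
      have "s \<in> \<mm>" "t \<in> \<mm>" using not_mm_unit st T(1) by blast+
      hence "s \<ominus> t \<in> \<mm>"
        using mm_ideal by (simp add: R.minus_eq additive_subgroup.a_closed additive_subgroup.a_inv_closed ideal.axioms(1))
      hence "inv (s \<ominus> t) \<otimes> (s \<ominus> t) \<in> \<mm>" using ideal.I_l_closed[OF mm_ideal] R.Units_inv_closed[OF u] by blast
      hence "\<mm> = carrier R" using R.Units_l_inv[OF u] ideal.one_imp_carrier[OF mm_ideal] by simp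
      thus False using maximalideal.I_notcarr[OF mm] by simp
    qed
    hence "{t \<in> T. t \<notin> Units R} = {} \<or> (\<exists>t. {t \<in> T. t \<notin> Units R} = {t})" by blast
    thus ?thesis by (elim disjE exE) (simp_all only: finite.emptyI finite.insertI)
  qed
  moreover have "{t \<in> T. \<not> X \<subseteq> elem_smult M (x \<oplus> t \<otimes> y) L \<uplus> S} \<subseteq> bad \<union> {t \<in> T. t \<notin> Units R}"
    by (auto simp: bad_def)
  ultimately show ?thesis by (meson finite_UnI finite_subset)
qed

end

section \<open>Weak-(FC)-sequences and joint reductions\<close>

context power_family
begin

text \<open>The right-hand side of the equation for joint reductions, as an iterated sum.
  \<open>nfold\<close> adds to \<open>N\<close> the multiples of \<open>M\<close> by the sequence.
  The notions with prefix \<open>rel\<close> refer to \<open>M/N\<close>, so that an induction along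
  a sequence can replace \<open>N\<close> by \<open>xM + N\<close>.\<close>

primrec jsum :: "('a \<times> nat) list \<Rightarrow> (nat \<Rightarrow> nat) \<Rightarrow> 'b set" where
  "jsum [] v = {\<zero>\<^sub>M}"
| "jsum (p # s) v = elem_smult M (fst p) (U (lower (snd p) v)) \<uplus> jsum s v"

primrec nfold :: "('a \<times> nat) list \<Rightarrow> 'b set \<Rightarrow> 'b set" where
  "nfold [] N = N"
| "nfold (p # s) N = nfold s (elem_smult M (fst p) (carrier M) \<uplus> N)"

primrec rel_FC_seq :: "('a \<times> nat) list \<Rightarrow> 'b set \<Rightarrow> bool" where
  "rel_FC_seq [] N \<longleftrightarrow> True"
| "rel_FC_seq (p # s) N \<longleftrightarrow> rel_FC N (snd p) (fst p) \<and> rel_FC_seq s (elem_smult M (fst p) (carrier M) \<uplus> N)"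

definition seq_in :: "('a \<times> nat) list \<Rightarrow> bool" where
  "seq_in s \<longleftrightarrow> (\<forall>p\<in>set s. snd p \<le> d \<and> fst p \<in> K (snd p))"

text \<open>\<open>Q\<close> is the Hilbert function of \<open>M/N\<close> at large exponents. The
  definition also records that these lengths are finite, on which the deformation of joint
  reductions relies.\<close>

definition rel_P :: "'b set \<Rightarrow> ((nat \<Rightarrow> int) \<Rightarrow> int) \<Rightarrow> bool" where
  "rel_P N Q \<longleftrightarrow> for_all_large d (\<lambda>v. \<exists>l. has_length (U (inc 0 v) \<uplus> N) (U v \<uplus> N) l \<and>
     Q (\<lambda>i. int (v i)) = int l)"

definition rel_JR :: "('a \<times> nat) list \<Rightarrow> 'b set \<Rightarrow> bool" where
  "rel_JR s N \<longleftrightarrow> seq_in s \<and> for_all_large d (\<lambda>v. U v \<subseteq> jsum s v \<uplus> N)"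

lemma rel_FC_mem: "rel_FC N i x \<Longrightarrow> i \<le> d \<and> x \<in> K i \<and> x \<in> carrier R"
  unfolding rel_FC_def using K_mem by blast

lemma rel_FC_seq_in: "rel_FC_seq s N \<Longrightarrow> seq_in s"
  by (induct s arbitrary: N) (auto simp: seq_in_def dest: rel_FC_mem)

lemma seq_in_Cons: "seq_in (p # s) \<longleftrightarrow> snd p \<le> d \<and> fst p \<in> K (snd p) \<and> seq_in s"
  by (auto simp: seq_in_def)

lemma seq_in_carrier: "seq_in (p # s) \<Longrightarrow> fst p \<in> carrier R"
  using K_mem by (auto simp: seq_in_Cons)

lemma sm_xM: "x \<in> carrier R \<Longrightarrow> sm N \<Longrightarrow> sm (elem_smult M x (carrier M) \<uplus> N)"
  by (intro sm_ssum sm_elem_smult sm_carrier_whole)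

lemma sm_nfold: "seq_in s \<Longrightarrow> sm N \<Longrightarrow> sm (nfold s N)"
proof (induct s arbitrary: N)
  case (Cons p s)
  have "sm (elem_smult M (fst p) (carrier M) \<uplus> N)" by (rule sm_xM[OF seq_in_carrier[OF Cons(2)] Cons(3)])
  thus ?case using Cons by (simp add: seq_in_Cons)
qed simp

lemma sm_jsum: "seq_in s \<Longrightarrow> sm (jsum s v)"
proof (induct s)
  case (Cons p s)
  thus ?case using sm_ssum[OF sm_elem_smult[OF seq_in_carrier[OF Cons(2)] sm_U]] by (simp add: seq_in_Cons)
qed (simp add: sm_zero_set)

lemma inc_lower: "0 < v i \<Longrightarrow> inc i (lower i v) = v"
  by (simp add: lower_def)

lemma elem_U_lower:
  assumes "i \<le> d" "x \<in> K i" "0 < v i" shows "elem_smult M x (U (lower i v)) \<subseteq> U v"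
proof
  fix w assume "w \<in> elem_smult M x (U (lower i v))"
  then obtain z where "z \<in> U (lower i v)" "w = x \<bullet> z" unfolding elem_smult_def by blast
  thus "w \<in> U v" using K_smult_U[OF assms(1,2), of z "lower i v"] by (simp only: inc_lower[of v i, OF assms(3)])
qed

lemma jsum_U: "seq_in s \<Longrightarrow> \<forall>k\<le>d. 0 < v k \<Longrightarrow> jsum s v \<subseteq> U v"
proof (induct s)
  case (Cons p s)
  have "elem_smult M (fst p) (U (lower (snd p) v)) \<subseteq> U v"
    using Cons(2,3) by (intro elem_U_lower) (auto simp: seq_in_Cons)
  moreover have "jsum s v \<subseteq> U v" using Cons by (simp add: seq_in_Cons)
  ultimately show ?case unfolding jsum.simps by (rule ssum_least[OF sm_U])
qed (simp add: sm_zero[OF sm_U])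

lemma pw_jsum:
  assumes "seq_in s" "\<forall>k\<le>d. 0 < v k"
  shows "pw r (jsum s v) \<subseteq> jsum s (\<lambda>k. r k + v k)"
  using assms(1)
proof (induct s)
  case Nil
  show ?case using pw_le[OF sm_zero_set] by simp
next
  case (Cons p s)
  have xR: "fst p \<in> carrier R" by (rule seq_in_carrier[OF Cons(2)])
  have s: "seq_in s" and i: "snd p \<le> d" using Cons(2) by (auto simp: seq_in_Cons)
  have "(\<lambda>k. r k + lower (snd p) v k) = lower (snd p) (\<lambda>k. r k + v k)"
    using spec[OF assms(2), of "snd p"] i by (auto simp: lower_def fun_eq_iff)
  hence "pw r (elem_smult M (fst p) (U (lower (snd p) v))) = elem_smult M (fst p) (U (lower (snd p) (\<lambda>k. r k + v k)))"
    by (simp add: pw_elem[OF xR sm_U] pw_U)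
  thus ?case using ssum_mono[OF order_refl Cons(1)[OF s]]
    by (simp add: pw_ssum[OF sm_elem_smult[OF xR sm_U] sm_jsum[OF s]])
qed

text \<open>One sufficiently large degree suffices, since the powers of the ideals multiply it up.\<close>

lemma rel_JR_one:
  assumes s: "seq_in s" and N: "sm N" and v: "\<forall>k\<le>d. 0 < v k" and U: "U v \<subseteq> jsum s v \<uplus> N"
  shows "rel_JR s N"
proof -
  have "for_all_large d (\<lambda>w. U w \<subseteq> jsum s w \<uplus> N)"
  proof (rule for_all_largeI[of _ "Max (v ` {..d})"])
    fix w :: "nat \<Rightarrow> nat" assume w: "\<And>k. k \<le> d \<Longrightarrow> Max (v ` {..d}) \<le> w k"
    have vw: "v k \<le> w k" if "k \<le> d" for k
      using w[OF that] that by (meson Max_ge atMost_iff finite_atMost finite_imageI imageI order_trans)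
    let ?r = "\<lambda>k. w k - v k"
    have jc: "jsum s (\<lambda>k. ?r k + v k) = jsum s w"
      using s
    proof (induct s)
      case (Cons p s)
      have "U (lower (snd p) (\<lambda>k. ?r k + v k)) = U (lower (snd p) w)"
        by (rule U_cong) (use vw Cons(2) in \<open>auto simp: lower_def seq_in_Cons\<close>)
      thus ?case using Cons by (simp add: seq_in_Cons)
    qed simp
    have "U w = U (\<lambda>k. ?r k + v k)" by (rule U_cong) (use vw in auto)
    also have "\<dots> = pw ?r (U v)" by (simp add: pw_U)
    also have "\<dots> \<subseteq> pw ?r (jsum s v \<uplus> N)" by (rule pw_mono[OF U])
    also have "\<dots> = pw ?r (jsum s v) \<uplus> pw ?r N" by (rule pw_ssum[OF sm_jsum[OF s] N])
    also have "\<dots> \<subseteq> jsum s (\<lambda>k. ?r k + v k) \<uplus> N" by (rule ssum_mono[OF pw_jsum[OF s v] pw_le[OF N]])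
    finally show "U w \<subseteq> jsum s w \<uplus> N" unfolding jc .
  qed
  thus ?thesis using s by (simp add: rel_JR_def)
qed

text \<open>(FC1) for a whole sequence. The induction writes an element as a part from
  \<open>jsum s v\<close> plus a part in \<open>xM + N\<close>; the latter then lies in
  \<open>U v\<close> too, so that (FC1) for \<open>x\<close> applies to it.\<close>

lemma FC_seq_intersection:
  assumes "rel_FC_seq s N" "sm N"
  shows "for_all_large d (\<lambda>v. U v \<inter> nfold s N \<subseteq> jsum s v \<uplus> N)"
  using assms
proof (induct s arbitrary: N)
  case Nil
  have "N \<subseteq> {\<zero>\<^sub>M} \<uplus> N" by (rule ssum_ub2[OF sm_zero_set sm_carrier[OF Nil(2)]])
  thus ?case by (intro for_all_largeI) auto
next
  case (Cons p s)
  obtain x i where p: "p = (x, i)" by (cases p)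
  have FC: "rel_FC N i x" and s: "rel_FC_seq s (elem_smult M x (carrier M) \<uplus> N)"
    using Cons(2) by (auto simp: p)
  have i: "i \<le> d" and xK: "x \<in> K i" and xR: "x \<in> carrier R" using rel_FC_mem[OF FC] by auto
  note N = Cons(3)
  let ?N = "elem_smult M x (carrier M) \<uplus> N"
  have smN: "sm ?N" by (rule sm_xM[OF xR N])
  have sin: "seq_in s" by (rule rel_FC_seq_in[OF s])
  have FC1: "for_all_large d (\<lambda>v. ?N \<inter> (U v \<uplus> N) = elem_smult M x (U (lower i v)) \<uplus> N)"
    using FC by (simp add: rel_FC_def)
  show ?case
  proof (rule for_all_large_mono[OF for_all_large_conj[OF for_all_large_conj[OF Cons(1)[OF s smN] FC1]
          for_all_large_ge[of d 1]]], elim conjE)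
    fix v
    assume IH: "U v \<inter> nfold s ?N \<subseteq> jsum s v \<uplus> ?N"
      and FC1: "?N \<inter> (U v \<uplus> N) = elem_smult M x (U (lower i v)) \<uplus> N" and "\<forall>k\<le>d. 1 \<le> v k"
    hence v: "\<forall>k\<le>d. 0 < v k" by fastforce
    have smx: "sm (elem_smult M x (U (lower i v)))" by (rule sm_elem_smult[OF xR sm_U])
    have J: "sm (jsum s v)" by (rule sm_jsum[OF sin])
    show "U v \<inter> nfold (p # s) N \<subseteq> jsum (p # s) v \<uplus> N"
    proof
      fix z assume z: "z \<in> U v \<inter> nfold (p # s) N"
      hence "z \<in> jsum s v \<uplus> ?N" using IH by (auto simp: p)
      then obtain j n where jn: "j \<in> jsum s v" "n \<in> ?N" "z = j \<oplus>\<^sub>M n" by (subst (asm) mem_ssum) blast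
      have car: "j \<in> carrier M" "n \<in> carrier M" by (rule sm_mem[OF J jn(1)], rule sm_mem[OF smN jn(2)])
      have "j \<in> U v" using jsum_U[OF sin v] jn(1) by blast
      moreover have "j \<oplus>\<^sub>M n \<in> U v" using z jn(3) by blast
      ultimately have "n \<in> U v" by (rule sm_add_cancel_left[OF sm_U _ car(2)])
      hence "n \<in> U v \<uplus> N" using ssum_ub1[OF U_carrier N] by blast
      hence n: "n \<in> elem_smult M x (U (lower i v)) \<uplus> N" using jn(2) FC1 by blast
      have "z = n \<oplus>\<^sub>M j" using car jn(3) by (simp add: M.a_comm)
      moreover have "elem_smult M x (U (lower i v)) \<uplus> N \<subseteq> jsum (p # s) v \<uplus> N"
        by (rule ssum_mono[OF _ order_refl]) (simp add: p ssum_ub1[OF sm_carrier[OF smx] J])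
      moreover have "jsum s v \<subseteq> jsum (p # s) v \<uplus> N"
        using ssum_ub2[OF smx sm_carrier[OF J]] ssum_ub1[OF sm_carrier[OF sm_ssum[OF smx J]] N] by (auto simp: p)
      moreover have "sm (jsum (p # s) v \<uplus> N)" using sm_ssum[OF sm_ssum[OF smx J] N] by (simp add: p)
      ultimately show "z \<in> jsum (p # s) v \<uplus> N" using n jn(1) sm_add by blast
    qed
  qed
qed

lemma FC_seq_rel_JR:
  assumes "rel_FC_seq s N" "sm N" "for_all_large d (\<lambda>v. U v \<subseteq> nfold s N)"
  shows "rel_JR s N"
  unfolding rel_JR_def
proof
  show "seq_in s" by (rule rel_FC_seq_in[OF assms(1)])
  show "for_all_large d (\<lambda>v. U v \<subseteq> jsum s v \<uplus> N)"
    by (rule for_all_large_mono[OF for_all_large_conj[OF FC_seq_intersection[OF assms(1,2)] assms(3)]]) blast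
qed

end

context noetherian_power_family
begin

text \<open>The colons of \<open>N\<close> by the powers of \<open>IJ\<close> form an ascending
  chain of submodules of \<open>M\<close>; \<open>m0\<close> is an exponent from which it is
  constant.\<close>

lemma torsion_bound:
  assumes N: "sm N"
  obtains m0 where "\<And>z m. z \<in> carrier M \<Longrightarrow> \<forall>a\<in>PP (\<lambda>_. m). a \<bullet> z \<in> N \<Longrightarrow>
    \<forall>a\<in>PP (\<lambda>_. m0). a \<bullet> z \<in> N"
proof -
  define C where "C m = {z \<in> carrier M. \<forall>a\<in>PP (\<lambda>_. m). a \<bullet> z \<in> N}" for m
  have C: "sm (C m)" for m unfolding C_def by (rule sm_colon[OF PP_ideal N])
  have mono: "C m \<subseteq> C (Suc m)" for m
  proof
    fix z assume z: "z \<in> C m"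
    have "a \<bullet> z \<in> N" if a: "a \<in> PP (\<lambda>_. Suc m)" for a
    proof (rule ideal_prod_smult_mem[OF PP_ideal PP_ideal N])
      show "a \<in> PP (\<lambda>_. 1) \<cdot>\<^bsub>R\<^esub> PP (\<lambda>_. m)" using a PP_add[of "\<lambda>_. 1" "\<lambda>_. m"] by simp
      show "z \<in> carrier M" using z by (simp add: C_def)
      show "b \<bullet> (c \<bullet> z) \<in> N" if "b \<in> PP (\<lambda>_. 1)" "c \<in> PP (\<lambda>_. m)" for b c
        using z that sm_smult[OF N subsetD[OF PP_carrier that(1)]] by (simp add: C_def)
    qed
    thus "z \<in> C (Suc m)" using z by (simp add: C_def)
  qed
  obtain m0 where m0: "\<And>n. n \<ge> m0 \<Longrightarrow> C n = C m0"
    by (rule accD[of sm C, OF acc_submodules[OF noetherian fin_gen] C mono]) blast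
  have "C m \<subseteq> C m0" for m
  proof (cases "m \<le> m0")
    case True
    thus ?thesis by (rule lift_Suc_mono_le[of C, OF mono])
  next
    case False
    hence "C m = C m0" by (intro m0) simp
    thus ?thesis by (rule equalityD1)
  qed
  thus ?thesis using that[of m0] unfolding C_def by blast
qed

text \<open>By (FC2) the elements of \<open>M\<close> that \<open>x\<close> carries into
  \<open>N\<close> lie in the stable colon \<open>C\<close>. Artin-Rees puts
  \<open>C \<inter> U v\<close> into a product of powers times \<open>C\<close>, and for large
  \<open>v\<close> a factor \<open>PP (\<lambda>_. m0)\<close> splits off, which carries
  \<open>C\<close> into \<open>N\<close>.\<close>

lemma rel_FC_kernel:
  assumes N: "sm N" and FC: "rel_FC N i x"
  shows "for_all_large d (\<lambda>v. \<forall>z\<in>U v \<uplus> N. x \<bullet> z \<in> N \<longrightarrow> z \<in> N)"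
proof -
  have xR: "x \<in> carrier R" using rel_FC_mem[OF FC] by blast
  obtain m0 where m0: "\<And>z m. z \<in> carrier M \<Longrightarrow> \<forall>a\<in>PP (\<lambda>_. m). a \<bullet> z \<in> N \<Longrightarrow>
    \<forall>a\<in>PP (\<lambda>_. m0). a \<bullet> z \<in> N"
    by (rule torsion_bound[OF N]) blast
  define C where "C = {z \<in> carrier M. \<forall>a\<in>PP (\<lambda>_. m0). a \<bullet> z \<in> N}"
  have C: "sm C" unfolding C_def by (rule sm_colon[OF PP_ideal N])
  obtain D where D: "\<And>v. C \<inter> U v \<subseteq> pw (\<lambda>k. v k - min (v k) D) C" using artin_rees[OF C] by blast
  show ?thesis
  proof (rule for_all_largeI[of _ "D + m0"], intro ballI impI)
    fix v z assume v: "\<And>k. k \<le> d \<Longrightarrow> D + m0 \<le> v k" and z: "z \<in> U v \<uplus> N" and xz: "x \<bullet> z \<in> N"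
    obtain u n where u: "u \<in> U v" "n \<in> N" "z = u \<oplus>\<^sub>M n" using z unfolding mem_ssum by blast
    have car: "u \<in> carrier M" "n \<in> carrier M" using u sm_mem[OF sm_U] sm_mem[OF N] by auto
    have "x \<bullet> z = x \<bullet> u \<oplus>\<^sub>M x \<bullet> n" using u(3) car xR by (simp add: smult_r_distr)
    hence "x \<bullet> u \<in> N" using sm_add_cancel_right[OF N sm_smult[OF N xR u(2)]] xz car xR by simp
    then obtain m where "\<forall>a\<in>PP (\<lambda>_. m). a \<bullet> u \<in> N" using FC car(1) unfolding rel_FC_def by blast
    hence "u \<in> C" using m0[OF car(1), of m] car(1) unfolding C_def by blast
    hence "u \<in> pw (\<lambda>k. v k - min (v k) D) C" using D u(1) by blast
    also have "\<dots> = pw (\<lambda>k. (v k - min (v k) D - m0) + m0) C" by (rule pw_cong) (use v in fastforce)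
    also have "\<dots> = pw (\<lambda>k. v k - min (v k) D - m0) (pw (\<lambda>_. m0) C)" by (rule pw_pw[OF C, symmetric])
    also have "\<dots> \<subseteq> pw (\<lambda>k. v k - min (v k) D - m0) N"
      by (rule pw_mono, rule ideal_smult_least[OF N]) (simp add: C_def)
    also have "\<dots> \<subseteq> N" by (rule pw_le[OF N])
    finally show "z \<in> N" using u sm_add[OF N] by simp
  qed
qed

text \<open>For large \<open>v\<close>, multiplication by \<open>x\<close> embeds the graded piece
  of \<open>M/N\<close> in degree \<open>v - e_i\<close> into the piece in degree \<open>v\<close>,
  and the cokernel is the piece of the quotient by \<open>x\<close>. Injectivity and image come from
  \<open>rel_FC_kernel\<close> together with (FC1) at \<open>v\<close> and at
  \<open>v + e_0\<close>.\<close>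

theorem rel_P_diff:
  assumes N: "sm N" and FC: "rel_FC N i x" and P: "rel_P N Q"
  shows "rel_P (elem_smult M x (carrier M) \<uplus> N) (backward_diff i Q)"
  unfolding rel_P_def
proof -
  have i: "i \<le> d" and xK: "x \<in> K i" and xR: "x \<in> carrier R" using rel_FC_mem[OF FC] by auto
  let ?N = "elem_smult M x (carrier M) \<uplus> N"
  let ?L = "\<lambda>v. \<exists>l. has_length (U (inc 0 v) \<uplus> N) (U v \<uplus> N) l \<and> Q (\<lambda>i. int (v i)) = int l"
  let ?F = "\<lambda>v. ?N \<inter> (U v \<uplus> N) = elem_smult M x (U (lower i v)) \<uplus> N"
  let ?Z = "\<lambda>v. \<forall>z\<in>U v \<uplus> N. x \<bullet> z \<in> N \<longrightarrow> z \<in> N"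
  have smxM: "sm (elem_smult M x (carrier M))" by (rule sm_elem_smult[OF xR sm_carrier_whole])
  have smN: "sm ?N" by (rule sm_ssum[OF smxM N])
  have NN: "N \<subseteq> ?N" by (rule ssum_ub2[OF smxM sm_carrier[OF N]])
  have F: "for_all_large d ?F" using FC by (simp add: rel_FC_def)
  have Finc: "for_all_large d (\<lambda>v. ?F (inc 0 v))"
  proof (rule for_all_large_comp[OF F])
    show "for_all_large d (\<lambda>v. \<forall>k\<le>d. B \<le> inc 0 v k)" for B
      by (rule for_all_largeI[of _ B]) (auto intro: le_SucI)
  qed
  have L: "for_all_large d ?L" using P by (simp add: rel_P_def)
  have Z: "for_all_large d ?Z" by (rule rel_FC_kernel[OF N FC])
  show "for_all_large d (\<lambda>v. \<exists>l. has_length (U (inc 0 v) \<uplus> ?N) (U v \<uplus> ?N) l \<and>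
     backward_diff i Q (\<lambda>i. int (v i)) = int l)"
  proof (rule for_all_large_mono[OF for_all_large_conj[OF for_all_large_conj[OF F Finc]
        for_all_large_conj[OF for_all_large_conj[OF L for_all_large_lower[OF L, of i]]
          for_all_large_conj[OF for_all_large_lower[OF Z, of i] for_all_large_ge[of d 1]]]]], elim conjE)
    fix v
    assume F1: "?F v" and F2: "?F (inc 0 v)" and L1: "?L v" and L2: "?L (lower i v)" and Z: "?Z (lower i v)"
      and "\<forall>k\<le>d. 1 \<le> v k"
    hence vi: "0 < v i" using i by fastforce
    define X where "X = U v \<uplus> N"
    define Y where "Y = U (inc 0 v) \<uplus> N"
    define X' where "X' = U (lower i v) \<uplus> N"
    define Y' where "Y' = U (inc 0 (lower i v)) \<uplus> N"
    have sm: "sm X" "sm Y" "sm X'" "sm Y'" unfolding X_def Y_def X'_def Y'_def by (intro sm_ssum sm_U N)+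
    have Nsub: "N \<subseteq> X" "N \<subseteq> Y" "N \<subseteq> X'" "N \<subseteq> Y'"
      unfolding X_def Y_def X'_def Y'_def by (rule ssum_ub2[OF sm_U sm_carrier[OF N]])+
    have lo: "lower i (inc 0 v) = inc 0 (lower i v)" using vi by (auto simp: lower_def)
    have YX: "Y \<subseteq> X" unfolding X_def Y_def by (rule ssum_mono[OF U_antimono order_refl]) simp
    have YX': "Y' \<subseteq> X'" unfolding X'_def Y'_def by (rule ssum_mono[OF U_antimono order_refl]) simp
    have absorb: "elem_smult M x (U w \<uplus> N) \<uplus> N = elem_smult M x (U w) \<uplus> N" for w
    proof
      have s: "sm (elem_smult M x (U w) \<uplus> N)" by (intro sm_ssum sm_elem_smult xR sm_U N)
      have n: "N \<subseteq> elem_smult M x (U w) \<uplus> N" by (rule ssum_ub2[OF sm_elem_smult[OF xR sm_U] sm_carrier[OF N]])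
      have "elem_smult M x (U w \<uplus> N) \<subseteq> elem_smult M x (U w) \<uplus> N"
      proof
        fix t assume "t \<in> elem_smult M x (U w \<uplus> N)"
        then obtain s where s: "s \<in> U w \<uplus> N" "t = x \<bullet> s" by (auto simp: elem_smult_def)
        then obtain u n where "u \<in> U w" "n \<in> N" "s = u \<oplus>\<^sub>M n" unfolding mem_ssum by blast
        hence un: "u \<in> U w" "n \<in> N" "t = x \<bullet> (u \<oplus>\<^sub>M n)" using s(2) by auto
        hence "t = x \<bullet> u \<oplus>\<^sub>M x \<bullet> n" using xR sm_mem[OF sm_U] sm_mem[OF N] by (simp add: smult_r_distr)
        thus "t \<in> elem_smult M x (U w) \<uplus> N" using un sm_smult[OF N xR] by (simp add: ssumI elem_smult_incl)
      qed
      thus "elem_smult M x (U w \<uplus> N) \<uplus> N \<subseteq> elem_smult M x (U w) \<uplus> N" by (rule ssum_least[OF s _ n])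
      show "elem_smult M x (U w) \<uplus> N \<subseteq> elem_smult M x (U w \<uplus> N) \<uplus> N"
        by (rule ssum_mono[OF elem_smult_mono[OF ssum_ub1[OF U_carrier N]] order_refl])
    qed
    \<comment> \<open>The image of the piece in degree \<open>v - e_i\<close>:
      \<open>W/(W \<inter> Y)\<close> has its length \<open>b\<close>, and \<open>X/(W + Y)\<close>
      is the piece of the new quotient.\<close>
    define W where "W = elem_smult M x X' \<uplus> N"
    have W: "sm W" unfolding W_def by (intro sm_ssum sm_elem_smult xR sm N)
    have W1: "?N \<inter> X = W" using F1 absorb unfolding W_def X_def X'_def by simp
    have W2: "?N \<inter> Y = elem_smult M x Y' \<uplus> N" using F2 absorb lo unfolding Y_def Y'_def by simp
    have WY: "W \<inter> Y = elem_smult M x Y' \<uplus> N" using W1 W2 YX by blast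
    obtain a where a: "has_length Y X a" "Q (\<lambda>i. int (v i)) = int a" using L1 unfolding X_def Y_def by blast
    obtain b where b: "has_length Y' X' b" "Q (\<lambda>k. int (lower i v k)) = int b" using L2 unfolding X'_def Y'_def by blast
    have "has_length (W \<inter> Y) W b" unfolding WY unfolding W_def
    proof (rule has_length_elem_smult[OF xR N sm(4) Nsub(4) b(1)])
      show "z \<in> Y'" if "z \<in> X'" "x \<bullet> z \<in> N" for z using that Z Nsub(4) unfolding X'_def by blast
    qed
    hence hb: "has_length Y (W \<uplus> Y) b" by (rule has_length_second_iso[OF W sm(2)])
    have YW: "sm (W \<uplus> Y)" by (rule sm_ssum[OF W sm(2)])
    have WX: "W \<subseteq> X" using W1 by blast
    obtain b' c where bc: "has_length Y (W \<uplus> Y) b'" "has_length (W \<uplus> Y) X c" "a = b' + c"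
      by (rule has_length_split[OF a(1) YW ssum_ub2[OF W sm_carrier[OF sm(2)]] ssum_least[OF sm(1) WX YX]])
    have ac: "a = b + c" using bc has_length_unique[OF hb bc(1)] by simp
    have YN: "sm (Y \<uplus> ?N)" by (rule sm_ssum[OF sm(2) smN])
    have "X \<inter> (Y \<uplus> ?N) = Y \<uplus> (X \<inter> ?N)" by (rule sm_modular[OF sm(1) smN YX sm_carrier[OF sm(2)]])
    also have "X \<inter> ?N = W" using W1 by blast
    also have "Y \<uplus> W = W \<uplus> Y" by (rule ssum_commute[OF sm(2) W])
    finally have "has_length (X \<inter> (Y \<uplus> ?N)) X c" using bc(2) by simp
    hence "has_length (Y \<uplus> ?N) (X \<uplus> (Y \<uplus> ?N)) c" by (rule has_length_second_iso[OF sm(1) YN])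
    moreover have "X \<uplus> (Y \<uplus> ?N) = X \<uplus> ?N"
      using ssum_assoc[OF sm(1) sm(2) smN] ssum_absorb1[OF sm(1,2) YX] by simp
    moreover have "U w \<uplus> N \<uplus> ?N = U w \<uplus> ?N" for w
      using ssum_assoc[OF sm_U N smN, of w] ssum_absorb1[OF smN N NN] ssum_commute[OF N smN] by simp
    ultimately have "has_length (U (inc 0 v) \<uplus> ?N) (U v \<uplus> ?N) c" unfolding X_def Y_def by simp
    moreover have "backward_diff i Q (\<lambda>i. int (v i)) = int c"
    proof -
      have "(\<lambda>k. int (lower i v k)) = (\<lambda>k. int (v k))(i := int (v i) - 1)"
        using vi by (auto simp: lower_def fun_eq_iff of_nat_diff)
      hence "Q ((\<lambda>k. int (v k))(i := int (v i) - 1)) = int b" using b(2) by simp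
      thus ?thesis using a(2) ac by (simp add: backward_diff_def)
    qed
    ultimately show "\<exists>l. has_length (U (inc 0 v) \<uplus> ?N) (U v \<uplus> ?N) l \<and>
     backward_diff i Q (\<lambda>i. int (v i)) = int l" by blast
  qed
qed

lemma rel_P_nfold:
  "rel_FC_seq s N \<Longrightarrow> sm N \<Longrightarrow> rel_P N Q \<Longrightarrow> rel_P (nfold s N) (fold (\<lambda>p. backward_diff (snd p)) s Q)"
proof (induct s arbitrary: N Q)
  case (Cons p s)
  have FC: "rel_FC N (snd p) (fst p)" using Cons(2) by simp
  have "sm (elem_smult M (fst p) (carrier M) \<uplus> N)" using sm_xM[OF _ Cons(3)] rel_FC_mem[OF FC] by blast
  thus ?case using Cons(1)[OF _ _ rel_P_diff[OF Cons(3) FC Cons(4)]] Cons(2) by simp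
qed simp

end

context local_power_family
begin

text \<open>\<open>y\<close> is chosen outside all the ideals to be avoided, whereas
  \<open>x\<close> may lie in them; each ideal then excludes at most one parameter.\<close>

lemma generic_on_line:
  assumes N: "sm N" and i: "i \<le> d" and x: "x \<in> K i"
    and T: "T \<subseteq> carrier R" "\<And>s t. s \<in> T \<Longrightarrow> t \<in> T \<Longrightarrow> s \<noteq> t \<Longrightarrow> s \<ominus> t \<in> Units R"
  obtains y where "y \<in> K i" "finite {t \<in> T. \<not> rel_FC N i (x \<oplus> t \<otimes> y)}"
proof -
  obtain \<W> where W: "finite \<W>" "\<And>W. W \<in> \<W> \<Longrightarrow> ideal W R \<and> W \<subset> K i"
    "\<And>x. x \<in> K i - \<Union>\<W> \<Longrightarrow> rel_FC N i x"
    by (rule generic_rel_FC[OF N i]) blast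
  obtain y where y: "y \<in> K i" "y \<notin> \<Union>\<W>" using ideal_avoidance[OF K_ideal[OF i] W(1,2)] by blast
  have "finite {t \<in> T. x \<oplus> t \<otimes> y \<in> \<Union>\<W>}"
  proof (rule line_finite_Union[OF T W(1) _ K_mem[OF i x] K_mem[OF i y(1)] y(2)])
    show "ideal W R" if "W \<in> \<W>" for W using W(2)[OF that] by simp
  qed
  moreover have "x \<oplus> t \<otimes> y \<in> K i" if "t \<in> T" for t
  proof -
    have "t \<otimes> y \<in> K i" using that T(1) by (intro ideal.I_l_closed[OF K_ideal[OF i] y(1)]) blast
    thus ?thesis by (rule additive_subgroup.a_closed[OF ideal.axioms(1)[OF K_ideal[OF i]] x])
  qed
  ultimately have "finite {t \<in> T. \<not> rel_FC N i (x \<oplus> t \<otimes> y)}"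
    using W(3) by (elim finite_subset[rotated]) blast
  thus ?thesis using that y by blast
qed

lemma rel_FC_exists:
  assumes "sm N" "i \<le> d" obtains x where "rel_FC N i x"
proof -
  obtain \<W> where W: "finite \<W>" "\<And>W. W \<in> \<W> \<Longrightarrow> ideal W R \<and> W \<subset> K i"
    "\<And>x. x \<in> K i - \<Union>\<W> \<Longrightarrow> rel_FC N i x"
    by (rule generic_rel_FC[OF assms]) blast
  obtain y where "y \<in> K i" "y \<notin> \<Union>\<W>" using ideal_avoidance[OF K_ideal[OF assms(2)] W(1,2)] by blast
  thus ?thesis using W(3) that by blast
qed

lemma FC_seq_exists:
  assumes "sm N" "\<forall>i\<in>set is. i \<le> d"
  shows "\<exists>s. map snd s = is \<and> rel_FC_seq s N"
  using assms
proof (induct "is" arbitrary: N)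
  case (Cons i "is")
  obtain x where x: "rel_FC N i x" by (rule rel_FC_exists[of N i]) (use Cons(2,3) in auto)
  have "sm (elem_smult M x (carrier M) \<uplus> N)" using sm_xM[OF _ Cons(2)] rel_FC_mem[OF x] by blast
  then obtain s where "map snd s = is" "rel_FC_seq s (elem_smult M x (carrier M) \<uplus> N)"
    using Cons(1) Cons(3) by (metis list.set_intros(2))
  hence "map snd ((x, i) # s) = i # is \<and> rel_FC_seq ((x, i) # s) N" using x by simp
  thus ?case by (rule exI)
qed simp

text \<open>\<open>x\<close> is moved along a line to \<open>y = x + t y0\<close>. All but finitely
  many \<open>t\<close> give a weak-(FC)-element, and all but finitely many keep the reduction
  inclusion in one fixed degree by \<open>surjective_open\<close>; \<open>rel_JR_one\<close> passes
  from this degree to all large ones.\<close>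

lemma rel_JR_step:
  assumes N: "sm N" and P: "rel_P N Q" and JR: "rel_JR ((x, i) # s) N"
  obtains y where "rel_FC N i y" "rel_JR s (elem_smult M y (carrier M) \<uplus> N)"
proof -
  obtain T where T: "infinite T" "T \<subseteq> carrier R" "\<And>s t. s \<in> T \<Longrightarrow> t \<in> T \<Longrightarrow> s \<noteq> t \<Longrightarrow> s \<ominus> t \<in> Units R"
    by (rule residue_representatives) blast
  have s: "seq_in s" and i: "i \<le> d" and xK: "x \<in> K i"
    using JR by (auto simp: rel_JR_def seq_in_Cons)
  have xR: "x \<in> carrier R" by (rule K_mem[OF i xK])
  have J: "for_all_large d (\<lambda>v. U v \<subseteq> jsum ((x, i) # s) v \<uplus> N)"
    and L: "for_all_large d (\<lambda>v. \<exists>l. has_length (U (inc 0 v) \<uplus> N) (U v \<uplus> N) l \<and> Q (\<lambda>i. int (v i)) = int l)"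
    using JR P by (auto simp: rel_JR_def rel_P_def)
  \<comment> \<open>A single degree in which the inclusion holds and the graded piece has finite
    length. With infinitely many degrees the excluded parameters could exhaust
    \<open>T\<close>.\<close>
  obtain v where v: "U v \<subseteq> jsum ((x, i) # s) v \<uplus> N \<and>
      (\<exists>l. has_length (U (inc 0 v) \<uplus> N) (U v \<uplus> N) l \<and> Q (\<lambda>i. int (v i)) = int l)"
    and v1: "\<And>k. k \<le> d \<Longrightarrow> 1 \<le> v k"
    by (rule for_all_large_obtain[OF for_all_large_conj[OF J L], of 1]) blast
  obtain l where l: "has_length (U (inc 0 v) \<uplus> N) (U v \<uplus> N) l" using v by blast
  have vi: "0 < v i" using v1[OF i] by simp
  define L where "L = U (lower i v)"
  define S where "S = jsum s v \<uplus> N"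
  define X where "X = U v \<uplus> N"
  have smL: "sm L" and smS: "sm S" and smX: "sm X"
    unfolding L_def S_def X_def by (intro sm_U sm_ssum sm_jsum[OF s] N)+
  have UX: "U v \<subseteq> X" and NS: "N \<subseteq> S" and NX: "N \<subseteq> X"
    unfolding X_def S_def using ssum_ub1[OF U_carrier N] ssum_ub2[OF sm_jsum[OF s] sm_carrier[OF N]]
      ssum_ub2[OF sm_U sm_carrier[OF N]] by blast+
  obtain y0 where y0: "y0 \<in> K i" "finite {t \<in> T. \<not> rel_FC N i (x \<oplus> t \<otimes> y0)}"
    by (rule generic_on_line[OF N i xK T(2,3)]) blast
  have y0R: "y0 \<in> carrier R" by (rule K_mem[OF i y0(1)])
  have "finite {t \<in> T. \<not> X \<subseteq> elem_smult M (x \<oplus> t \<otimes> y0) L \<uplus> S}"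
  proof (rule surjective_open[OF T(2,3) smL smS smX xR y0R _ _ _ l[folded X_def]])
    show "elem_smult M x L \<subseteq> X" "elem_smult M y0 L \<subseteq> X"
      using elem_U_lower[where v = v, OF i xK vi] elem_U_lower[where v = v, OF i y0(1) vi] UX unfolding L_def by blast+
    have smx: "sm (elem_smult M x L)" by (rule sm_elem_smult[OF xR smL])
    have "U v \<subseteq> elem_smult M x L \<uplus> S"
      using v ssum_assoc[OF smx sm_jsum[OF s] N, of v] unfolding L_def S_def by simp
    moreover have "N \<subseteq> elem_smult M x L \<uplus> S" using NS ssum_ub2[OF smx sm_carrier[OF smS]] by blast
    ultimately show "X \<subseteq> elem_smult M x L \<uplus> S" unfolding X_def by (rule ssum_least[OF sm_ssum[OF smx smS]])
    have K0: "ideal (K 0) R" by (rule K_ideal) simp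
    have "U (inc 0 v) \<subseteq> ideal_smult M (K 0) X" unfolding U_inc[OF le0] by (rule ideal_smult_mono[OF order_refl UX])
    thus "U (inc 0 v) \<uplus> N \<subseteq> ideal_smult M (K 0) X \<uplus> S" by (rule ssum_mono[OF _ NS])
  qed
  hence "finite ({t \<in> T. \<not> rel_FC N i (x \<oplus> t \<otimes> y0)} \<union> {t \<in> T. \<not> X \<subseteq> elem_smult M (x \<oplus> t \<otimes> y0) L \<uplus> S})"
    using y0(2) by simp
  from infinite_imp_nonempty[OF Diff_infinite_finite[OF this T(1)]]
  obtain t where t: "t \<in> T" "rel_FC N i (x \<oplus> t \<otimes> y0)" "X \<subseteq> elem_smult M (x \<oplus> t \<otimes> y0) L \<uplus> S"
    by blast
  define y where "y = x \<oplus> t \<otimes> y0"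
  have yR: "y \<in> carrier R" using rel_FC_mem[OF t(2)] by (simp add: y_def)
  let ?N = "elem_smult M y (carrier M) \<uplus> N"
  have smN: "sm ?N" by (rule sm_xM[OF yR N])
  have NN: "N \<subseteq> ?N" by (rule ssum_ub2[OF sm_elem_smult[OF yR sm_carrier_whole] sm_carrier[OF N]])
  have J: "sm (jsum s v \<uplus> ?N)" by (rule sm_ssum[OF sm_jsum[OF s] smN])
  have "elem_smult M y L \<subseteq> elem_smult M y (carrier M)" by (rule elem_smult_mono[OF sm_carrier[OF smL]])
  also have "\<dots> \<subseteq> ?N" by (rule ssum_ub1[OF sm_carrier[OF sm_elem_smult[OF yR sm_carrier_whole]] N])
  also have "\<dots> \<subseteq> jsum s v \<uplus> ?N" by (rule ssum_ub2[OF sm_jsum[OF s] sm_carrier[OF smN]])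
  finally have "elem_smult M y L \<uplus> S \<subseteq> jsum s v \<uplus> ?N"
    unfolding S_def by (rule ssum_least[OF J _ ssum_mono[OF order_refl NN]])
  hence "U v \<subseteq> jsum s v \<uplus> ?N" using t(3) UX unfolding y_def by blast
  moreover have "\<forall>k\<le>d. 0 < v k" using v1 by fastforce
  ultimately have "rel_JR s ?N" using rel_JR_one[OF s smN] by blast
  thus ?thesis using that t(2) unfolding y_def by blast
qed

lemma rel_JR_imp_FC_seq:
  assumes "sm N" "rel_P N Q" "rel_JR s N"
  shows "\<exists>s'. map snd s' = map snd s \<and> rel_FC_seq s' N \<and> for_all_large d (\<lambda>v. U v \<subseteq> nfold s' N)"
  using assms
proof (induct s arbitrary: N Q)
  case Nil
  have "{\<zero>\<^sub>M} \<uplus> N \<subseteq> N" by (rule ssum_least[OF Nil(1)]) (use sm_zero[OF Nil(1)] in auto)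
  hence "for_all_large d (\<lambda>v. U v \<subseteq> N)" using Nil(3) unfolding rel_JR_def by (auto elim!: for_all_large_mono)
  thus ?case by simp
next
  case (Cons p s)
  obtain x i where p: "p = (x, i)" by (cases p)
  obtain y where y: "rel_FC N i y" "rel_JR s (elem_smult M y (carrier M) \<uplus> N)"
    using rel_JR_step[OF Cons(2,3)] Cons(4) unfolding p by blast
  have smN: "sm (elem_smult M y (carrier M) \<uplus> N)" using sm_xM[OF _ Cons(2)] rel_FC_mem[OF y(1)] by blast
  obtain s' where s': "map snd s' = map snd s" "rel_FC_seq s' (elem_smult M y (carrier M) \<uplus> N)"
    "for_all_large d (\<lambda>v. U v \<subseteq> nfold s' (elem_smult M y (carrier M) \<uplus> N))"
    using Cons(1)[OF smN rel_P_diff[OF Cons(2) y(1) Cons(3)] y(2)] by blast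
  show ?case by (rule exI[of _ "(y, i) # s'"]) (use s' y p in simp)
qed

text \<open>Length zero means \<open>U v + N = U (v + e_0) + N\<close>. Since
  \<open>U (v + e_0)\<close> is \<open>K 0\<close> times \<open>U v\<close> and \<open>K 0\<close>
  lies in the maximal ideal, Nakayama's lemma gives \<open>U v \<subseteq> N\<close>.\<close>

lemma rel_P_zero_iff:
  assumes N: "sm N" and P: "rel_P N Q"
  shows "for_all_large d (\<lambda>v. U v \<subseteq> N) \<longleftrightarrow> for_all_large d (\<lambda>v. Q (\<lambda>i. int (v i)) = 0)"
proof
  note P = P[unfolded rel_P_def]
  have sm: "sm (U v \<uplus> N)" for v by (rule sm_ssum[OF sm_U N])
  have NU: "N \<subseteq> U v \<uplus> N" for v by (rule ssum_ub2[OF sm_U sm_carrier[OF N]])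
  have UU: "U v \<subseteq> U v \<uplus> N" for v by (rule ssum_ub1[OF U_carrier N])
  { assume a: "for_all_large d (\<lambda>v. U v \<subseteq> N)"
    show "for_all_large d (\<lambda>v. Q (\<lambda>i. int (v i)) = 0)"
    proof (rule for_all_large_mono[OF for_all_large_conj[OF P a]], elim conjE exE)
      fix v l assume l: "has_length (U (inc 0 v) \<uplus> N) (U v \<uplus> N) l" "Q (\<lambda>i. int (v i)) = int l" and "U v \<subseteq> N"
      hence "U v \<uplus> N \<subseteq> N" by (intro ssum_least[OF N]) auto
      hence "U v \<uplus> N = U (inc 0 v) \<uplus> N" using NU[of "inc 0 v"] has_length_sm[OF l(1)] by blast
      hence "has_length (U (inc 0 v) \<uplus> N) (U v \<uplus> N) 0" using has_length_0_iff[OF sm sm] by simp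
      thus "Q (\<lambda>i. int (v i)) = 0" using l has_length_unique by fastforce
    qed }
  assume a: "for_all_large d (\<lambda>v. Q (\<lambda>i. int (v i)) = 0)"
  show "for_all_large d (\<lambda>v. U v \<subseteq> N)"
  proof (rule for_all_large_mono[OF for_all_large_conj[OF P a]], elim conjE exE)
    fix v l assume l: "has_length (U (inc 0 v) \<uplus> N) (U v \<uplus> N) l" "Q (\<lambda>i. int (v i)) = int l"
      and "Q (\<lambda>i. int (v i)) = 0"
    hence "has_length (U (inc 0 v) \<uplus> N) (U v \<uplus> N) 0" by simp
    hence e: "U v \<uplus> N = U (inc 0 v) \<uplus> N" using has_length_0_iff[OF sm sm] has_length_sm by blast
    have K0: "ideal (K 0) R" by (rule K_ideal) simp
    have "U (inc 0 v) \<subseteq> ideal_smult M (K 0) (U v \<uplus> N)"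
      unfolding U_inc[OF le0] by (rule ideal_smult_mono[OF order_refl UU])
    hence "U v \<uplus> N \<subseteq> N \<uplus> ideal_smult M (K 0) (U v \<uplus> N)"
      unfolding e using ssum_commute[OF N sm_ideal_smult[OF K0 sm_carrier[OF sm]], of v] e
      by (metis order_refl ssum_mono)
    hence "U v \<uplus> N = N" by (rule nakayama[OF N sm NU])
    thus "U v \<subseteq> N" using UU by blast
  qed
qed

text \<open>If the Hilbert function does not grow in the direction of the ideal contained in the maximal
  ideal, the modules \<open>U v\<close> have dimension at most one modulo \<open>N\<close>, and by the Artin-Rees lemma the
  multiplicity of a submodule cannot be larger.\<close>

theorem no_growth:
  assumes N: "sm N" and j: "j \<le> d" and c: "0 < c"
    and L: "for_all_large d (\<lambda>v. has_length (U (inc 0 v) \<uplus> N) (U v \<uplus> N) (g v))"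
    and g0: "for_all_large d (\<lambda>v. g (inc 0 v) = g v)"
    and gj: "for_all_large d (\<lambda>v. g (inc j v) = g v + (c::nat))"
  shows False
proof -
  obtain B where B: "\<And>v. \<forall>k\<le>d. B \<le> v k \<Longrightarrow> has_length (U (inc 0 v) \<uplus> N) (U v \<uplus> N) (g v) \<and>
      g (inc 0 v) = g v \<and> g (inc j v) = g v + c"
    using for_all_large_conj[OF L for_all_large_conj[OF g0 gj]] unfolding for_all_large_def by blast
  have sm: "sm (U v \<uplus> N)" for v by (rule sm_ssum[OF sm_U N])
  have mono: "U w \<uplus> N \<subseteq> U v \<uplus> N" if "\<And>k. k \<le> d \<Longrightarrow> v k \<le> w k" for v w
    by (rule ssum_mono[OF U_antimono[OF that] order_refl])
  \<comment> \<open>All steps in direction 0 have the same length \<open>g v\<close>, so the length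
    of \<open>m\<close> of them is linear in \<open>m\<close>.\<close>
  have mult: "has_length (U (shift 0 m v) \<uplus> N) (U v \<uplus> N) (m * g v) \<and> g (shift 0 m v) = g v"
    if v: "\<forall>k\<le>d. B \<le> v k" for v m
  proof (induct m)
    case 0
    show ?case using has_length_0_iff[OF sm sm order_refl, of v] by (simp add: fun_upd_idem)
  next
    case (Suc m)
    have e: "inc 0 (shift 0 m v) = shift 0 (Suc m) v" by auto
    have "\<forall>k\<le>d. B \<le> shift 0 m v k" using v by auto
    from B[OF this] have h: "has_length (U (shift 0 (Suc m) v) \<uplus> N) (U (shift 0 m v) \<uplus> N) (g (shift 0 m v))"
      "g (shift 0 (Suc m) v) = g (shift 0 m v)" unfolding e by blast+
    show ?case using has_length_add[OF sm h(1) conjunct1[OF Suc]] by (simp only: h(2) conjunct2[OF Suc] mult_Suc)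
  qed
  define v where "v = (\<lambda>_::nat. B)"
  have v: "\<forall>k\<le>d. B \<le> v k" "\<forall>k\<le>d. B \<le> inc j v k" by (auto simp: v_def)
  have gj: "g (inc j v) = g v + c" using B[OF v(1)] by blast
  define N' where "N' = U (inc j v) \<uplus> N"
  have N': "sm N'" unfolding N'_def by (rule sm)
  have NN': "N \<subseteq> N'" unfolding N'_def by (rule ssum_ub2[OF sm_U sm_carrier[OF N]])
  obtain D where D: "\<And>w. N' \<inter> U w \<subseteq> pw (\<lambda>k. w k - min (w k) D) N'" using artin_rees[OF N'] by blast
  \<comment> \<open>Chosen so that \<open>k * c\<close> exceeds \<open>D * g v\<close>, the most
    that the Artin-Rees shift by \<open>D\<close> can account for.\<close>
  define k where "k = D * g v + 1"
  define m where "m = k + D"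
  let ?Y = "U (shift 0 m v) \<uplus> N"
  let ?A = "U (shift 0 k (inc j v)) \<uplus> N"
  \<comment> \<open>The filtration that \<open>N'\<close> inherits from \<open>U v + N\<close> and
    its own filtration differ by a shift of at most \<open>D\<close>.\<close>
  have sub: "N' \<inter> ?Y \<subseteq> ?A"
  proof
    fix z assume z: "z \<in> N' \<inter> ?Y"
    hence "z \<in> ?Y" by blast
    then obtain u n where un: "u \<in> U (shift 0 m v)" "n \<in> N" "z = u \<oplus>\<^sub>M n" unfolding mem_ssum by blast
    have "u \<in> N'"
      using sm_add_cancel_right[OF N' subsetD[OF NN' un(2)] sm_mem[OF sm_U un(1)]] z un(3) by blast
    hence "u \<in> pw (\<lambda>k. shift 0 m v k - min (shift 0 m v k) D) N'" using D un(1) by blast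
    also have "\<dots> = pw (\<lambda>k. shift 0 m v k - min (shift 0 m v k) D) (U (inc j v)) \<uplus>
        pw (\<lambda>k. shift 0 m v k - min (shift 0 m v k) D) N"
      unfolding N'_def by (rule pw_ssum[OF sm_U N])
    also have "\<dots> \<subseteq> U (\<lambda>k. (shift 0 m v k - min (shift 0 m v k) D) + inc j v k) \<uplus> N"
      unfolding pw_U by (rule ssum_mono[OF order_refl pw_le[OF N]])
    also have "\<dots> \<subseteq> ?A" by (rule mono) (auto simp: m_def)
    finally have "u \<in> ?A" .
    moreover have "n \<in> ?A" using un(2) ssum_ub2[OF sm_U sm_carrier[OF N]] by blast
    ultimately show "z \<in> ?A" using sm_add[OF sm] un(3) by blast
  qed
  have YX: "?Y \<subseteq> U v \<uplus> N" by (rule mono) auto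
  have NX: "N' \<subseteq> U v \<uplus> N" unfolding N'_def by (rule mono) auto
  have "U (shift 0 m (inc j v)) \<uplus> N \<subseteq> N' \<inter> ?Y"
    unfolding N'_def by (intro Int_greatest mono) auto
  then obtain p where p: "has_length (N' \<inter> ?Y) N' p"
    using has_length_split[OF conjunct1[OF mult[OF v(2), of m]] sm_Int[OF N' sm]] unfolding N'_def by blast
  \<comment> \<open>The length \<open>p\<close> of \<open>N'/(N' \<inter> ?Y)\<close> is at least
    that of \<open>k\<close> steps of the filtration of \<open>N'\<close>; in turn it is at most
    that of \<open>m\<close> steps starting at \<open>v\<close>.\<close>
  have "chn (k * g (inc j v)) ?A N'" using mult[OF v(2), of k] unfolding has_length_def N'_def by blast
  hence "chn (k * g (inc j v)) (N' \<inter> ?Y) N'" by (rule chn_bot_mono[OF _ sub])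
  hence kp: "k * g (inc j v) \<le> p" using p unfolding has_length_def by blast
  have "has_length ?Y (N' \<uplus> ?Y) p" by (rule has_length_second_iso[OF N' sm p])
  moreover obtain a b where "has_length ?Y (N' \<uplus> ?Y) a" "m * g v = a + b"
    by (rule has_length_split[OF conjunct1[OF mult[OF v(1), of m]] sm_ssum[OF N' sm]
          ssum_ub2[OF N' sm_carrier[OF sm]] ssum_least[OF sm NX YX]])
  ultimately have "p \<le> m * g v" using has_length_unique by fastforce
  hence "k * (g v + c) \<le> (k + D) * g v" using kp gj unfolding m_def by simp
  hence "k * c \<le> D * g v" by (simp add: algebra_simps)
  moreover have "k \<le> k * c" using c by simp
  ultimately show False by (simp add: k_def)
qed

end

section \<open>Passage to quotient modules\<close>

context module
begin

context
  fixes N assumes N: "sm N"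
begin

lemma N_subgroup: "abelian_subgroup N M"
  using N by (simp add: abelian_subgroupI3 additive_subgroup_def submodule.axioms(1) M.abelian_group_axioms)

abbreviation quo :: "('a, 'c set) module" where "quo \<equiv> factor_module M N"

definition img :: "'c set \<Rightarrow> 'c set set" where "img S = (\<lambda>x. N +>\<^bsub>M\<^esub> x) ` S"

definition pre :: "'c set set \<Rightarrow> 'c set" where "pre S = {x \<in> carrier M. N +>\<^bsub>M\<^esub> x \<in> S}"

lemma quo_carrier: "carrier quo = img (carrier M)"
  by (auto simp: factor_module_def A_RCOSETS_def' img_def)

lemma quo_zero: "\<zero>\<^bsub>quo\<^esub> = N"
  by (simp add: factor_module_def)

lemma coset_zero: "N +>\<^bsub>M\<^esub> \<zero>\<^bsub>M\<^esub> = N"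
  using sm_carrier[OF N] by simp

lemma quo_add: "x \<in> carrier M \<Longrightarrow> y \<in> carrier M \<Longrightarrow> (N +>\<^bsub>M\<^esub> x) \<oplus>\<^bsub>quo\<^esub> (N +>\<^bsub>M\<^esub> y) = N +>\<^bsub>M\<^esub> (x \<oplus>\<^bsub>M\<^esub> y)"
  by (simp add: factor_module_def abelian_subgroup.a_rcos_sum[OF N_subgroup])

lemmas quo_smult = factor_module_smult[OF N]

lemma coset_eq_iff:
  assumes "x \<in> carrier M" "y \<in> carrier M"
  shows "N +>\<^bsub>M\<^esub> x = N +>\<^bsub>M\<^esub> y \<longleftrightarrow> x \<ominus>\<^bsub>M\<^esub> y \<in> N"
proof
  assume e: "N +>\<^bsub>M\<^esub> x = N +>\<^bsub>M\<^esub> y"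
  have "x \<in> N +>\<^bsub>M\<^esub> x" by (rule abelian_subgroup.a_rcos_self[OF N_subgroup assms(1)])
  then obtain n where "n \<in> N" "x = n \<oplus>\<^bsub>M\<^esub> y" unfolding e by (auto simp: a_r_coset_def')
  thus "x \<ominus>\<^bsub>M\<^esub> y \<in> N" using assms sm_mem[OF N] by simp
next
  assume "x \<ominus>\<^bsub>M\<^esub> y \<in> N"
  moreover have "x = (x \<ominus>\<^bsub>M\<^esub> y) \<oplus>\<^bsub>M\<^esub> y" using assms by simp
  ultimately have "x \<in> N +>\<^bsub>M\<^esub> y" by (auto simp: a_r_coset_def')
  thus "N +>\<^bsub>M\<^esub> x = N +>\<^bsub>M\<^esub> y"
    using abelian_subgroup.a_repr_independence'[OF N_subgroup _ assms(2)] by simp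
qed

lemma coset_eq_N: "x \<in> carrier M \<Longrightarrow> N +>\<^bsub>M\<^esub> x = N \<longleftrightarrow> x \<in> N"
  using coset_eq_iff[of x "\<zero>\<^bsub>M\<^esub>"] coset_zero diff_add_cancel(3)[of x "\<zero>\<^bsub>M\<^esub>"] by simp

lemma module_quo: "module R quo"
  by (rule factor_module_is_module[OF N])

lemma sm_img:
  assumes S: "sm S" shows "submodule (img S) R quo"
proof (rule module.smI[OF module_quo])
  show "img S \<subseteq> carrier quo" using sm_carrier[OF S] by (auto simp: quo_carrier img_def)
  show "\<zero>\<^bsub>quo\<^esub> \<in> img S" using sm_zero[OF S] coset_zero by (auto simp: quo_zero img_def)
  show "a \<oplus>\<^bsub>quo\<^esub> b \<in> img S" if "a \<in> img S" "b \<in> img S" for a b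
    using that sm_add[OF S] sm_mem[OF S] by (auto simp: img_def quo_add)
  show "a \<odot>\<^bsub>quo\<^esub> x \<in> img S" if "a \<in> carrier R" "x \<in> img S" for a x
    using that sm_smult[OF S] sm_mem[OF S] by (auto simp: img_def quo_smult)
qed

lemma sm_pre:
  assumes S: "submodule S R quo" shows "sm (pre S)" "N \<subseteq> pre S"
proof -
  interpret Q: module R quo by (rule module_quo)
  show "sm (pre S)"
  proof (rule smI)
    show "\<zero>\<^bsub>M\<^esub> \<in> pre S" using Q.sm_zero[OF S] coset_zero by (auto simp: pre_def quo_zero)
    show "a \<oplus>\<^bsub>M\<^esub> b \<in> pre S" if "a \<in> pre S" "b \<in> pre S" for a b
      using that Q.sm_add[OF S] by (auto simp: pre_def quo_add[symmetric])
    show "a \<odot>\<^bsub>M\<^esub> x \<in> pre S" if "a \<in> carrier R" "x \<in> pre S" for a x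
      using that Q.sm_smult[OF S] by (auto simp: pre_def quo_smult[symmetric])
  qed (auto simp: pre_def)
  show "N \<subseteq> pre S"
  proof
    fix x assume x: "x \<in> N"
    hence "x \<in> carrier M" by (rule sm_mem[OF N])
    thus "x \<in> pre S" using Q.sm_zero[OF S] coset_eq_N[of x] x by (simp add: pre_def quo_zero)
  qed
qed

lemma pre_img:
  assumes S: "sm S" shows "pre (img S) = S <+>\<^bsub>M\<^esub> N"
proof
  show "pre (img S) \<subseteq> S <+>\<^bsub>M\<^esub> N"
  proof
    fix x assume "x \<in> pre (img S)"
    then obtain s where s: "x \<in> carrier M" "s \<in> S" "N +>\<^bsub>M\<^esub> x = N +>\<^bsub>M\<^esub> s" by (auto simp: pre_def img_def)
    have sM: "s \<in> carrier M" by (rule sm_mem[OF S s(2)])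
    have "x \<ominus>\<^bsub>M\<^esub> s \<in> N" using s coset_eq_iff[OF s(1) sM] by blast
    moreover have "x = s \<oplus>\<^bsub>M\<^esub> (x \<ominus>\<^bsub>M\<^esub> s)" using s(1) sM by simp
    ultimately show "x \<in> S <+>\<^bsub>M\<^esub> N" using s(2) ssumI by metis
  qed
  have "S \<subseteq> pre (img S)" using sm_mem[OF S] by (auto simp: pre_def img_def)
  thus "S <+>\<^bsub>M\<^esub> N \<subseteq> pre (img S)" using sm_pre[OF sm_img[OF S]] by (intro ssum_least)
qed

lemma pre_subset_iff: "S \<subseteq> carrier quo \<Longrightarrow> pre S \<subseteq> pre S' \<longleftrightarrow> S \<subseteq> S'"
  by (auto simp: pre_def quo_carrier img_def)

lemma pre_eq_iff: "S \<subseteq> carrier quo \<Longrightarrow> S' \<subseteq> carrier quo \<Longrightarrow> pre S = pre S' \<longleftrightarrow> S = S'"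
  using pre_subset_iff[of S S'] pre_subset_iff[of S' S] by blast

lemma img_psubset:
  assumes S: "sm S" "sm S'" "N \<subseteq> S" "S \<subset> S'" shows "img S \<subset> img S'"
proof -
  have NS': "N \<subseteq> S'" using S by blast
  have p: "pre (img S) = S" "pre (img S') = S'"
    by (simp_all only: pre_img[OF S(1)] pre_img[OF S(2)] ssum_absorb1[OF S(1) N S(3)] ssum_absorb1[OF S(2) N NS'])
  have "img S \<noteq> img S'"
  proof
    assume e: "img S = img S'"
    have "S = S'" by (rule trans[OF p(1)[symmetric] trans[OF arg_cong[OF e, of pre] p(2)]])
    thus False using S(4) by blast
  qed
  moreover have "img S \<subseteq> img S'" using S(4) unfolding img_def by (intro image_mono) blast
  ultimately show ?thesis by blast
qed

text \<open>Chains of submodules of \<open>M/N\<close> and chains in \<open>M\<close> above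
  \<open>N\<close> correspond through images and preimages.\<close>

lemma has_length_module_length:
  assumes l: "module_length R quo = enat l" shows "has_length N (carrier M) l"
proof -
  interpret Q: module R quo by (rule module_quo)
  define ch where "ch n \<longleftrightarrow> (\<exists>C :: nat \<Rightarrow> 'c set set. (\<forall>i\<le>n. submodule (C i) R quo) \<and> (\<forall>i<n. C i \<subset> C (Suc i)))" for n
  have ml: "module_length R quo = Sup {enat n | n. ch n}" by (simp add: module_length_def ch_def)
  have ex: "\<exists>C. (\<forall>i\<le>n. submodule (C i) R quo) \<and> (\<forall>i<n. C i \<subset> C (Suc i)) \<and> C n = img S" if "chn n N S" for n S
    using that
  proof (induct n arbitrary: S)
    case 0
    thus ?case using sm_img by (intro exI[of _ "\<lambda>_. img S"]) simp
  next
    case (Suc n)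
    then obtain S' where S: "sm S" and S': "chn n N S'" "S' \<subset> S" by auto
    obtain C where C: "\<And>i. i \<le> n \<Longrightarrow> submodule (C i) R quo" "\<And>i. i < n \<Longrightarrow> C i \<subset> C (Suc i)" "C n = img S'"
      using Suc(1)[OF S'(1)] by blast
    have "img S' \<subset> img S" by (rule img_psubset[OF chn_sm[OF S'(1)] S chn_subset[OF S'(1)] S'(2)])
    hence "(C(Suc n := img S)) i \<subset> (C(Suc n := img S)) (Suc i)" if "i < Suc n" for i
      using C(2,3) that by (cases "i = n") auto
    moreover have "submodule ((C(Suc n := img S)) i) R quo" if "i \<le> Suc n" for i
      using C(1) that sm_img[OF S] by (cases "i = Suc n") auto
    ultimately show ?case by (intro exI[of _ "C(Suc n := img S)"]) auto
  qed
  have chC: "ch n" if "chn n N (carrier M)" for n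
    using ex[OF that] unfolding ch_def by (elim exE conjE) (intro exI conjI)
  have ub: "n \<le> l" if "chn n N (carrier M)" for n
  proof -
    have "enat n \<in> {enat n | n. ch n}" using chC[OF that] by blast
    hence "enat n \<le> Sup {enat n | n. ch n}" by (rule Sup_upper)
    thus ?thesis using l ml by (metis enat_ord_simps(1))
  qed
  have chn: "chn n N (carrier M)" if c: "ch n" for n
  proof -
    obtain C where C: "\<And>i. i \<le> n \<Longrightarrow> submodule (C i) R quo" "\<And>i. i < n \<Longrightarrow> C i \<subset> C (Suc i)"
      using c unfolding ch_def by blast
    have "chn i N (pre (C i))" if "i \<le> n" for i
      using that
    proof (induct i)
      case 0
      thus ?case using sm_pre[OF C(1)[of 0]] by simp
    next
      case (Suc i)
      have "pre (C i) \<subset> pre (C (Suc i))"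
        using C(2)[of i] Q.sm_carrier[OF C(1)[of i]] Q.sm_carrier[OF C(1)[of "Suc i"]] Suc(2)
          pre_subset_iff[of "C i" "C (Suc i)"] pre_subset_iff[of "C (Suc i)" "C i"] by auto
      thus ?case using Suc sm_pre(1)[OF C(1)[OF Suc(2)]] by auto
    qed
    from this[of n] show ?thesis by (intro chn_top_mono[OF _ _ sm_carrier_whole]) (auto simp: pre_def)
  qed
  \<comment> \<open>A finite supremum of natural numbers is attained: otherwise all chains would
    have length at most \<open>l - 1\<close>.\<close>
  have "ch l"
  proof (rule ccontr)
    assume nl: "\<not> ch l"
    have "ch 0" unfolding ch_def using Q.sm_carrier_whole by (intro exI[of _ "\<lambda>_. carrier quo"]) auto
    hence "l \<noteq> 0" using nl by metis
    have "n \<le> l - 1" if c: "ch n" for n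
    proof -
      have "n \<noteq> l" using c nl by metis
      thus ?thesis using ub[OF chn[OF c]] by simp
    qed
    hence "Sup {enat n | n. ch n} \<le> enat (l - 1)" by (intro Sup_least) auto
    thus False using l ml \<open>l \<noteq> 0\<close> by simp
  qed
  thus ?thesis using ub chn unfolding has_length_def by blast
qed

lemma ideal_smult_img:
  assumes I: "ideal I R" and S: "sm S"
  shows "ideal_smult quo I (img S) = img (ideal_smult M I S)"
proof
  interpret Q: module R quo by (rule module_quo)
  have IS: "sm (ideal_smult M I S)" by (rule sm_ideal_smult[OF I sm_carrier[OF S]])
  have iS: "img S \<subseteq> carrier quo" by (rule Q.sm_carrier[OF sm_img[OF S]])
  have ism: "submodule (ideal_smult quo I (img S)) R quo" by (rule Q.sm_ideal_smult[OF I iS])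
  show "ideal_smult quo I (img S) \<subseteq> img (ideal_smult M I S)"
  proof (rule Q.ideal_smult_least[OF sm_img[OF IS]])
    fix a z assume a: "a \<in> I" and "z \<in> img S"
    then obtain s where s: "s \<in> S" "z = N +>\<^bsub>M\<^esub> s" by (auto simp: img_def)
    have "a \<odot>\<^bsub>quo\<^esub> z = N +>\<^bsub>M\<^esub> (a \<odot>\<^bsub>M\<^esub> s)"
      unfolding s(2) by (rule quo_smult[OF ideal.Icarr[OF I a] sm_mem[OF S s(1)]])
    thus "a \<odot>\<^bsub>quo\<^esub> z \<in> img (ideal_smult M I S)" using ideal_smult_incl[OF a s(1)] by (auto simp: img_def)
  qed
  have "ideal_smult M I S \<subseteq> pre (ideal_smult quo I (img S))"
  proof (rule ideal_smult_least[OF sm_pre(1)[OF ism]])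
    fix a s assume a: "a \<in> I" and s: "s \<in> S"
    have "N +>\<^bsub>M\<^esub> s \<in> img S" using s by (auto simp: img_def)
    hence "a \<odot>\<^bsub>quo\<^esub> (N +>\<^bsub>M\<^esub> s) \<in> ideal_smult quo I (img S)" by (rule Q.ideal_smult_incl[OF a])
    thus "a \<odot>\<^bsub>M\<^esub> s \<in> pre (ideal_smult quo I (img S))"
      using quo_smult[OF ideal.Icarr[OF I a] sm_mem[OF S s]] ideal.Icarr[OF I a] sm_mem[OF S s] by (simp add: pre_def)
  qed
  thus "img (ideal_smult M I S) \<subseteq> ideal_smult quo I (img S)" by (auto simp: img_def pre_def)
qed

lemma elem_smult_img: "x \<in> carrier R \<Longrightarrow> sm S \<Longrightarrow> elem_smult quo x (img S) = img (elem_smult M x S)"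
  using quo_smult sm_mem by (auto simp: elem_smult_def img_def image_image intro!: image_cong)

lemma img_Int_eq_iff:
  assumes "sm A" "sm B" "sm C"
  shows "img A \<inter> img B = img C \<longleftrightarrow> (A <+>\<^bsub>M\<^esub> N) \<inter> (B <+>\<^bsub>M\<^esub> N) = C <+>\<^bsub>M\<^esub> N"
proof -
  interpret Q: module R quo by (rule module_quo)
  have c: "img S \<subseteq> carrier quo" if "sm S" for S by (rule Q.sm_carrier[OF sm_img[OF that]])
  have "img A \<inter> img B = img C \<longleftrightarrow> pre (img A \<inter> img B) = pre (img C)"
    by (rule pre_eq_iff[symmetric]) (use c assms in auto)
  also have "pre (img A \<inter> img B) = pre (img A) \<inter> pre (img B)" by (auto simp: pre_def)
  finally show ?thesis using pre_img assms by simp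
qed

end

lemma has_length_sub:
  assumes X: "sm X" and Y: "sm Y" "Y \<subseteq> X" and l: "module_length R (factor_module (M\<lparr>carrier := X\<rparr>) Y) = enat l"
  shows "has_length Y X l"
proof -
  let ?X = "M\<lparr>carrier := X\<rparr>"
  interpret X: module R ?X by (rule submodule.submodule_is_module[OF X module_axioms])
  have sub: "submodule S R ?X \<longleftrightarrow> sm S \<and> S \<subseteq> X" for S
  proof
    assume S: "submodule S R ?X"
    have SX: "S \<subseteq> X" using X.sm_carrier[OF S] by simp
    have "sm S"
    proof (rule smI)
      show "S \<subseteq> carrier M" using SX sm_carrier[OF X] by blast
      show "\<zero>\<^bsub>M\<^esub> \<in> S" using X.sm_zero[OF S] by simp
      show "a \<oplus>\<^bsub>M\<^esub> b \<in> S" if "a \<in> S" "b \<in> S" for a b using X.sm_add[OF S that] by simp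
      show "a \<odot>\<^bsub>M\<^esub> x \<in> S" if "a \<in> carrier R" "x \<in> S" for a x using X.sm_smult[OF S that] by simp
    qed
    thus "sm S \<and> S \<subseteq> X" using SX by simp
  next
    assume S: "sm S \<and> S \<subseteq> X"
    show "submodule S R ?X"
      by (rule X.smI) (use S sm_zero sm_add sm_smult in auto)
  qed
  have chn: "X.chn n Y S \<longleftrightarrow> chn n Y S \<and> S \<subseteq> X" for n S
    by (induct n arbitrary: S) (auto simp: sub)
  have "X.has_length Y (carrier ?X) l"
    by (rule X.has_length_module_length[OF _ l]) (simp add: sub Y)
  thus ?thesis unfolding has_length_def X.has_length_def chn by simp
qed

end

context power_family
begin

lemma ssum_le_iff: "sm A \<Longrightarrow> sm B \<Longrightarrow> sm T \<Longrightarrow> A \<uplus> B \<subseteq> T \<longleftrightarrow> A \<subseteq> T \<and> B \<subseteq> T"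
  using ssum_ub1[of A B] ssum_ub2[of A B] ssum_least[of T A B] sm_carrier by blast

lemma nfold_le_iff:
  "seq_in s \<Longrightarrow> sm N \<Longrightarrow> sm T \<Longrightarrow>
    nfold s N \<subseteq> T \<longleftrightarrow> N \<subseteq> T \<and> (\<forall>p\<in>set s. elem_smult M (fst p) (carrier M) \<subseteq> T)"
proof (induct s arbitrary: N)
  case (Cons p s)
  have xR: "fst p \<in> carrier R" by (rule seq_in_carrier[OF Cons(2)])
  have s: "seq_in s" using Cons(2) by (simp add: seq_in_Cons)
  show ?case
    using Cons(1)[OF s sm_xM[OF xR Cons(3)] Cons(4)]
      ssum_le_iff[OF sm_elem_smult[OF xR sm_carrier_whole] Cons(3,4)] by auto
qed simp

lemma genideal_smult_le_iff:
  assumes S: "S \<subseteq> carrier R" and X: "sm X" and T: "sm T"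
  shows "ideal_smult M (Idl S) X \<subseteq> T \<longleftrightarrow> (\<forall>x\<in>S. elem_smult M x X \<subseteq> T)"
proof
  assume a: "ideal_smult M (Idl S) X \<subseteq> T"
  show "\<forall>x\<in>S. elem_smult M x X \<subseteq> T"
  proof
    fix x assume "x \<in> S"
    hence "x \<in> Idl S" using R.genideal_self[OF S] by blast
    thus "elem_smult M x X \<subseteq> T" using a ideal_smult_incl[of x "Idl S" _ X] unfolding elem_smult_def by blast
  qed
next
  assume a: "\<forall>x\<in>S. elem_smult M x X \<subseteq> T"
  show "ideal_smult M (Idl S) X \<subseteq> T"
  proof (rule ideal_smult_least[OF T])
    fix c z assume c: "c \<in> Idl S" and z: "z \<in> X"
    show "c \<bullet> z \<in> T"
      by (rule colon_genideal[OF S T sm_mem[OF X z] _ c]) (use a z elem_smult_incl in blast)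
  qed
qed

text \<open>Both sides are submodules contained in the same submodules, hence equal.\<close>

lemma genideal_smult_nfold:
  assumes s: "seq_in s"
  shows "ideal_smult M (Idl (fst ` set s)) (carrier M) = nfold s {\<zero>\<^sub>M}"
proof -
  have S: "fst ` set s \<subseteq> carrier R" using s K_mem unfolding seq_in_def by blast
  have sm1: "sm (ideal_smult M (Idl (fst ` set s)) (carrier M))"
    by (rule sm_ideal_smult[OF R.genideal_ideal[OF S]]) simp
  have sm2: "sm (nfold s {\<zero>\<^sub>M})" by (rule sm_nfold[OF s sm_zero_set])
  have eq: "ideal_smult M (Idl (fst ` set s)) (carrier M) \<subseteq> T \<longleftrightarrow> nfold s {\<zero>\<^sub>M} \<subseteq> T" if "sm T" for T
    unfolding genideal_smult_le_iff[OF S sm_carrier_whole that] nfold_le_iff[OF s sm_zero_set that]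
    using sm_zero[OF that] by simp
  show ?thesis using eq[OF sm1] eq[OF sm2] by blast
qed

lemma product_ideal_pow: "product_ideal R d K [^]\<^bsub>ideals_set R\<^esub> (m::nat) = PP (\<lambda>_. m)"
proof -
  interpret I: comm_monoid "ideals_set R" by (rule R.ideals_set_is_comm_monoid)
  show ?thesis
  proof (induct m)
    case 0
    show ?case by (simp add: PP_0 ideals_set_simps)
  next
    case (Suc m)
    have "PP (\<lambda>_. Suc m) = PP (\<lambda>_. m) \<cdot>\<^bsub>R\<^esub> PP (\<lambda>_. 1)" using PP_add[of "\<lambda>_. m" "\<lambda>_. 1"] by simp
    thus ?case using Suc by (simp add: ideals_set_simps product_ideal_def)
  qed
qed

text \<open>Preimages in \<open>M\<close> turn the equality in (FC1) into one between submodules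
  containing \<open>N\<close>, whence the summands \<open>N\<close> in \<open>rel_FC\<close>; (FC2)
  is tested on representatives of cosets.\<close>

lemma weak_FC_element_iff:
  assumes N: "sm N"
  shows "weak_FC_element R d K (factor_module M N) i x \<longleftrightarrow> rel_FC N i x"
proof (cases "i \<le> d \<and> x \<in> K i")
  case True
  hence xR: "x \<in> carrier R" using K_mem by blast
  let ?Q = "factor_module M N"
  have smx: "sm (elem_smult M x S)" if "sm S" for S by (rule sm_elem_smult[OF xR that])
  have pQ: "power_submodule R d K ?Q v = img N (U v)" for v
    unfolding power_submodule_def[of R d K ?Q] quo_carrier[OF N] ideal_smult_img[OF N PP_ideal sm_carrier_whole]
    by (simp add: U_pw)
  have 1: "elem_smult ?Q x (carrier ?Q) \<inter> power_submodule R d K ?Q v = elem_smult ?Q x (power_submodule R d K ?Q (lower i v))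
     \<longleftrightarrow> (elem_smult M x (carrier M) \<uplus> N) \<inter> (U v \<uplus> N) = elem_smult M x (U (lower i v)) \<uplus> N" for v
    unfolding pQ quo_carrier[OF N] elem_smult_img[OF N xR sm_carrier_whole] elem_smult_img[OF N xR sm_U]
    by (rule img_Int_eq_iff[OF N smx[OF sm_carrier_whole] sm_U smx[OF sm_U]])
  have z: "a \<odot>\<^bsub>?Q\<^esub> (N +>\<^bsub>M\<^esub> y) = \<zero>\<^bsub>?Q\<^esub> \<longleftrightarrow> a \<bullet> y \<in> N" if "a \<in> carrier R" "y \<in> carrier M" for a y
    using quo_smult[OF N that] coset_eq_N[OF N, of "a \<bullet> y"] that by (simp add: quo_zero[OF N])
  have zc: "N +>\<^bsub>M\<^esub> y \<in> zero_colon ?Q A \<longleftrightarrow> (\<forall>a\<in>A. a \<bullet> y \<in> N)" if "A \<subseteq> carrier R" "y \<in> carrier M" for A y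
  proof -
    have "N +>\<^bsub>M\<^esub> y \<in> carrier ?Q" using that by (auto simp: quo_carrier[OF N] img_def[OF N])
    thus ?thesis using z[OF subsetD[OF that(1)] that(2)] by (simp add: zero_colon_def)
  qed
  have 2: "zero_colon ?Q {x} \<subseteq> zero_colon_inf R ?Q (product_ideal R d K) \<longleftrightarrow>
    (\<forall>z\<in>carrier M. x \<bullet> z \<in> N \<longrightarrow> (\<exists>m. \<forall>a\<in>PP (\<lambda>_. m). a \<bullet> z \<in> N))"
  proof -
    have inf: "N +>\<^bsub>M\<^esub> y \<in> zero_colon_inf R ?Q (product_ideal R d K) \<longleftrightarrow> (\<exists>m. \<forall>a\<in>PP (\<lambda>_. m). a \<bullet> y \<in> N)"
      if "y \<in> carrier M" for y
      using zc[OF PP_carrier that] by (simp add: zero_colon_inf_def product_ideal_pow)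
    have one: "N +>\<^bsub>M\<^esub> y \<in> zero_colon ?Q {x} \<longleftrightarrow> x \<bullet> y \<in> N" if "y \<in> carrier M" for y
      using zc[OF _ that, of "{x}"] xR by simp
    have "zero_colon ?Q {x} \<subseteq> zero_colon_inf R ?Q (product_ideal R d K) \<longleftrightarrow>
      (\<forall>y\<in>carrier M. N +>\<^bsub>M\<^esub> y \<in> zero_colon ?Q {x} \<longrightarrow> N +>\<^bsub>M\<^esub> y \<in> zero_colon_inf R ?Q (product_ideal R d K))"
      by (auto simp: zero_colon_def[of ?Q "{x}"] quo_carrier[OF N] img_def[OF N])
    thus ?thesis using inf one by simp
  qed
  show ?thesis unfolding weak_FC_element_def rel_FC_def 1 2 by simp
next
  case False
  thus ?thesis by (auto simp: weak_FC_element_def rel_FC_def)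
qed

lemma rel_FC_seq_nth:
  "rel_FC_seq s N \<longleftrightarrow> (\<forall>j<length s. rel_FC (nfold (take j s) N) (snd (s ! j)) (fst (s ! j)))"
proof (induct s arbitrary: N)
  case (Cons p s)
  have "(\<forall>j<length (p # s). rel_FC (nfold (take j (p # s)) N) (snd ((p # s) ! j)) (fst ((p # s) ! j))) \<longleftrightarrow>
    rel_FC N (snd p) (fst p) \<and>
    (\<forall>j<length s. rel_FC (nfold (take j s) (elem_smult M (fst p) (carrier M) \<uplus> N)) (snd (s ! j)) (fst (s ! j)))"
    unfolding length_Cons All_less_Suc2 by simp
  thus ?case using Cons by simp
qed simp

lemma seq_in_take: "seq_in s \<Longrightarrow> seq_in (take j s)"
  unfolding seq_in_def using in_set_takeD by metis

lemma quotient_by_initial_eq: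
  "seq_in s \<Longrightarrow> quotient_by_initial R M s j = factor_module M (nfold (take j s) {\<zero>\<^sub>M})"
  unfolding quotient_by_initial_def using genideal_smult_nfold[OF seq_in_take] by simp

lemma weak_FC_sequence_iff: "weak_FC_sequence R d K M s \<longleftrightarrow> rel_FC_seq s {\<zero>\<^sub>M}"
proof -
  have eq: "weak_FC_sequence R d K M s \<longleftrightarrow> rel_FC_seq s {\<zero>\<^sub>M}" if s: "seq_in s"
    unfolding weak_FC_sequence_def rel_FC_seq_nth quotient_by_initial_eq[OF s]
    using weak_FC_element_iff[OF sm_nfold[OF seq_in_take[OF s] sm_zero_set]] by blast
  have "seq_in s" if "weak_FC_sequence R d K M s"
    using that unfolding weak_FC_sequence_def seq_in_def weak_FC_element_def by (metis in_set_conv_nth)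
  thus ?thesis using eq rel_FC_seq_in by blast
qed

lemma sequence_of_type_seq_in: "sequence_of_type d K \<tau> s \<Longrightarrow> seq_in s"
  by (auto simp: sequence_of_type_def seq_in_def)

lemma sequence_of_type_iff:
  "sequence_of_type d K \<tau> s \<longleftrightarrow> seq_in s \<and> (\<forall>i\<le>d. count_list (map snd s) i = \<tau> i)"
  by (auto simp: sequence_of_type_def seq_in_def)

lemma generate_jsum:
  assumes s: "seq_in s"
  shows "generate (add_monoid M) (\<Union>i\<in>{0..d}. ideal_smult M (Idl {x. (x, i) \<in> set s}) (U (lower i v))) = jsum s v"
    (is "generate _ ?G = _")
proof
  have J: "sm (jsum s v)" by (rule sm_jsum[OF s])
  have SR: "{x. (x, i) \<in> set s} \<subseteq> carrier R" for i
  proof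
    fix x assume "x \<in> {x. (x, i) \<in> set s}"
    hence "i \<le> d \<and> x \<in> K i" using s unfolding seq_in_def by fastforce
    thus "x \<in> carrier R" using K_mem by blast
  qed
  have le: "elem_smult M (fst p) (U (lower (snd p) v)) \<subseteq> jsum s' v" if "p \<in> set s'" "seq_in s'" for p s'
    using that
  proof (induct s')
    case (Cons q s')
    have q: "fst q \<in> carrier R" "seq_in s'" using seq_in_carrier[OF Cons(3)] Cons(3) by (auto simp: seq_in_Cons)
    have sm: "sm (elem_smult M (fst q) (U (lower (snd q) v)))" "sm (jsum s' v)"
      using sm_elem_smult[OF q(1) sm_U] sm_jsum[OF q(2)] by auto
    show ?case
    proof (cases "p = q")
      case True
      thus ?thesis using ssum_ub1[OF sm_carrier[OF sm(1)] sm(2)] by simp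
    next
      case False
      thus ?thesis using Cons(1,2) q(2) ssum_ub2[OF sm(1) sm_carrier[OF sm(2)]] by auto
    qed
  qed simp
  have "?G \<subseteq> jsum s v"
  proof (rule UN_least)
    fix i
    show "ideal_smult M (Idl {x. (x, i) \<in> set s}) (U (lower i v)) \<subseteq> jsum s v"
      unfolding genideal_smult_le_iff[OF SR sm_U J] using le[OF _ s] by fastforce
  qed
  thus "generate (add_monoid M) ?G \<subseteq> jsum s v"
    using M.add.generate_subgroup_incl[of ?G "jsum s v"] J by (simp add: submodule_def)
  have "jsum s' v \<subseteq> generate (add_monoid M) ?G" if "set s' \<subseteq> set s" for s'
    using that
  proof (induct s')
    case Nil
    show ?case using generate.one[of "add_monoid M" ?G] by simp
  next
    case (Cons p s')
    obtain x i where p: "p = (x, i)" by (cases p)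
    have i: "i \<le> d" using Cons(2) s p by (auto simp: seq_in_def)
    have x: "x \<in> Idl {x. (x, i) \<in> set s}" using Cons(2) p R.genideal_self[OF SR, of i] by auto
    show ?case
    proof
      fix z assume "z \<in> jsum (p # s') v"
      hence "z \<in> elem_smult M x (U (lower i v)) \<uplus> jsum s' v" by (simp add: p)
      then obtain u w where u: "u \<in> U (lower i v)" "w \<in> jsum s' v" "z = x \<bullet> u \<oplus>\<^sub>M w"
        unfolding mem_ssum elem_smult_def by blast
      have "x \<bullet> u \<in> ?G" using ideal_smult_incl[OF x u(1)] i by auto
      hence "x \<bullet> u \<in> generate (add_monoid M) ?G" by (rule generate.incl)
      moreover have "w \<in> generate (add_monoid M) ?G" using Cons u(2) by auto
      ultimately show "z \<in> generate (add_monoid M) ?G" using generate.eng[of _ "add_monoid M" ?G w] u(3) by simp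
    qed
  qed
  thus "jsum s v \<subseteq> generate (add_monoid M) ?G" by blast
qed

text \<open>The reverse inclusion holds as soon as all exponents are positive, where the truncated
  \<open>lower\<close> is a genuine subtraction; so \<open>rel_JR\<close> asks for one inclusion
  only.\<close>

lemma joint_reduction_iff:
  "joint_reduction R d K M \<tau> s \<longleftrightarrow> sequence_of_type d K \<tau> s \<and> rel_JR s {\<zero>\<^sub>M}"
proof (cases "seq_in s")
  case True
  have absorb: "jsum s v \<uplus> {\<zero>\<^sub>M} = jsum s v" for v
    using ssum_absorb1[OF sm_jsum[OF True] sm_zero_set] sm_zero[OF sm_jsum[OF True]] by blast
  have "for_all_large d (\<lambda>v. U v = jsum s v) \<longleftrightarrow> for_all_large d (\<lambda>v. U v \<subseteq> jsum s v)"
  proof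
    assume "for_all_large d (\<lambda>v. U v \<subseteq> jsum s v)"
    thus "for_all_large d (\<lambda>v. U v = jsum s v)"
    proof (rule for_all_large_mono[OF for_all_large_conj[OF _ for_all_large_ge[of d 1]]])
      fix v assume v: "U v \<subseteq> jsum s v \<and> (\<forall>i\<le>d. 1 \<le> v i)"
      hence "\<forall>k\<le>d. 0 < v k" by fastforce
      thus "U v = jsum s v" using jsum_U[OF True] v by blast
    qed
  qed (elim for_all_large_mono, blast)
  thus ?thesis
    unfolding joint_reduction_def rel_JR_def generate_jsum[OF True] absorb using True by blast
next
  case False
  thus ?thesis using sequence_of_type_seq_in by (auto simp: joint_reduction_def)
qed

end

context noetherian_power_family
begin

text \<open>The radical gives an exponent for each element of \<open>IJ\<close> separately. For a
  common one let \<open>C\<close> be the stable colon of \<open>N\<close> by the powers of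
  \<open>IJ\<close>: if \<open>C\<close> were not \<open>M\<close>, some element outside
  \<open>C\<close> would be carried into \<open>C\<close> by generators of \<open>IJ\<close>, hence
  by \<open>IJ\<close>, and would therefore belong to \<open>C\<close>.\<close>

lemma nilpotent_iff:
  assumes N: "sm N"
  shows "product_ideal R d K \<subseteq> ideal_radical R (module_annihilator R (factor_module M N)) \<longleftrightarrow>
    for_all_large d (\<lambda>v. U v \<subseteq> N)"
proof -
  have IJ: "product_ideal R d K = PP (\<lambda>_. 1)" by (simp add: product_ideal_def)
  have ann: "a \<in> module_annihilator R (factor_module M N) \<longleftrightarrow> (\<forall>y\<in>carrier M. a \<bullet> y \<in> N)" if "a \<in> carrier R" for a
    using that quo_smult[OF N that] coset_eq_N[OF N]
    by (auto simp: module_annihilator_def quo_carrier[OF N] img_def[OF N] quo_zero[OF N])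
  have rad: "product_ideal R d K \<subseteq> ideal_radical R (module_annihilator R (factor_module M N)) \<longleftrightarrow>
    (\<forall>a\<in>PP (\<lambda>_. 1). \<exists>n::nat. \<forall>y\<in>carrier M. a [^] n \<bullet> y \<in> N)"
  proof -
    have "a \<in> ideal_radical R (module_annihilator R (factor_module M N)) \<longleftrightarrow>
      (\<exists>n::nat. \<forall>y\<in>carrier M. a [^] n \<bullet> y \<in> N)" if "a \<in> carrier R" for a
      using that ann[OF R.nat_pow_closed[OF that]] by (simp add: ideal_radical_def)
    thus ?thesis unfolding IJ using PP_carrier by blast
  qed
  show ?thesis unfolding rad
  proof
    assume "for_all_large d (\<lambda>v. U v \<subseteq> N)"
    then obtain m where "\<And>v. (\<And>i. i \<le> d \<Longrightarrow> m \<le> v i) \<Longrightarrow> U v \<subseteq> N" by (rule for_all_largeE) blast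
    hence m: "U (\<lambda>_. m) \<subseteq> N" by simp
    show "\<forall>a\<in>PP (\<lambda>_. 1). \<exists>n::nat. \<forall>y\<in>carrier M. a [^] n \<bullet> y \<in> N"
    proof
      fix a assume a: "a \<in> PP (\<lambda>_. 1)"
      have "a [^] n \<in> PP (\<lambda>_. n)" for n :: nat
      proof (induct n)
        case (Suc n)
        have "a [^] n \<otimes> a \<in> PP (\<lambda>_. n) \<cdot>\<^bsub>R\<^esub> PP (\<lambda>_. 1)" by (rule ideal_prod.prod[OF Suc a])
        thus ?case using PP_add[of "\<lambda>_. n" "\<lambda>_. 1"] by simp
      qed (simp add: PP_0)
      hence "a [^] m \<bullet> y \<in> N" if "y \<in> carrier M" for y
        using ideal_smult_incl[of "a [^] m" "PP (\<lambda>_. m)" y "carrier M"] that m by (auto simp: U_pw)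
      thus "\<exists>n::nat. \<forall>y\<in>carrier M. a [^] n \<bullet> y \<in> N" by blast
    qed
  next
    assume nil: "\<forall>a\<in>PP (\<lambda>_. 1). \<exists>n::nat. \<forall>y\<in>carrier M. a [^] n \<bullet> y \<in> N"
    obtain m0 where m0: "\<And>z m. z \<in> carrier M \<Longrightarrow> \<forall>a\<in>PP (\<lambda>_. m). a \<bullet> z \<in> N \<Longrightarrow>
      \<forall>a\<in>PP (\<lambda>_. m0). a \<bullet> z \<in> N" by (rule torsion_bound[OF N]) blast
    define C where "C = {z \<in> carrier M. \<forall>a\<in>PP (\<lambda>_. m0). a \<bullet> z \<in> N}"
    have C: "sm C" unfolding C_def by (rule sm_colon[OF PP_ideal N])
    have NC: "N \<subseteq> C" unfolding C_def using sm_mem[OF N] sm_smult[OF N subsetD[OF PP_carrier]] by blast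
    obtain S where S: "finite S" "S \<subseteq> PP (\<lambda>_. 1)" "PP (\<lambda>_. 1) = Idl S" using ideal_gens[OF PP_ideal] by blast
    have SR: "a \<in> carrier R" if "a \<in> S" for a using that S(2) PP_carrier by blast
    have "z \<in> C" if z: "z \<in> carrier M" for z
    proof (rule ccontr)
      assume nz: "z \<notin> C"
      obtain w where w: "w \<in> carrier M" "w \<notin> C" "\<And>a. a \<in> S \<Longrightarrow> a \<bullet> w \<in> C"
      proof (rule commuting_last_bad[of S z "carrier M" "\<lambda>z. z \<in> C" "\<lambda>a z. a \<bullet> z"])
        show "finite S" by (rule S)
        show "z \<in> carrier M" by (rule z)
        show "z \<notin> C" by (rule nz)
        show "a \<bullet> (b \<bullet> s) = b \<bullet> (a \<bullet> s)" if "a \<in> S" "b \<in> S" "s \<in> carrier M" for a b s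
          using smult_commute that SR by blast
        show "a \<bullet> s \<in> carrier M" if "a \<in> S" "s \<in> carrier M" for a s using that SR by simp
        show "a \<bullet> s \<in> C" if "a \<in> S" "s \<in> carrier M" "s \<in> C" for a s using sm_smult[OF C SR[OF that(1)] that(3)] .
        show "\<exists>n. ((\<bullet>) a ^^ n) s \<in> C" if a: "a \<in> S" and s: "s \<in> carrier M" for a s
        proof -
          have pow: "((\<bullet>) a ^^ n) s = a [^] n \<bullet> s" for n
          proof (induct n)
            case (Suc n)
            thus ?case using SR[OF a] s by (simp add: smult_assoc1[symmetric] R.m_comm)
          qed (simp add: s)
          obtain n :: nat where "a [^] n \<bullet> s \<in> N" using nil S(2) a s by blast
          thus ?thesis using NC pow by auto
        qed
      qed blast
      have Iw: "a \<bullet> w \<in> C" if "a \<in> PP (\<lambda>_. 1)" for a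
        by (rule colon_genideal[of S, OF _ C w(1) w(3)]) (use S SR that in auto)
      have "c \<bullet> w \<in> N" if c: "c \<in> PP (\<lambda>_. Suc m0)" for c
      proof (rule ideal_prod_smult_mem[OF PP_ideal PP_ideal N w(1)])
        show "c \<in> PP (\<lambda>_. m0) \<cdot>\<^bsub>R\<^esub> PP (\<lambda>_. 1)" using c PP_add[of "\<lambda>_. m0" "\<lambda>_. 1"] by simp
        show "a \<bullet> (b \<bullet> w) \<in> N" if "a \<in> PP (\<lambda>_. m0)" "b \<in> PP (\<lambda>_. 1)" for a b
          using Iw[OF that(2)] that(1) unfolding C_def by blast
      qed
      hence "w \<in> C" using m0[OF w(1), of "Suc m0"] w(1) unfolding C_def by blast
      thus False using w(2) by simp
    qed
    hence "U (\<lambda>_. m0) \<subseteq> N"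
      unfolding U_pw by (intro ideal_smult_least[OF N]) (auto simp: C_def)
    moreover have "U v \<subseteq> U (\<lambda>_. m0)" if "\<And>i. i \<le> d \<Longrightarrow> m0 \<le> v i" for v by (rule U_antimono[OF that])
    ultimately show "for_all_large d (\<lambda>v. U v \<subseteq> N)" by (intro for_all_largeI[of _ m0]) blast
  qed
qed

end

section \<open>Difference operators and types\<close>

lemma backward_diff_commute: "backward_diff i (backward_diff j f) = backward_diff j (backward_diff i f)"
  by (cases "i = j") (auto simp: backward_diff_def fun_eq_iff fun_upd_twist)

definition type_list :: "nat \<Rightarrow> (nat \<Rightarrow> nat) \<Rightarrow> nat list" where
  "type_list d \<kappa> = concat (map (\<lambda>i. replicate (\<kappa> i) i) [0..<Suc d])"

lemma count_type_list: "i \<le> d \<Longrightarrow> count_list (type_list d \<kappa>) i = \<kappa> i"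
proof -
  have rep: "count_list (replicate m j) i = (if i = j then m else 0)" for m and i j :: nat
    by (induct m) auto
  have "count_list (concat (map (\<lambda>i. replicate (\<kappa> i) i) [0..<m])) i = (if i < m then \<kappa> i else 0)" for m
    by (induct m) (auto simp: rep)
  from this[of "Suc d"] show "i \<le> d \<Longrightarrow> count_list (type_list d \<kappa>) i = \<kappa> i" unfolding type_list_def by simp
qed

lemma set_type_list: "\<forall>i\<in>set (type_list d \<kappa>). i \<le> d"
  by (auto simp: type_list_def)

lemma length_type_list: "length (type_list d \<kappa>) = (\<Sum>i=0..d. \<kappa> i)"
proof -
  have "length (concat (map (\<lambda>i. replicate (\<kappa> i) i) [0..<m])) = (\<Sum>i=0..<m. \<kappa> i)" for m
    by (induct m) auto
  from this[of "Suc d"] show ?thesis by (simp add: type_list_def atLeastLessThanSuc_atLeastAtMost)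
qed

text \<open>The differences commute, so only the multiset of indices matters;
  \<open>type_list\<close> lists them in the order in which \<open>iterated_diff\<close> composes
  them.\<close>

lemma fold_diff_iterated:
  assumes "\<forall>i\<in>set is. i \<le> d" "\<forall>i\<le>d. count_list is i = \<kappa> i"
  shows "fold backward_diff is f = iterated_diff d \<kappa> f"
proof -
  have "fold backward_diff (concat (map (\<lambda>i. replicate (\<kappa> i) i) js)) f = fold (\<lambda>i. backward_diff i ^^ \<kappa> i) js f" for js f
  proof (induct js arbitrary: f)
    case (Cons j js)
    have "fold backward_diff (replicate m j) f = (backward_diff j ^^ m) f" for m
      by (induct m arbitrary: f) (simp_all add: funpow_swap1)
    thus ?case using Cons by simp
  qed simp
  hence "fold backward_diff (type_list d \<kappa>) f = iterated_diff d \<kappa> f"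
    unfolding type_list_def iterated_diff_def by blast
  moreover have "fold backward_diff is = fold backward_diff (type_list d \<kappa>)"
  proof (rule fold_multiset_equiv)
    show "backward_diff x \<circ> backward_diff y = backward_diff y \<circ> backward_diff x" for x y
      by (auto simp: fun_eq_iff backward_diff_commute[THEN fun_cong])
    have "count_list is i = count_list (type_list d \<kappa>) i" for i
    proof (cases "i \<le> d")
      case True
      thus ?thesis using assms(2) count_type_list by simp
    next
      case False
      hence "i \<notin> set is" "i \<notin> set (type_list d \<kappa>)" using assms(1) set_type_list by blast+
      thus ?thesis by (simp add: count_list_0_iff)
    qed
    thus "mset is = mset (type_list d \<kappa>)" by (intro multiset_eqI) (simp add: count_mset)
  qed
  ultimately show ?thesis by simp
qed

section \<open>The equivalences\<close>

context local_power_family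
begin

lemma hilbert_rel_P:
  assumes "is_hilbert_polynomial R d K M P" shows "rel_P {\<zero>\<^sub>M} P"
  unfolding rel_P_def
proof (rule for_all_large_mono)
  show "for_all_large d (\<lambda>v. \<exists>l::nat. module_length R (factor_module (M\<lparr>carrier := U v\<rparr>) (U (v(0 := v 0 + 1)))) = enat l \<and>
    P (\<lambda>i. int (v i)) = int l)"
    using assms unfolding is_hilbert_polynomial_def by blast
  have absorb: "U v \<uplus> {\<zero>\<^sub>M} = U v" for v
    using ssum_absorb1[OF sm_U sm_zero_set] sm_zero[OF sm_U] by blast
  have le: "U (inc 0 v) \<subseteq> U v" for v by (rule U_antimono) simp
  fix v assume "\<exists>l::nat. module_length R (factor_module (M\<lparr>carrier := U v\<rparr>) (U (v(0 := v 0 + 1)))) = enat l \<and>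
    P (\<lambda>i. int (v i)) = int l"
  thus "\<exists>l. has_length (U (inc 0 v) \<uplus> {\<zero>\<^sub>M}) (U v \<uplus> {\<zero>\<^sub>M}) l \<and> P (\<lambda>i. int (v i)) = int l"
    unfolding absorb using has_length_sub[OF sm_U sm_U le] by (metis Suc_eq_plus1)
qed

lemma rel_P_type:
  assumes P: "rel_P {\<zero>\<^sub>M} P" and s: "rel_FC_seq s {\<zero>\<^sub>M}" and \<kappa>: "\<forall>i\<le>d. count_list (map snd s) i = \<kappa> i"
  shows "rel_P (nfold s {\<zero>\<^sub>M}) (iterated_diff d \<kappa> P)"
proof -
  have "\<forall>i\<in>set (map snd s). i \<le> d" using rel_FC_seq_in[OF s] by (auto simp: seq_in_def)
  hence "fold backward_diff (map snd s) P = iterated_diff d \<kappa> P" using \<kappa> by (rule fold_diff_iterated)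
  moreover have "fold backward_diff (map snd s) P = fold (\<lambda>p. backward_diff (snd p)) s P"
    by (simp add: fold_map comp_def)
  ultimately show ?thesis using rel_P_nfold[OF s sm_zero_set P] by simp
qed

end

lemma iterated_diff_add:
  assumes "\<forall>i\<le>d. \<sigma> i \<le> \<rho> i"
  shows "iterated_diff d \<rho> f = fold backward_diff (type_list d (\<lambda>i. \<rho> i - \<sigma> i)) (iterated_diff d \<sigma> f)"
proof -
  have "fold backward_diff (type_list d \<sigma> @ type_list d (\<lambda>i. \<rho> i - \<sigma> i)) f = iterated_diff d \<rho> f"
    by (rule fold_diff_iterated) (use assms set_type_list in \<open>auto simp: count_type_list\<close>)
  moreover have "fold backward_diff (type_list d \<sigma>) f = iterated_diff d \<sigma> f"
    by (rule fold_diff_iterated[OF set_type_list]) (simp add: count_type_list)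
  ultimately show ?thesis by simp
qed

lemma iterated_diff_step:
  assumes j: "j \<le> d" and "\<forall>i\<le>d. \<rho> i = (\<sigma>(j := Suc (\<sigma> j))) i"
  shows "iterated_diff d \<rho> f = backward_diff j (iterated_diff d \<sigma> f)"
proof -
  have "fold backward_diff (type_list d \<sigma> @ [j]) f = iterated_diff d \<rho> f"
    by (rule fold_diff_iterated) (use assms set_type_list in \<open>auto simp: count_type_list\<close>)
  moreover have "fold backward_diff (type_list d \<sigma>) f = iterated_diff d \<sigma> f"
    by (rule fold_diff_iterated[OF set_type_list]) (simp add: count_type_list)
  ultimately show ?thesis by simp
qed

lemma int_lower: "0 < v i \<Longrightarrow> (\<lambda>k. int (lower i v k)) = (\<lambda>k. int (v k))(i := int (v i) - 1)"
  by (auto simp: lower_def fun_eq_iff of_nat_diff)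

lemma eventually_zero_diff:
  assumes "for_all_large d (\<lambda>v. f (\<lambda>i. int (v i)) = 0)" "i \<le> d"
  shows "for_all_large d (\<lambda>v. backward_diff i f (\<lambda>i. int (v i)) = 0)"
proof (rule for_all_large_mono[OF for_all_large_conj[OF for_all_large_conj[OF assms(1) for_all_large_lower[OF assms(1), of i]]
        for_all_large_ge[of d 1]]])
  fix v assume v: "(f (\<lambda>i. int (v i)) = 0 \<and> f (\<lambda>k. int (lower i v k)) = 0) \<and> (\<forall>i\<le>d. 1 \<le> v i)"
  hence "0 < v i" using assms(2) by fastforce
  thus "backward_diff i f (\<lambda>i. int (v i)) = 0" using v int_lower[of v i] by (simp add: backward_diff_def)
qed

lemma eventually_zero_fold_diff:
  "\<forall>i\<in>set is. i \<le> d \<Longrightarrow> for_all_large d (\<lambda>v. f (\<lambda>i. int (v i)) = 0) \<Longrightarrow>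
    for_all_large d (\<lambda>v. fold backward_diff is f (\<lambda>i. int (v i)) = 0)"
  by (induct "is" arbitrary: f) (simp_all add: eventually_zero_diff)

context local_power_family
begin

context
  fixes P :: "(nat \<Rightarrow> int) \<Rightarrow> int" and \<kappa> :: "nat \<Rightarrow> nat" and c :: int
  assumes P: "rel_P {\<zero>\<^sub>M} P" and const: "iterated_diff d \<kappa> P = (\<lambda>_. c)"
begin

abbreviation "\<tau> \<equiv> \<kappa>(0 := Suc (\<kappa> 0))"

lemma FC_seq_of_type_exists:
  obtains s where "rel_FC_seq s {\<zero>\<^sub>M}" "\<forall>i\<le>d. count_list (map snd s) i = \<sigma> i" "map snd s = type_list d \<sigma>"
proof -
  obtain s where "map snd s = type_list d \<sigma> \<and> rel_FC_seq s {\<zero>\<^sub>M}"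
    using FC_seq_exists[OF sm_zero_set set_type_list] by blast
  thus ?thesis using that count_type_list by metis
qed

text \<open>\<open>c\<close> is the length of the graded pieces of the quotient by \<open>s\<close>
  in all large degrees.\<close>

lemma const_nonneg_iff:
  assumes s: "rel_FC_seq s {\<zero>\<^sub>M}" "\<forall>i\<le>d. count_list (map snd s) i = \<kappa> i"
  shows "0 \<le> c" "for_all_large d (\<lambda>v. U v \<subseteq> nfold s {\<zero>\<^sub>M}) \<longleftrightarrow> c = 0"
proof -
  have r: "rel_P (nfold s {\<zero>\<^sub>M}) (\<lambda>_. c)" using rel_P_type[OF P s] const by simp
  from for_all_large_obtain[OF r[unfolded rel_P_def]] show "0 \<le> c" by (metis of_nat_0_le_iff)
  have "for_all_large d (\<lambda>v::nat\<Rightarrow>nat. c = 0) \<longleftrightarrow> c = 0" unfolding for_all_large_def by auto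
  thus "for_all_large d (\<lambda>v. U v \<subseteq> nfold s {\<zero>\<^sub>M}) \<longleftrightarrow> c = 0"
    using rel_P_zero_iff[OF sm_nfold[OF rel_FC_seq_in[OF s(1)] sm_zero_set] r] by simp
qed

text \<open>One more difference in direction 0 annihilates the constant.\<close>

lemma tau_vanishes:
  assumes s: "rel_FC_seq s {\<zero>\<^sub>M}" "\<forall>i\<le>d. count_list (map snd s) i = \<tau> i"
  shows "for_all_large d (\<lambda>v. U v \<subseteq> nfold s {\<zero>\<^sub>M})"
proof -
  have "iterated_diff d \<tau> P = backward_diff 0 (\<lambda>_. c)"
    unfolding const[symmetric] by (rule iterated_diff_step) auto
  hence z: "iterated_diff d \<tau> P = (\<lambda>_. 0)" by (simp add: backward_diff_def)
  have "rel_P (nfold s {\<zero>\<^sub>M}) (\<lambda>_. 0)" using rel_P_type[OF P s] unfolding z .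
  from rel_P_zero_iff[OF sm_nfold[OF rel_FC_seq_in[OF s(1)] sm_zero_set] this]
  show ?thesis by (simp add: for_all_large_def)
qed

lemma no_smaller_joint_reduction:
  assumes c: "0 < c" and \<sigma>: "type_less d \<sigma> \<tau>"
  shows "\<not> joint_reduction R d K M \<sigma> s"
proof
  assume "joint_reduction R d K M \<sigma> s"
  hence s: "sequence_of_type d K \<sigma> s" "rel_JR s {\<zero>\<^sub>M}" by (auto simp: joint_reduction_iff)
  obtain s' where s': "map snd s' = map snd s" "rel_FC_seq s' {\<zero>\<^sub>M}"
    "for_all_large d (\<lambda>v. U v \<subseteq> nfold s' {\<zero>\<^sub>M})"
    using rel_JR_imp_FC_seq[OF sm_zero_set P s(2)] by blast
  have cnt: "\<forall>i\<le>d. count_list (map snd s') i = \<sigma> i" using s(1) s'(1) by (simp add: sequence_of_type_def)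
  have z: "for_all_large d (\<lambda>v. iterated_diff d \<sigma> P (\<lambda>i. int (v i)) = 0)"
    using rel_P_zero_iff[OF sm_nfold[OF rel_FC_seq_in[OF s'(2)] sm_zero_set] rel_P_type[OF P s'(2) cnt]] s'(3) by simp
  obtain j where j: "j \<le> d" "\<sigma> j < \<tau> j" "\<forall>i\<le>d. \<sigma> i \<le> \<tau> i" using \<sigma> by (auto simp: type_less_def)
  \<comment> \<open>One unit below \<open>\<tau>\<close> in a coordinate where
    \<open>\<sigma>\<close> is smaller, so still at least \<open>\<sigma>\<close>; vanishing at
    large exponents passes from the difference for \<open>\<sigma>\<close> to the one for
    \<open>\<rho>\<close>.\<close>
  define \<rho> where "\<rho> = \<tau>(j := \<tau> j - 1)"
  have "\<forall>i\<le>d. \<sigma> i \<le> \<rho> i" using j by (auto simp: \<rho>_def)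
  hence z\<rho>: "for_all_large d (\<lambda>v. iterated_diff d \<rho> P (\<lambda>i. int (v i)) = 0)"
    using eventually_zero_fold_diff[OF set_type_list z] by (simp add: iterated_diff_add)
  show False
  proof (cases "j = 0")
    case True
    hence "\<rho> = \<kappa>" by (auto simp: \<rho>_def)
    thus False using z\<rho> const c by (auto simp: for_all_large_def)
  next
    case False
    hence kj: "0 < \<kappa> j" using j by auto
    \<comment> \<open>\<open>\<rho> = \<kappa>' + e_0\<close> and
      \<open>\<kappa> = \<kappa>' + e_j\<close>: the two differences of \<open>Q\<close> are zero at
      large exponents and \<open>c\<close>, respectively.\<close>
    define \<kappa>' where "\<kappa>' = \<kappa>(j := \<kappa> j - 1)"
    define Q where "Q = iterated_diff d \<kappa>' P"
    have Q0: "iterated_diff d \<rho> P = backward_diff 0 Q"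
      unfolding Q_def by (rule iterated_diff_step) (use False in \<open>auto simp: \<rho>_def \<kappa>'_def\<close>)
    have "iterated_diff d \<kappa> P = backward_diff j Q"
      unfolding Q_def by (rule iterated_diff_step[OF j(1)]) (use kj in \<open>auto simp: \<kappa>'_def\<close>)
    hence Qj: "backward_diff j Q = (\<lambda>_. c)" using const by simp
    obtain t where t: "rel_FC_seq t {\<zero>\<^sub>M}" "\<forall>i\<le>d. count_list (map snd t) i = \<kappa>' i"
      by (rule FC_seq_of_type_exists[of \<kappa>']) blast
    define N where "N = nfold t {\<zero>\<^sub>M}"
    have N: "sm N" unfolding N_def by (rule sm_nfold[OF rel_FC_seq_in[OF t(1)] sm_zero_set])
    have PN: "rel_P N Q" unfolding N_def Q_def by (rule rel_P_type[OF P t])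
    \<comment> \<open>\<open>no_growth\<close> counts in natural numbers; \<open>nat\<close> changes
      nothing at large exponents, where \<open>Q\<close> is a length.\<close>
    define g where "g v = nat (Q (\<lambda>i. int (v i)))" for v :: "nat \<Rightarrow> nat"
    have L: "for_all_large d (\<lambda>v. has_length (U (inc 0 v) \<uplus> N) (U v \<uplus> N) (g v) \<and> Q (\<lambda>i. int (v i)) = int (g v))"
      by (rule for_all_large_mono[OF PN[unfolded rel_P_def]]) (auto simp: g_def)
    have large_inc: "for_all_large d (\<lambda>v. \<forall>k\<le>d. B \<le> inc i v k)" for B i
      by (rule for_all_largeI[of _ B]) (auto intro: le_SucI)
    have incQ: "backward_diff i Q (\<lambda>k. int (inc i v k)) = Q (\<lambda>k. int (inc i v k)) - Q (\<lambda>k. int (v k))" for i v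
    proof -
      have "(\<lambda>k. int (inc i v k))(i := int (inc i v i) - 1) = (\<lambda>k. int (v k))" by (auto simp: fun_eq_iff)
      thus ?thesis unfolding backward_diff_def by (simp only:)
    qed
    have g0: "for_all_large d (\<lambda>v. g (inc 0 v) = g v)"
    proof (rule for_all_large_mono[OF for_all_large_comp[OF z\<rho> large_inc[of _ 0]]])
      fix v assume "iterated_diff d \<rho> P (\<lambda>k. int (inc 0 v k)) = 0"
      hence "Q (\<lambda>k. int (inc 0 v k)) = Q (\<lambda>k. int (v k))" unfolding Q0 incQ by simp
      thus "g (inc 0 v) = g v" unfolding g_def by (simp only:)
    qed
    have gj: "for_all_large d (\<lambda>v. g (inc j v) = g v + nat c)"
    proof (rule for_all_large_mono[OF L])
      fix v assume "has_length (U (inc 0 v) \<uplus> N) (U v \<uplus> N) (g v) \<and> Q (\<lambda>i. int (v i)) = int (g v)"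
      moreover have "Q (\<lambda>k. int (inc j v k)) = Q (\<lambda>k. int (v k)) + c"
        using incQ[of j v] unfolding Qj by linarith
      ultimately show "g (inc j v) = g v + nat c" unfolding g_def using c by linarith
    qed
    show False
      by (rule no_growth[OF N j(1) _ _ g0 gj]) (use c L in \<open>auto elim: for_all_large_mono\<close>)
  qed
qed

lemma FC_seq_joint_reduction:
  assumes "rel_FC_seq s {\<zero>\<^sub>M}" "\<forall>i\<le>d. count_list (map snd s) i = \<sigma> i" "for_all_large d (\<lambda>v. U v \<subseteq> nfold s {\<zero>\<^sub>M})"
  shows "joint_reduction R d K M \<sigma> s"
  unfolding joint_reduction_iff sequence_of_type_iff
  using rel_FC_seq_in[OF assms(1)] assms(2) FC_seq_rel_JR[OF assms(1) sm_zero_set assms(3)] by blast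

lemma rel_FC_seq_append: "rel_FC_seq (s @ t) N \<Longrightarrow> rel_FC_seq s N"
  by (induct s arbitrary: N) auto

text \<open>Because the last element is taken from \<open>J\<close>, omitting it lowers the type
  from \<open>\<tau>\<close> to \<open>\<kappa>\<close>.\<close>

lemma split_last:
  assumes n: "n = (\<Sum>i=0..d. \<kappa> i) + 1" and s: "length s = n" "snd (s ! (n - 1)) = 0"
    and FC: "rel_FC_seq s {\<zero>\<^sub>M}" and cnt: "\<forall>i\<le>d. count_list (map snd s) i = \<tau> i"
  shows "rel_FC_seq (take (n - 1) s) {\<zero>\<^sub>M}" "\<forall>i\<le>d. count_list (map snd (take (n - 1) s)) i = \<kappa> i"
proof -
  have ne: "s \<noteq> []" using n s by auto
  have "take (n - 1) s @ [s ! (n - 1)] = s"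
    using ne s(1) by (metis append_butlast_last_id butlast_conv_take last_conv_nth)
  then obtain x where sx: "s = take (n - 1) s @ [(x, 0)]" using s(2) by (metis prod.collapse)
  show "rel_FC_seq (take (n - 1) s) {\<zero>\<^sub>M}" using FC rel_FC_seq_append[of _ "[(x, 0)]"] sx by metis
  have "map snd s = map snd (take (n - 1) s) @ [0]" using arg_cong[OF sx, of "map snd"] by simp
  hence "count_list (map snd s) i = count_list (map snd (take (n - 1) s)) i + (if i = 0 then 1 else 0)" for i by simp
  thus "\<forall>i\<le>d. count_list (map snd (take (n - 1) s)) i = \<kappa> i" using cnt by (auto split: if_splits)
qed

lemma FC_seq_tau_exists:
  assumes n: "n = (\<Sum>i=0..d. \<kappa> i) + 1"
  obtains s where "rel_FC_seq s {\<zero>\<^sub>M}" "\<forall>i\<le>d. count_list (map snd s) i = \<tau> i" "length s = n" "snd (s ! (n - 1)) = 0"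
proof -
  obtain s where s: "map snd s = type_list d \<kappa> @ [0]" "rel_FC_seq s {\<zero>\<^sub>M}"
    using FC_seq_exists[OF sm_zero_set, of "type_list d \<kappa> @ [0]"] set_type_list by auto
  have len: "length s = n" using arg_cong[OF s(1), of length] n by (simp add: length_type_list)
  have "snd (s ! (n - 1)) = map snd s ! (n - 1)" using len n by simp
  also have "\<dots> = 0" unfolding s(1) using n by (simp add: nth_append length_type_list)
  finally have "snd (s ! (n - 1)) = 0" .
  moreover have "\<forall>i\<le>d. count_list (map snd s) i = \<tau> i" unfolding s(1) by (auto simp: count_type_list)
  ultimately show ?thesis using that s(2) len by blast
qed

text \<open>Every statement is compared with \<open>0 < c\<close>. For a weak-(FC)-sequence of type
  \<open>\<tau>\<close> that ends in \<open>J\<close>, maximality says just that \<open>IJ\<close>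
  is not nilpotent on the quotient by all but the last element, that is,
  \<open>c \<noteq> 0\<close>. If \<open>c = 0\<close>, omitting the last element leaves a joint
  reduction of type \<open>\<kappa>\<close>, which refutes (iv), (v) and (vi) at once.\<close>

theorem equivalences:
  assumes n: "n = (\<Sum>i=0..d. \<kappa> i) + 1"
  defines "ii \<equiv> \<forall>s. length s = n \<and> sequence_of_type d K \<tau> s \<and> snd (s ! (n - 1)) = 0 \<and>
                  weak_FC_sequence R d K M s \<longrightarrow> maximal_weak_FC_sequence R d K M s"
    and "iii \<equiv> \<exists>s. length s = n \<and> sequence_of_type d K \<tau> s \<and> snd (s ! (n - 1)) = 0 \<and>
                  maximal_weak_FC_sequence R d K M s"
    and "iv \<equiv> \<forall>s. length s = n \<and> joint_reduction R d K M \<tau> s \<and> snd (s ! (n - 1)) = 0 \<longrightarrow>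
                  \<not> joint_reduction R d K M \<kappa> (take (n - 1) s)"
    and "v \<equiv> \<forall>s. joint_reduction R d K M \<tau> s \<longrightarrow> minimal_joint_reduction R d K M \<tau> s"
    and "vi \<equiv> \<exists>s. minimal_joint_reduction R d K M \<tau> s"
  shows "(0 < c \<longleftrightarrow> ii) \<and> (0 < c \<longleftrightarrow> iii) \<and> (0 < c \<longleftrightarrow> iv) \<and> (0 < c \<longleftrightarrow> v) \<and> (0 < c \<longleftrightarrow> vi)"
proof -
  obtain s where s: "rel_FC_seq s {\<zero>\<^sub>M}" "\<forall>i\<le>d. count_list (map snd s) i = \<tau> i" "length s = n" "snd (s ! (n - 1)) = 0"
    by (rule FC_seq_tau_exists[OF n]) blast
  note s1 = split_last[OF n s(3,4,1,2)]
  have s_type: "sequence_of_type d K \<tau> s" unfolding sequence_of_type_iff using rel_FC_seq_in[OF s(1)] s(2) by blast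
  have s_JR: "joint_reduction R d K M \<tau> s" by (rule FC_seq_joint_reduction[OF s(1,2) tau_vanishes[OF s(1,2)]])
  have less: "type_less d \<kappa> \<tau>" by (auto simp: type_less_def)
  have c0: "0 \<le> c" by (rule const_nonneg_iff(1)[OF s1])
  have max: "maximal_weak_FC_sequence R d K M t \<longleftrightarrow> 0 < c"
    if t: "length t = n" "sequence_of_type d K \<tau> t" "snd (t ! (n - 1)) = 0" "weak_FC_sequence R d K M t" for t
  proof -
    have FC: "rel_FC_seq t {\<zero>\<^sub>M}" using t(4) weak_FC_sequence_iff by blast
    have tin: "seq_in t" by (rule rel_FC_seq_in[OF FC])
    have cnt: "\<forall>i\<le>d. count_list (map snd t) i = \<tau> i" using t(2) by (simp add: sequence_of_type_def)
    note t1 = split_last[OF n t(1,3) FC cnt]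
    have sm: "sm (nfold (take j t) {\<zero>\<^sub>M})" for j by (rule sm_nfold[OF seq_in_take[OF tin] sm_zero_set])
    have "t \<noteq> []" using t(1) n by auto
    moreover have "take (length t) t = t" by simp
    ultimately show ?thesis
      unfolding maximal_weak_FC_sequence_def quotient_by_initial_eq[OF tin] nilpotent_iff[OF sm]
      using t(4) const_nonneg_iff(2)[OF t1] tau_vanishes[OF FC cnt] c0 t(1) by auto
  qed
  have "0 < c \<longleftrightarrow> ii" unfolding ii_def using max s s_type weak_FC_sequence_iff by blast
  moreover have "0 < c \<longleftrightarrow> iii"
    unfolding iii_def using max s s_type weak_FC_sequence_iff maximal_weak_FC_sequence_def by blast
  moreover have pos: "iv \<and> v \<and> vi" if "0 < c"
    unfolding iv_def v_def vi_def minimal_joint_reduction_def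
    using no_smaller_joint_reduction[OF that] less s_JR by blast
  moreover have "\<not> iv \<and> \<not> v \<and> \<not> vi" if "\<not> 0 < c"
  proof -
    have "c = 0" using that c0 by simp
    hence "joint_reduction R d K M \<kappa> (take (n - 1) s)"
      using FC_seq_joint_reduction[OF s1] const_nonneg_iff(2)[OF s1] by blast
    thus ?thesis unfolding iv_def v_def vi_def minimal_joint_reduction_def using less s s_JR by blast
  qed
  ultimately show ?thesis by blast
qed

end

end

theorem proposition2p11:
  fixes A :: "('a, 'r) ring_scheme"
    and \<mm> :: "'a set"
    and M :: "('a, 'b, 'm) module_scheme"
    and J :: "'a set"
    and I :: "nat \<Rightarrow> 'a set"
    and d :: nat
    and k0 :: nat
    and k :: "nat \<Rightarrow> nat"
    and n :: nat
    and P :: "(nat \<Rightarrow> int) \<Rightarrow> int"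
  assumes "noetherian_ring A"
    and "local_ring A \<mm>"
    and "infinite (carrier (A Quot \<mm>))"
    and "module A M"
    and "finitely_generated_module A M"
    and "primary_to A \<mm> J"
    and "\<forall>i\<in>{1..d}. ideal (I i) A"
    and "is_hilbert_polynomial A d (I(0 := J)) M P"
    and "\<exists>c. \<forall>v. iterated_diff d (k(0 := k0)) P v = c"
    and "n = k0 + (\<Sum>i=1..d. k i) + 1"
  shows
    "let K = I(0 := J); \<tau> = k(0 := k0 + 1);
         i = (\<forall>v. 0 < iterated_diff d (k(0 := k0)) P v);
         ii = (\<forall>s. length s = n \<and> sequence_of_type d K \<tau> s \<and> snd (s ! (n - 1)) = 0 \<and>
                  weak_FC_sequence A d K M s \<longrightarrow> maximal_weak_FC_sequence A d K M s);
         iii = (\<exists>s. length s = n \<and> sequence_of_type d K \<tau> s \<and> snd (s ! (n - 1)) = 0 \<and>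
                  maximal_weak_FC_sequence A d K M s);
         iv = (\<forall>s. length s = n \<and> joint_reduction A d K M \<tau> s \<and> snd (s ! (n - 1)) = 0 \<longrightarrow>
                  \<not> joint_reduction A d K M (k(0 := k0)) (take (n - 1) s));
         v = (\<forall>s. joint_reduction A d K M \<tau> s \<longrightarrow> minimal_joint_reduction A d K M \<tau> s);
         vi = (\<exists>s. minimal_joint_reduction A d K M \<tau> s)
     in (i \<longleftrightarrow> ii) \<and> (i \<longleftrightarrow> iii) \<and> (i \<longleftrightarrow> iv) \<and> (i \<longleftrightarrow> v) \<and> (i \<longleftrightarrow> vi)"
proof -
  interpret M: module A M by (rule assms(4))
  have J: "ideal J A" "ideal_radical A J = \<mm>" using assms(6) by (auto simp: primary_to_def primary_ideal_def)
  have "J \<subseteq> \<mm>"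
  proof
    fix a assume a: "a \<in> J"
    hence "a \<in> carrier A" by (rule ideal.Icarr[OF J(1)])
    hence "a [^]\<^bsub>A\<^esub> (1::nat) \<in> J" using a by simp
    thus "a \<in> \<mm>" using \<open>a \<in> carrier A\<close> J(2) unfolding ideal_radical_def by blast
  qed
  have K: "ideal ((I(0 := J)) i) A" if "i \<le> d" for i using that assms(7) J(1) by (cases "i = 0") auto
  have K0: "(I(0 := J)) 0 \<subseteq> \<mm>" using \<open>J \<subseteq> \<mm>\<close> by simp
  interpret local_power_family A M d "I(0 := J)" \<mm>
    by (intro local_power_family.intro noetherian_power_family.intro power_family.intro
        power_family_axioms.intro noetherian_power_family_axioms.intro local_power_family_axioms.intro
        K K0 assms)
  obtain c where c: "\<And>v. iterated_diff d (k(0 := k0)) P v = c" using assms(9) by blast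
  hence const: "iterated_diff d (k(0 := k0)) P = (\<lambda>_. c)" by (rule ext)
  have "(\<Sum>i=0..d. (k(0 := k0)) i) = k0 + (\<Sum>i=1..d. k i)"
    by (simp add: sum.atLeast_Suc_atMost)
  hence n: "n = (\<Sum>i=0..d. (k(0 := k0)) i) + 1" using assms(10) by simp
  have \<tau>: "(k(0 := k0))(0 := Suc ((k(0 := k0)) 0)) = k(0 := k0 + 1)" by simp
  have all: "(\<forall>v::nat \<Rightarrow> int. 0 < c) \<longleftrightarrow> 0 < c" by simp
  show ?thesis
    unfolding Let_def c all by (rule equivalences[OF hilbert_rel_P[OF assms(8)] const n, unfolded \<tau>])
qed

end
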